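(* Let $A$ be a finite simple tracially $\mathcal{Z}$-absorbing C*-algebra. Then for every $x,a\in A_+$ with $\|a\|=1$, every finite set $F\subseteq A$, every $\varepsilon>0$, and every $n\in\mathbb{N}$, there is a c.p.c. order zero map $\varphi\colon M_n\to A$ such that: (1) $(x^2-x\varphi(1)x-\varepsilon)_+\precsim a$; (2) $\|[\varphi(z),b]\|<\varepsilon$ for any $z\in M_n$ with $\|z\|\le1$ and any $b\in F$; (3) $\|\varphi(1)a\varphi(1)\|>1-\varepsilon$.
   Context: C*-algebras are not assumed unital. A unital C*-algebra is finite if its unit is a finite projection (equivalently, all one-sided invertible elements are two-sided invertible); a nonunital C*-algebra $A$ is finite if its unitization is finite in this sense. For positive elements $a,b$ of a C*-algebra $A$, $a \precsim b$ (Cuntz subequivalence) means there is a sequence $(v_n)$ in $A$ with $\|a - v_n b v_n^*\| \to 0$. For self-adjoint $c$ and $\varepsilon>0$, $(c-\varepsilon)_+$ is obtained by applying $t \mapsto \max(t-\varepsilon,0)$. $M_n=M_n(\mathbb{C})$, $[y,z]=yz-zy$. A completely positive contractive (c.p.c.) map $\varphi$ has order zero if $\varphi(y)\varphi(z)=0$ whenever $y,z$ are positive with $yz=0$. A simple C*-algebra $A$ is tracially $\mathcal{Z}$-absorbing if $A \not\cong \mathbb{C}$ and for every $x,a \in A_+$ with $a \neq 0$, every finite set $F \subseteq A$, every $\varepsilon>0$, and every $n \in \mathbb{N}$, there is a c.p.c. order zero map $\varphi\colon M_n \to A$ such that (i) $(x^2 - x\varphi(1)x - \varepsilon)_+ \precsim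 a$, and (ii) $\|[\varphi(z),b]\| < \varepsilon$ for all $z \in M_n$ with $\|z\| \le 1$ and all $b \in F$. *)

theory Defs
  imports "HOL-Analysis.L2_Norm" "Jordan_Normal_Form.Matrix"
begin

section \<open>C*-algebras, not necessarily unital\<close>

class star_algebra = ring +
  fixes scaleC :: "complex \<Rightarrow> 'a \<Rightarrow> 'a" (infixr "*\<^sub>C" 75)
    and star :: "'a \<Rightarrow> 'a"
  assumes scaleC_add_right: "c *\<^sub>C (x + y) = c *\<^sub>C x + c *\<^sub>C y"
    and scaleC_add_left: "(c + d) *\<^sub>C x = c *\<^sub>C x + d *\<^sub>C x"
    and scaleC_scaleC: "c *\<^sub>C d *\<^sub>C x = (c * d) *\<^sub>C x"
    and scaleC_one: "1 *\<^sub>C x = x"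
    and mult_scaleC_left: "(c *\<^sub>C x) * y = c *\<^sub>C (x * y)"
    and mult_scaleC_right: "x * (c *\<^sub>C y) = c *\<^sub>C (x * y)"
    and star_star: "star (star x) = x"
    and star_add: "star (x + y) = star x + star y"
    and star_mult: "star (x * y) = star y * star x"
    and star_scaleC: "star (c *\<^sub>C x) = cnj c *\<^sub>C star x"

text \<open>The library only has real Banach algebras; the real structure is tied to the complex one.\<close>

class cstar_algebra = star_algebra + real_normed_algebra + banach +
  assumes scaleR_scaleC: "r *\<^sub>R x = complex_of_real r *\<^sub>C x"
    and norm_scaleC: "norm (c *\<^sub>C x) = cmod c * norm x"
    and cstar_identity: "norm (star x * x) = (norm x)\<^sup>2"

instantiation complex :: cstar_algebra
begin

definition scaleC_complex :: "complex \<Rightarrow> complex \<Rightarrow> complex"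
  where "scaleC_complex c x = c * x"

definition star_complex :: "complex \<Rightarrow> complex"
  where "star_complex = cnj"

instance
  by standard
    (simp_all add: scaleC_complex_def star_complex_def algebra_simps norm_mult power2_eq_square
      scaleR_conv_of_real)

end

definition star_isomorphism :: "('a::star_algebra \<Rightarrow> 'b::star_algebra) \<Rightarrow> bool" where
  "star_isomorphism f \<longleftrightarrow> bij f \<and>
    (\<forall>x y. f (x + y) = f x + f y) \<and> (\<forall>c x. f (c *\<^sub>C x) = c *\<^sub>C f x) \<and>
    (\<forall>x y. f (x * y) = f x * f y) \<and> (\<forall>x. f (star x) = star (f x))"

definition closed_ideal :: "'a::cstar_algebra set \<Rightarrow> bool" where
  "closed_ideal I \<longleftrightarrow> closed I \<and> 0 \<in> I \<and>
    (\<forall>x\<in>I. \<forall>y\<in>I. x + y \<in> I) \<and> (\<forall>c. \<forall>x\<in>I. c *\<^sub>C x \<in> I) \<and>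
    (\<forall>x\<in>I. \<forall>y. x * y \<in> I \<and> y * x \<in> I)"

definition simple_cstar :: "'a::cstar_algebra itself \<Rightarrow> bool" where
  "simple_cstar _ \<longleftrightarrow> (\<forall>I::'a set. closed_ideal I \<longrightarrow> I = {0} \<or> I = UNIV)"

definition positive :: "'a::star_algebra \<Rightarrow> bool" where
  "positive a \<longleftrightarrow> (\<exists>y. a = star y * y)"


section \<open>Unitization\<close>

text \<open>
  \<open>Unitization c x\<close> stands for \<open>c 1 + x\<close>. A new unit is always adjoined, also to algebras
  that already have one. Only the *-algebra structure is used, so no norm is put on the unitization.
\<close>

datatype 'a unitization = Unitization (scalar_part: complex) (algebra_part: 'a)

instantiation unitization :: (star_algebra) "{ring_1, star_algebra}"
begin

definition zero_unitization :: "'a unitization"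
  where "0 = Unitization 0 0"

definition one_unitization :: "'a unitization"
  where "1 = Unitization 1 0"

fun plus_unitization :: "'a unitization \<Rightarrow> 'a unitization \<Rightarrow> 'a unitization"
  where "Unitization c x + Unitization d y = Unitization (c + d) (x + y)"

fun minus_unitization :: "'a unitization \<Rightarrow> 'a unitization \<Rightarrow> 'a unitization"
  where "Unitization c x - Unitization d y = Unitization (c - d) (x - y)"

fun uminus_unitization :: "'a unitization \<Rightarrow> 'a unitization"
  where "- Unitization c x = Unitization (- c) (- x)"

fun times_unitization :: "'a unitization \<Rightarrow> 'a unitization \<Rightarrow> 'a unitization"
  where "Unitization c x * Unitization d y =
    Unitization (c * d) (c *\<^sub>C y + d *\<^sub>C x + x * y)"

fun scaleC_unitization :: "complex \<Rightarrow> 'a unitization \<Rightarrow> 'a unitization"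
  where "c *\<^sub>C Unitization d x = Unitization (c * d) (c *\<^sub>C x)"

fun star_unitization :: "'a unitization \<Rightarrow> 'a unitization"
  where "star (Unitization c x) = Unitization (cnj c) (star x)"

instance
proof
  have scaleC_0: "c *\<^sub>C (0::'a) = 0" for c
    using scaleC_add_right[of c "0::'a" 0] by simp
  have scaleC_0_left: "0 *\<^sub>C x = 0" for x :: 'a
    using scaleC_add_left[of 0 0 x] by simp
  note defs = zero_unitization_def one_unitization_def scaleC_0 scaleC_0_left
  note laws = scaleC_add_right scaleC_add_left scaleC_scaleC scaleC_one
    mult_scaleC_left mult_scaleC_right star_star star_add star_mult star_scaleC
  fix a b e :: "'a unitization" and c d :: complex
  show "a + b + e = a + (b + e)" "a + b = b + a" "0 + a = a" "- a + a = 0" "a - b = a + - b"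
    by (cases a; cases b; cases e; simp add: defs algebra_simps)+
  show "a * b * e = a * (b * e)" "(a + b) * e = a * e + b * e" "a * (b + e) = a * b + a * e"
    by (cases a; cases b; cases e; simp add: defs laws algebra_simps)+
  show "1 * a = a" "a * 1 = a" "(0::'a unitization) \<noteq> 1"
    by (cases a; simp add: defs laws)+
  show "c *\<^sub>C (a + b) = c *\<^sub>C a + c *\<^sub>C b" "(c + d) *\<^sub>C a = c *\<^sub>C a + d *\<^sub>C a"
    "c *\<^sub>C d *\<^sub>C a = (c * d) *\<^sub>C a" "1 *\<^sub>C a = a"
    "(c *\<^sub>C a) * b = c *\<^sub>C (a * b)" "a * (c *\<^sub>C b) = c *\<^sub>C (a * b)"
    by (cases a; cases b; simp add: defs laws algebra_simps)+
  show "star (star a) = a" "star (a + b) = star a + star b" "star (a * b) = star b * star a"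
    "star (c *\<^sub>C a) = cnj c *\<^sub>C star a"
    by (cases a; cases b; simp add: defs laws algebra_simps)+
qed

end


section \<open>Finiteness\<close>

definition projection :: "'a::star_algebra \<Rightarrow> bool" where
  "projection p \<longleftrightarrow> p * p = p \<and> star p = p"

definition mvn_equivalent :: "'a::star_algebra \<Rightarrow> 'a \<Rightarrow> bool" where
  "mvn_equivalent p q \<longleftrightarrow> (\<exists>v. star v * v = p \<and> v * star v = q)"

text \<open>For projections, \<open>q \<le> p\<close> means \<open>p q = q\<close>.\<close>

definition finite_projection :: "'a::star_algebra \<Rightarrow> bool" where
  "finite_projection p \<longleftrightarrow> projection p \<and>
    (\<forall>q. projection q \<and> p * q = q \<and> mvn_equivalent p q \<longrightarrow> q = p)"

definition is_unit_element :: "'a::star_algebra \<Rightarrow> bool" where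
  "is_unit_element e \<longleftrightarrow> (\<forall>x. e * x = x \<and> x * e = x)"

definition finite_cstar :: "'a::cstar_algebra itself \<Rightarrow> bool" where
  "finite_cstar _ \<longleftrightarrow>
    (if \<exists>e::'a. is_unit_element e
     then finite_projection (THE e::'a. is_unit_element e)
     else finite_projection (1 :: 'a unitization))"


section \<open>Continuous functional calculus\<close>

text \<open>
  The spectrum is taken in the unitization and hence always contains \<open>0\<close>; for unital
  algebras it is the usual spectrum together with \<open>0\<close>. Since only functions vanishing at \<open>0\<close>
  are applied, this does not affect the functional calculus.
\<close>

definition spectrum :: "'a::cstar_algebra \<Rightarrow> complex set" where
  "spectrum c = {z. \<not> (\<exists>y. Unitization (- z) c * y = 1 \<and> y * Unitization (- z) c = 1)}"

definition spectrum_fun :: "'a::cstar_algebra \<Rightarrow> (complex \<Rightarrow> complex) set" where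
  "spectrum_fun c = {f. continuous_on (spectrum c) f \<and> f 0 = 0}"

text \<open>
  \<open>functional_calculus_hom c \<Phi>\<close>: \<open>\<Phi>\<close> is a *-homomorphism to the algebra from the
  continuous functions on the spectrum of \<open>c\<close> that vanish at \<open>0\<close>, and it maps the identity
  function to \<open>c\<close>. For normal \<open>c\<close> there is exactly one (up to its values outside
  \<open>spectrum_fun c\<close>).
\<close>

definition functional_calculus_hom ::
    "'a::cstar_algebra \<Rightarrow> ((complex \<Rightarrow> complex) \<Rightarrow> 'a) \<Rightarrow> bool" where
  "functional_calculus_hom c \<Phi> \<longleftrightarrow>
    (\<forall>f\<in>spectrum_fun c. \<forall>g\<in>spectrum_fun c. (\<forall>z\<in>spectrum c. f z = g z) \<longrightarrow> \<Phi> f = \<Phi> g) \<and>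
    (\<forall>f\<in>spectrum_fun c. \<forall>g\<in>spectrum_fun c.
      \<Phi> (\<lambda>z. f z + g z) = \<Phi> f + \<Phi> g \<and> \<Phi> (\<lambda>z. f z * g z) = \<Phi> f * \<Phi> g) \<and>
    (\<forall>f\<in>spectrum_fun c.
      (\<forall>k. \<Phi> (\<lambda>z. k * f z) = k *\<^sub>C \<Phi> f) \<and> \<Phi> (\<lambda>z. cnj (f z)) = star (\<Phi> f)) \<and>
    \<Phi> (\<lambda>z. z) = c"

definition functional_calculus :: "(complex \<Rightarrow> complex) \<Rightarrow> 'a::cstar_algebra \<Rightarrow> 'a" where
  "functional_calculus f c = (THE y. \<exists>\<Phi>. functional_calculus_hom c \<Phi> \<and> \<Phi> f = y)"

text \<open>\<open>cut_down c \<epsilon>\<close> is \<open>(c - \<epsilon>)\<^sub>+\<close>, for self-adjoint \<open>c\<close> (whose spectrum is real).\<close>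

definition cut_down :: "'a::cstar_algebra \<Rightarrow> real \<Rightarrow> 'a" where
  "cut_down c \<epsilon> = functional_calculus (\<lambda>t. complex_of_real (max (Re t - \<epsilon>) 0)) c"

definition cuntz_below :: "'a::cstar_algebra \<Rightarrow> 'a \<Rightarrow> bool" (infix "\<precsim>" 50) where
  "a \<precsim> b \<longleftrightarrow> (\<exists>v :: nat \<Rightarrow> 'a. (\<lambda>n. norm (a - v n * b * star (v n))) \<longlonglongrightarrow> 0)"


section \<open>Completely positive contractive order zero maps\<close>

definition mat_star :: "'a::star_algebra mat \<Rightarrow> 'a mat" where
  "mat_star B = mat (dim_col B) (dim_row B) (\<lambda>(i, j). star (B $$ (j, i)))"

definition mat_positive :: "nat \<Rightarrow> 'a::star_algebra mat \<Rightarrow> bool" where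
  "mat_positive k B \<longleftrightarrow> (\<exists>C \<in> carrier_mat k k. B = mat_star C * C)"

definition euclidean_norm :: "complex vec \<Rightarrow> real" where
  "euclidean_norm v = L2_set (\<lambda>i. cmod (v $ i)) {..<dim_vec v}"

definition operator_norm :: "complex mat \<Rightarrow> real" where
  "operator_norm z =
    (SUP v \<in> {v \<in> carrier_vec (dim_col z). euclidean_norm v \<le> 1}. euclidean_norm (z *\<^sub>v v))"

text \<open>
  \<open>M\<^sub>k(M\<^sub>n)\<close> is identified with \<open>M\<^sub>k\<^sub>n\<close> via \<open>n \<times> n\<close> blocks;
  \<open>amplification n \<phi> k\<close> is the map \<open>M\<^sub>k(M\<^sub>n) \<rightarrow> M\<^sub>k(A)\<close> that applies \<open>\<phi>\<close> to each block.
\<close>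

definition mat_block :: "nat \<Rightarrow> complex mat \<Rightarrow> nat \<Rightarrow> nat \<Rightarrow> complex mat" where
  "mat_block n B i j = mat n n (\<lambda>(p, q). B $$ (i * n + p, j * n + q))"

definition amplification ::
    "nat \<Rightarrow> (complex mat \<Rightarrow> 'a) \<Rightarrow> nat \<Rightarrow> complex mat \<Rightarrow> 'a mat" where
  "amplification n \<phi> k B = mat k k (\<lambda>(i, j). \<phi> (mat_block n B i j))"

text \<open>Maps \<open>M\<^sub>n \<rightarrow> A\<close> are HOL functions whose values outside \<open>carrier_mat n n\<close> are irrelevant.\<close>

definition linear_on_mat :: "nat \<Rightarrow> (complex mat \<Rightarrow> 'a::star_algebra) \<Rightarrow> bool" where
  "linear_on_mat n \<phi> \<longleftrightarrow>
    (\<forall>y \<in> carrier_mat n n. \<forall>z \<in> carrier_mat n n. \<phi> (y + z) = \<phi> y + \<phi> z) \<and>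
    (\<forall>c. \<forall>z \<in> carrier_mat n n. \<phi> (c \<cdot>\<^sub>m z) = c *\<^sub>C \<phi> z)"

definition completely_positive :: "nat \<Rightarrow> (complex mat \<Rightarrow> 'a::star_algebra) \<Rightarrow> bool" where
  "completely_positive n \<phi> \<longleftrightarrow>
    (\<forall>k. \<forall>B. mat_positive (k * n) B \<longrightarrow> mat_positive k (amplification n \<phi> k B))"

definition contractive :: "nat \<Rightarrow> (complex mat \<Rightarrow> 'a::cstar_algebra) \<Rightarrow> bool" where
  "contractive n \<phi> \<longleftrightarrow> (\<forall>z \<in> carrier_mat n n. norm (\<phi> z) \<le> operator_norm z)"

definition order_zero :: "nat \<Rightarrow> (complex mat \<Rightarrow> 'a::star_algebra) \<Rightarrow> bool" where
  "order_zero n \<phi> \<longleftrightarrow>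
    (\<forall>y z. mat_positive n y \<and> mat_positive n z \<and> y * z = 0\<^sub>m n n \<longrightarrow> \<phi> y * \<phi> z = 0)"

definition cpc_order_zero :: "nat \<Rightarrow> (complex mat \<Rightarrow> 'a::cstar_algebra) \<Rightarrow> bool" where
  "cpc_order_zero n \<phi> \<longleftrightarrow>
    linear_on_mat n \<phi> \<and> completely_positive n \<phi> \<and> contractive n \<phi> \<and> order_zero n \<phi>"


section \<open>Tracial Z-absorption\<close>

definition commutator :: "'a::ring \<Rightarrow> 'a \<Rightarrow> 'a" where
  "commutator y z = y * z - z * y"

definition tracially_Z_absorbing :: "'a::cstar_algebra itself \<Rightarrow> bool" where
  "tracially_Z_absorbing _ \<longleftrightarrow>
    \<not> (\<exists>f :: 'a \<Rightarrow> complex. star_isomorphism f) \<and>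
    (\<forall>(x::'a) a F (\<epsilon>::real) n.
      positive x \<and> positive a \<and> a \<noteq> 0 \<and> finite F \<and> \<epsilon> > 0 \<and> n \<ge> 1 \<longrightarrow>
      (\<exists>\<phi>. cpc_order_zero n \<phi> \<and>
        cut_down (x * x - x * \<phi> (1\<^sub>m n) * x) \<epsilon> \<precsim> a \<and>
        (\<forall>z \<in> carrier_mat n n. operator_norm z \<le> 1 \<longrightarrow>
          (\<forall>b\<in>F. norm (commutator (\<phi> z) b) < \<epsilon>))))"

end

theory Submission
  imports Defs "HOL-Analysis.Weierstrass_Theorems" "HOL-Analysis.Complex_Transcendental"
    "HOL-Computational_Algebra.Fundamental_Theorem_Algebra"
begin

text \<open>
  Given \<open>a\<close> of norm one, choose a spectral cut-off \<open>c\<close> of \<open>a\<close> near \<open>1\<close> together with nonzero orthogonal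
  self-adjoint elements \<open>s\<close>, \<open>d\<close> on which \<open>c\<close> acts as a unit; a simple tracially \<open>\<Z>\<close>-absorbing algebra has
  no minimal projections, so such a pair exists. Apply the definition with \<open>s\<^sup>2\<close> in place of \<open>a\<close>, an
  approximate unit \<open>h\<close> for \<open>x\<close> and \<open>c\<close> in place of \<open>x\<close>, and a small tolerance. As \<open>s\<^sup>2 \<precsim> a\<close>, (1) and (2)
  follow. If \<open>\<parallel>\<phi>(1) a \<phi>(1)\<parallel>\<close> were at most \<open>1 - \<epsilon>\<close>, then \<open>1 - \<phi>(1)\<close> would be bounded below on the support of
  \<open>c\<close>, so \<open>c\<^sup>2\<close> would be nearly of the form \<open>v s\<^sup>2 v\<^sup>*\<close>. Then \<open>s v\<^sup>* + (1 - c\<^sup>2)\<^sup>1\<^sup>/\<^sup>2\<close> is nearly an isometry whose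
  range is orthogonal to \<open>d\<close>, contradicting finiteness.
\<close>

section \<open>Spectrum and spectral radius\<close>

text \<open>Condition (1) measures the defect only in the Cuntz order, so by itself it would let
  \<open>e = \<phi>(1)\<close> be small exactly where \<open>a\<close> attains its norm. Requiring
  the defect to lie below \<open>s\<^sup>2\<close> prevents this: \<open>c\<close> is a unit for
  \<open>s\<close> and also for \<open>d\<close>, which is orthogonal to \<open>s\<close>, so
  \<open>c\<^sup>2\<close> is properly larger than \<open>s\<^sup>2\<close>, and finiteness forbids
  comparing it down to \<open>s\<^sup>2\<close>. The definition controls the defect of one positive
  element, whereas (1) concerns \<open>x\<close> and the contradiction concerns \<open>c\<close>. As
  \<open>h\<close> nearly fixes both, both defects are read off the one at \<open>h\<close>. The
  element \<open>c\<close> joins the finite set because \<open>e c a c e\<close> and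
  \<open>c e a e c\<close> have to be compared. The calculus behind \<open>cut_down\<close> is given
  by a description on functions vanishing at 0. It is constructed in the unitization, equipped with
  a C*-norm, and a value \<open>f 0 = 0\<close> is what brings results back into the
  algebra.\<close>

lemma scaleC_zero_right [simp]: "c *\<^sub>C (0::'a::star_algebra) = 0"
  using scaleC_add_right[of c "0::'a" 0] by simp

lemma scaleC_zero_left [simp]: "0 *\<^sub>C (x::'a::star_algebra) = 0"
  using scaleC_add_left[of 0 0 x] by simp

lemma scaleC_minus_right [simp]: "c *\<^sub>C (- x) = - (c *\<^sub>C (x::'a::star_algebra))"
  using scaleC_add_right[of c x "- x"] by (simp add: eq_neg_iff_add_eq_0 add.commute)

lemma scaleC_minus_left [simp]: "(- c) *\<^sub>C x = - (c *\<^sub>C (x::'a::star_algebra))"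
  using scaleC_add_left[of c "- c" x] by (simp add: eq_neg_iff_add_eq_0 add.commute)

lemma scaleC_diff_right: "c *\<^sub>C (x - y) = c *\<^sub>C x - c *\<^sub>C (y::'a::star_algebra)"
  using scaleC_add_right[of c x "- y"] by simp

lemma scaleC_diff_left: "(c - d) *\<^sub>C x = c *\<^sub>C x - d *\<^sub>C (x::'a::star_algebra)"
  using scaleC_add_left[of c "- d" x] by simp

declare scaleC_one [simp] scaleC_scaleC [simp] mult_scaleC_left [simp] mult_scaleC_right [simp]
  star_star [simp] star_scaleC [simp]

lemma star_zero [simp]: "star (0::'a::star_algebra) = 0"
  using star_add[of "0::'a" 0] by simp

lemma star_minus [simp]: "star (- x) = - star (x::'a::star_algebra)"
  using star_add[of x "- x"] by (simp add: eq_neg_iff_add_eq_0 add.commute)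

lemma star_diff: "star (x - y) = star x - star (y::'a::star_algebra)"
  using star_add[of x "- y"] by simp

lemma star_one [simp]: "star (1::'a::{ring_1,star_algebra}) = 1"
  using star_mult[of "star (1::'a)" 1] by simp

lemma star_power: "star (x ^ n) = star (x::'a::{ring_1,star_algebra}) ^ n"
  by (induction n) (simp_all add: star_mult power_commutes)

lemma star_scaleR [simp]: "star (r *\<^sub>R x) = r *\<^sub>R star (x::'a::cstar_algebra)"
  by (simp add: scaleR_scaleC)

lemma norm_star [simp]: "norm (star x) = norm (x::'a::cstar_algebra)"
proof -
  have le: "norm y \<le> norm (star y)" for y :: 'a
  proof (cases "y = 0")
    case False
    have "(norm y)\<^sup>2 \<le> norm (star y) * norm y"
      using norm_mult_ineq[of "star y" y] by (simp add: cstar_identity)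
    then show ?thesis using False by (simp add: power2_eq_square)
  qed simp
  show ?thesis using le[of x] le[of "star x"] by simp
qed

lemma cstar_identity': "norm (x * star x) = (norm (x::'a::cstar_algebra))\<^sup>2"
  using cstar_identity[of "star x"] by simp

lemma bounded_linear_star: "bounded_linear (star :: 'a::cstar_algebra \<Rightarrow> 'a)"
  by (intro bounded_linear_intro[where K=1]) (simp_all add: star_add)

lemmas tendsto_star [tendsto_intros] = bounded_linear.tendsto[OF bounded_linear_star]

lemma bounded_linear_scaleC_left: "bounded_linear (\<lambda>c. c *\<^sub>C (x::'a::cstar_algebra))"
proof (intro bounded_linear_intro[where K="norm x"])
  show "(r *\<^sub>R c) *\<^sub>C x = r *\<^sub>R c *\<^sub>C x" for r c
    by (simp add: scaleR_scaleC[where 'a='a] scaleR_conv_of_real)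
qed (simp_all add: scaleC_add_left norm_scaleC)

lemma bounded_linear_scaleC_right: "bounded_linear (\<lambda>x::'a::cstar_algebra. c *\<^sub>C x)"
  by (intro bounded_linear_intro[where K="cmod c"])
    (simp_all add: scaleC_add_right norm_scaleC scaleR_scaleC mult.commute)

lemmas tendsto_scaleC_left [tendsto_intros] = bounded_linear.tendsto[OF bounded_linear_scaleC_left]

text \<open>Spectral theory is carried out in this class. Its instance is the unitization, through
  which the results reach algebras without a unit.\<close>

class unital_cstar_algebra = cstar_algebra + real_normed_algebra_1

section \<open>Inverses and averaged resolvents\<close>

definition inverse_of :: "'a::ring_1 \<Rightarrow> 'a \<Rightarrow> bool" where
  "inverse_of x y \<longleftrightarrow> x * y = 1 \<and> y * x = 1"

definition spec :: "'a::{ring_1,star_algebra} \<Rightarrow> complex set" where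
  "spec x = {z. \<not> (\<exists>y. inverse_of (x - z *\<^sub>C 1) y)}"

lemma inverse_ofI_left_right:
  assumes "x * y = 1" "z * x = (1::'a::ring_1)"
  shows "inverse_of x y"
proof -
  have "z = y" using assms by (metis mult.assoc mult_1_left mult_1_right)
  then show ?thesis using assms by (simp add: inverse_of_def)
qed

lemma neumann_inverse:
  fixes x :: "'a::{real_normed_algebra_1,banach}"
  assumes "norm x < 1"
  shows "\<exists>y. inverse_of (1 - x) y"
proof -
  have s: "summable (\<lambda>n. x ^ n)"
    using complete_algebra_summable_geometric[OF assms] .
  define y where "y = (\<Sum>n. x ^ n)"
  have y: "y = 1 + (\<Sum>n. x ^ Suc n)"
    using suminf_split_head[OF s] by (simp add: y_def)
  have "(\<Sum>n. x ^ Suc n) = x * y"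
    using suminf_mult[OF s, of x] by (simp add: y_def)
  moreover have "(\<Sum>n. x ^ Suc n) = y * x"
    using suminf_mult2[OF s, of x] by (simp add: y_def power_commutes)
  ultimately show ?thesis using y
    by (intro exI[of _ y]) (simp add: inverse_of_def algebra_simps)
qed

text \<open>The identity \<open>y' - y = y' * (x - x') * y\<close> first yields
  \<open>norm y' <= 2 * norm y\<close> and then the quadratic bound, so nothing about
  \<open>y'\<close> has to be known beforehand.\<close>

lemma inverse_close:
  fixes x :: "'a::real_normed_algebra_1"
  assumes "inverse_of x y" "inverse_of x' y'" "norm (x - x') * norm y \<le> 1 / 2"
  shows "norm (y' - y) \<le> 2 * (norm y)\<^sup>2 * norm (x - x')"
proof -
  have "y' - y = y' * (x - x') * y"
  proof -
    have "y' * (x - x') * y = y' * (x * y) - (y' * x') * y" by (simp add: algebra_simps)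
    then show ?thesis using assms(1,2) by (simp add: inverse_of_def)
  qed
  then have *: "norm (y' - y) \<le> norm y' * (norm (x - x') * norm y)"
    by (metis (no_types) mult.assoc norm_mult_ineq order_trans mult_left_mono norm_ge_zero)
  also have "\<dots> \<le> norm y' * (1 / 2)"
    using assms(3) by (intro mult_left_mono) auto
  finally have "norm y' \<le> 2 * norm y"
    using norm_triangle_ineq2[of y' y] by simp
  then have "norm y' * (norm (x - x') * norm y) \<le> (2 * norm y) * (norm (x - x') * norm y)"
    by (intro mult_right_mono) auto
  with * show ?thesis by (simp add: power2_eq_square mult_ac)
qed

lemma sum_root_of_unity_powers:
  assumes "n \<ge> 1" "j < n"
  defines "w \<equiv> exp (2 * of_real pi * \<i> / of_nat n)"
  shows "(\<Sum>k<n. (w ^ k) ^ j) = (if j = 0 then of_nat n else 0)"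
proof (cases "j = 0")
  case False
  have wj: "w ^ j = exp (2 * of_real pi * \<i> * of_nat j / of_nat n)" for j
    unfolding w_def by (simp add: exp_of_nat_mult[symmetric] mult_ac)
  have "w ^ j \<noteq> 1"
    using complex_root_unity_eq_1[OF assms(1), of j] False assms(2) wj
    by (auto dest: dvd_imp_le)
  moreover have "(w ^ j) ^ n = 1"
  proof -
    have "w ^ n = 1" using complex_root_unity_eq_1[OF assms(1), of n] wj by simp
    then show ?thesis by (metis mult.commute power_mult power_one)
  qed
  ultimately have "(\<Sum>k<n. (w ^ j) ^ k) = 0"
    by (simp add: sum_gp_strict)
  then show ?thesis using False by (simp add: power_mult[symmetric] mult.commute)
qed simp

lemma star_algebra_power_scaleC:
  "(c *\<^sub>C (x::'a::{ring_1,star_algebra})) ^ n = (c ^ n) *\<^sub>C x ^ n"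
  by (induction n) (simp_all add: mult.commute)

lemma ring_geometric_sum: "(\<Sum>j<n. x ^ j) * (1 - x) = 1 - (x::'a::ring_1) ^ n"
proof (induction n)
  case (Suc n)
  have "(\<Sum>j<Suc n. x ^ j) * (1 - x) = (\<Sum>j<n. x ^ j) * (1 - x) + x ^ n * (1 - x)"
    by (simp add: distrib_right)
  also have "\<dots> = 1 - x ^ Suc n"
    by (simp only: Suc.IH) (simp add: right_diff_distrib power_commutes)
  finally show ?case .
qed simp

lemma scaleC_sum_left: "(\<Sum>i\<in>I. f i) *\<^sub>C (x::'a::star_algebra) = (\<Sum>i\<in>I. f i *\<^sub>C x)"
  by (induction I rule: infinite_finite_induct) (simp_all add: scaleC_add_left)

text \<open>Averaging the resolvent over the \<open>n\<close>-th roots of unity gives the resolvent of \<open>a\<^sup>n\<close>. Its uniform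
  continuity in the radius then controls the powers of \<open>a\<close> without complex analysis (Rickart).\<close>

lemma resolvent_average:
  fixes a :: "'a::{ring_1,star_algebra}"
  assumes R: "\<And>z. cmod z \<le> 1 \<Longrightarrow> inverse_of (1 - z *\<^sub>C a) (R z)"
    and n: "n \<ge> 1" and z: "cmod z \<le> 1"
  defines "w \<equiv> exp (2 * of_real pi * \<i> / of_nat n)"
  shows "(1 - z ^ n *\<^sub>C a ^ n) * ((1 / of_nat n) *\<^sub>C (\<Sum>k<n. R (w ^ k * z))) = 1"
proof -
  have w1: "cmod w = 1" by (simp add: w_def)
  have wn: "w ^ n = 1"
    using complex_root_unity_eq_1[OF n, of n] n by (simp add: w_def exp_of_nat_mult[symmetric])
  have 1: "(1 - z ^ n *\<^sub>C a ^ n) * R (w ^ k * z) = (\<Sum>j<n. (w ^ k) ^ j *\<^sub>C (z ^ j *\<^sub>C a ^ j))" for k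
  proof -
    let ?b = "(w ^ k * z) *\<^sub>C a"
    have "(w ^ k) ^ n = 1" by (metis wn mult.commute power_mult power_one)
    then have "z ^ n *\<^sub>C a ^ n = ?b ^ n"
      by (simp add: star_algebra_power_scaleC power_mult_distrib)
    then have "1 - z ^ n *\<^sub>C a ^ n = (\<Sum>j<n. ?b ^ j) * (1 - ?b)"
      by (simp add: ring_geometric_sum)
    moreover have "(1 - ?b) * R (w ^ k * z) = 1"
      using R[of "w ^ k * z"] z w1 by (simp add: inverse_of_def norm_mult norm_power)
    ultimately show ?thesis
      by (simp add: mult.assoc star_algebra_power_scaleC power_mult_distrib)
  qed
  have "(1 - z ^ n *\<^sub>C a ^ n) * (\<Sum>k<n. R (w ^ k * z))
      = (\<Sum>k<n. \<Sum>j<n. (w ^ k) ^ j *\<^sub>C (z ^ j *\<^sub>C a ^ j))"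
    by (simp only: sum_distrib_left 1)
  also have "\<dots> = (\<Sum>j<n. (\<Sum>k<n. (w ^ k) ^ j) *\<^sub>C (z ^ j *\<^sub>C a ^ j))"
    by (subst sum.swap) (simp only: scaleC_sum_left)
  also have "\<dots> = (\<Sum>j<n. if j = 0 then of_nat n *\<^sub>C 1 else 0)"
    using sum_root_of_unity_powers[OF n] unfolding w_def by (intro sum.cong) auto
  also have "\<dots> = of_nat n *\<^sub>C 1"
    using n by (simp add: sum.delta)
  finally show ?thesis using n by simp
qed

text \<open>Continuation in the radius, with \<open>P r\<close> saying that \<open>r^n a^n\<close>
  tends to 0. Under \<open>P r\<close> the averages at \<open>r\<close> are near 1, so those at a
  nearby \<open>r'\<close> are within 1/2 of 1, which bounds their inverses
  \<open>1 - r'^n a^n\<close> by 2. Boundedness at \<open>r'\<close> gives \<open>P\<close> at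
  smaller radii, and finitely many steps lead from 0 to 1.\<close>

lemma power_bounded_if_resolvent:
  fixes a :: "'a::unital_cstar_algebra"
  assumes inv: "\<And>z. cmod z \<le> 1 \<Longrightarrow> \<exists>y. inverse_of (1 - z *\<^sub>C a) y"
  shows "eventually (\<lambda>n. norm (a ^ n) \<le> 3) sequentially"
proof -
  obtain R where R: "\<And>z. cmod z \<le> 1 \<Longrightarrow> inverse_of (1 - z *\<^sub>C a) (R z)"
    using inv by metis
  have "continuous_on (cball 0 1) R"
    unfolding continuous_on_iff
  proof (intro ballI allI impI)
    fix z :: complex and e :: real
    assume z: "z \<in> cball 0 1" and e: "e > 0"
    define M where "M = norm (R z) + norm a + 1"
    have M: "M \<ge> 1" "norm (R z) \<le> M" "norm a \<le> M" by (simp_all add: M_def)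
    \<comment> \<open>The first bound meets the hypothesis of \<open>inverse_close\<close>; the
      second makes the resulting estimate \<open>2 * M\<^sup>2 * (d * M)\<close> at most
      \<open>e / 2\<close>.\<close>
    define d where "d = min (1 / (2 * M\<^sup>2)) (e / (2 * M ^ 3) / 2)"
    have "d > 0" using M e by (simp add: d_def)
    moreover have "dist (R z') (R z) < e" if z': "z' \<in> cball 0 1" "dist z' z < d" for z'
    proof -
      have eq: "(1 - z *\<^sub>C a) - (1 - z' *\<^sub>C a) = (z' - z) *\<^sub>C a"
        by (simp add: scaleC_diff_left)
      have nd: "norm ((1 - z *\<^sub>C a) - (1 - z' *\<^sub>C a)) \<le> d * M"
        unfolding eq norm_scaleC using that(2) M(1,3) \<open>d > 0\<close>
        by (intro mult_mono) (auto simp: dist_norm)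
      have "d * M * M \<le> 1 / 2"
      proof -
        have "d * M\<^sup>2 \<le> 1 / (2 * M\<^sup>2) * M\<^sup>2"
          unfolding d_def using M(1) by (intro mult_right_mono) auto
        then show ?thesis using M(1) by (simp add: power2_eq_square mult_ac)
      qed
      then have "norm ((1 - z *\<^sub>C a) - (1 - z' *\<^sub>C a)) * norm (R z) \<le> 1 / 2"
        using mult_mono[OF nd M(2)] \<open>d > 0\<close> M(1) by simp
      from inverse_close[OF R R this] z z'
      have "norm (R z' - R z) \<le> 2 * (norm (R z))\<^sup>2 * norm ((1 - z *\<^sub>C a) - (1 - z' *\<^sub>C a))"
        by simp
      also have "\<dots> \<le> 2 * M\<^sup>2 * (d * M)"
        using nd M \<open>d > 0\<close> by (intro mult_mono) auto
      also have "\<dots> = d * (2 * M ^ 3)" by (simp add: power2_eq_square power3_eq_cube)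
      also have "\<dots> \<le> (e / (2 * M ^ 3) / 2) * (2 * M ^ 3)"
        unfolding d_def using M(1) by (intro mult_right_mono) auto
      also have "\<dots> = e / 2" using M(1) by simp
      also have "\<dots> < e" using e by simp
      finally show ?thesis by (simp add: dist_norm)
    qed
    ultimately show "\<exists>d>0. \<forall>z'\<in>cball 0 1. dist z' z < d \<longrightarrow> dist (R z') (R z) < e"
      by blast
  qed
  then have "uniformly_continuous_on (cball 0 1) R"
    by (intro compact_uniformly_continuous) auto
  then obtain d where d: "d > 0"
    "\<And>z z'. z \<in> cball 0 1 \<Longrightarrow> z' \<in> cball 0 1 \<Longrightarrow> dist z' z < d \<Longrightarrow> dist (R z') (R z) < 1 / 4"
    unfolding uniformly_continuous_on_def by (metis zero_less_divide_1_iff zero_less_numeral)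
  define P where "P r \<longleftrightarrow> (\<lambda>n. complex_of_real r ^ n *\<^sub>C a ^ n) \<longlonglongrightarrow> 0" for r :: real
  have step: "eventually (\<lambda>n. norm (complex_of_real r' ^ n *\<^sub>C a ^ n) \<le> 3) sequentially"
    if r: "P r" "0 \<le> r" "r \<le> r'" "r' \<le> 1" "r' < r + d" for r r'
  proof -
    have "eventually (\<lambda>n. norm (complex_of_real r ^ n *\<^sub>C a ^ n) < 1 / 8) sequentially"
      using r(1) unfolding P_def tendsto_iff by (auto simp: dist_norm dest!: spec[of _ "1/8"])
    with eventually_ge_at_top[of 1] show ?thesis
    proof eventually_elim
      case (elim n)
      define w where "w = exp (2 * of_real pi * \<i> / of_nat n)"
      define S where "S r = (1 / of_nat n) *\<^sub>C (\<Sum>k<n. R (w ^ k * complex_of_real r))" for r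
      have avg: "(1 - complex_of_real r ^ n *\<^sub>C a ^ n) * S r = 1" if "0 \<le> r" "r \<le> 1" for r
        unfolding S_def w_def using that elim by (intro resolvent_average[OF R]) auto
      have cw: "cmod w = 1" by (simp add: w_def)
      have "norm (\<Sum>k<n. R (w ^ k * complex_of_real r') - R (w ^ k * complex_of_real r)) \<le> (\<Sum>k<n. 1 / 4)"
      proof (intro norm_sum[THEN order_trans] sum_mono)
        fix k
        have "dist (w ^ k * complex_of_real r') (w ^ k * complex_of_real r) = \<bar>r' - r\<bar>"
          by (simp add: dist_norm norm_mult norm_power cw flip: right_diff_distrib of_real_diff)
        then have "dist (R (w ^ k * complex_of_real r')) (R (w ^ k * complex_of_real r)) < 1 / 4"
          using r by (intro d) (auto simp: norm_mult norm_power cw)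
        then show "norm (R (w ^ k * complex_of_real r') - R (w ^ k * complex_of_real r)) \<le> 1 / 4"
          by (simp add: dist_norm)
      qed
      then have "(1 / n) * norm (\<Sum>k<n. R (w ^ k * complex_of_real r') - R (w ^ k * complex_of_real r)) \<le> (1 / n) * (\<Sum>k<n. 1 / 4)"
        by (rule mult_left_mono) simp
      moreover have "norm (S r' - S r) = (1 / n) * norm (\<Sum>k<n. R (w ^ k * complex_of_real r') - R (w ^ k * complex_of_real r))"
        by (simp add: S_def norm_scaleC sum_subtractf norm_divide flip: scaleC_diff_right)
      ultimately have "norm (S r' - S r) \<le> (1 / n) * (\<Sum>k<n. 1 / 4)"
        by (simp only:)
      then have SS: "norm (S r' - S r) \<le> 1 / 4"
        using elim(1) by simp
      define T where "T = complex_of_real r ^ n *\<^sub>C a ^ n"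
      define T' where "T' = complex_of_real r' ^ n *\<^sub>C a ^ n"
      have S: "S r - 1 = T * S r" using avg[of r] r by (simp add: T_def algebra_simps)
      have "norm (T * S r) \<le> 1 / 8 * norm (S r)"
        using elim norm_mult_ineq[of T "S r"] mult_right_mono[of "norm T" "1/8" "norm (S r)"]
        unfolding T_def by simp
      then have 1: "norm (S r - 1) \<le> 1 / 8 * norm (S r)" by (simp add: S)
      then have "norm (S r) \<le> 8 / 7"
        using norm_triangle_ineq2[of "S r" 1] by simp
      with 1 have "norm (S r - 1) \<le> 1 / 7" by simp
      with SS have "norm (S r' - 1) \<le> 1 / 2"
        using norm_triangle_ineq[of "S r' - S r" "S r - 1"] by simp
      then have S'2: "norm (1 - S r') \<le> 1 / 2" by (simp add: norm_minus_commute)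
      \<comment> \<open>This is \<open>(1 - T') * S r' = 1\<close>, arranged so that
        \<open>norm (1 - T')\<close> returns on the right with a factor of at most 1/2 and can be
        absorbed.\<close>
      have e: "1 - T' = 1 + (1 - T') * (1 - S r')"
        using avg[of r'] r by (simp add: T'_def algebra_simps)
      have "norm (1 + (1 - T') * (1 - S r')) \<le> 1 + norm (1 - T') * norm (1 - S r')"
        using norm_triangle_ineq[of 1 "(1 - T') * (1 - S r')"] norm_mult_ineq[of "1 - T'" "1 - S r'"] by simp
      then have "norm (1 - T') \<le> 1 + norm (1 - T') * norm (1 - S r')"
        by (simp only: e[symmetric])
      also have "\<dots> \<le> 1 + norm (1 - T') * (1 / 2)"
        using S'2 by (intro add_left_mono mult_left_mono) auto
      finally have "norm (1 - T') \<le> 2" by simp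
      then have "norm T' \<le> 3"
        using norm_triangle_ineq2[of T' 1] by (simp add: norm_minus_commute)
      then show ?case by (simp add: T'_def)
    qed
  qed
  have P_less: "P r''" if "eventually (\<lambda>n. norm (complex_of_real r' ^ n *\<^sub>C a ^ n) \<le> 3) sequentially"
    "0 \<le> r''" "r'' < r'" for r' r''
    unfolding P_def
  proof (rule tendsto_0_le[where K=3])
    show "(\<lambda>n. (r'' / r') ^ n) \<longlonglongrightarrow> 0"
      using that by (intro LIMSEQ_power_zero) auto
    show "eventually (\<lambda>n. norm (complex_of_real r'' ^ n *\<^sub>C a ^ n) \<le> norm ((r'' / r') ^ n) * 3) sequentially"
      using that(1)
    proof eventually_elim
      case (elim n)
      have "norm (complex_of_real r'' ^ n *\<^sub>C a ^ n)
          = (r'' / r') ^ n * norm (complex_of_real r' ^ n *\<^sub>C a ^ n)"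
        using that by (simp add: norm_scaleC norm_power power_divide)
      also have "\<dots> \<le> (r'' / r') ^ n * 3"
        using elim that by (intro mult_left_mono) auto
      finally show ?case using that by simp
    qed
  qed
  obtain m :: nat where m: "m > 0" "2 / real m < d"
  proof -
    obtain m :: nat where "real m > 2 / d" using reals_Archimedean2 by blast
    then show ?thesis using d(1) that[of m] by (cases "m = 0") (auto simp: field_simps)
  qed
  have P: "P (real k / real m)" if "k < m" for k
    using that
  proof (induction k)
    case 0
    have "P 0" unfolding P_def
      by (rule tendsto_eventually) (auto simp: zero_power intro!: eventually_mono[OF eventually_gt_at_top[of "0::nat"]])
    then show ?case by simp
  next
    case (Suc k)
    \<comment> \<open>\<open>P_less\<close> loses a little of the radius, so the aim is
      \<open>(k + 2) / m\<close>, beyond the wanted \<open>(k + 1) / m\<close>; hence the 2 in the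
      choice of \<open>m\<close>. The minimum keeps the radius inside the unit disc, where
      \<open>R\<close> is known.\<close>
    let ?r' = "min 1 (real (k + 2) / real m)"
    have "real k / real m \<le> real (k + 2) / real m"
      using m(1) by (simp add: divide_right_mono)
    moreover have "real (k + 2) / real m < real k / real m + d"
      using m by (simp add: add_divide_distrib)
    ultimately have "eventually (\<lambda>n. norm (complex_of_real ?r' ^ n *\<^sub>C a ^ n) \<le> 3) sequentially"
      using Suc m(1) by (intro step[of "real k / real m"]) (simp_all add: min_less_iff_disj)
    then show ?case
      by (rule P_less) (use Suc(2) m(1) in \<open>auto simp: divide_strict_right_mono\<close>)
  qed
  have "real (m - 1) / real m = 1 - 1 / real m" using m(1) by (simp add: diff_divide_distrib of_nat_diff)
  then have "eventually (\<lambda>n. norm (complex_of_real 1 ^ n *\<^sub>C a ^ n) \<le> 3) sequentially"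
    using P[of "m - 1"] m by (intro step[of "real (m - 1) / real m"]) (auto simp: divide_le_eq field_simps)
  then show ?thesis by simp
qed

section \<open>Norm and spectrum of self-adjoint elements\<close>

abbreviation selfadj :: "'a::star_algebra \<Rightarrow> bool" where
  "selfadj a \<equiv> star a = a"

lemma selfadj_norm_power_two:
  fixes a :: "'a::unital_cstar_algebra"
  assumes "selfadj a"
  shows "norm (a ^ (2 ^ k)) = norm a ^ (2 ^ k)"
proof (induction k)
  case (Suc k)
  have "a ^ (2 ^ Suc k) = star (a ^ (2 ^ k)) * a ^ (2 ^ k)"
    using assms by (simp add: star_power mult_2 power_add)
  then have "norm (a ^ (2 ^ Suc k)) = (norm (a ^ (2 ^ k)))\<^sup>2"
    by (simp only: cstar_identity)
  then show ?case by (simp add: Suc power_mult[symmetric] mult.commute)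
qed simp

lemma inverse_of_scaleC:
  assumes "inverse_of x y" "c \<noteq> 0"
  shows "inverse_of (c *\<^sub>C x) ((1 / c) *\<^sub>C (y :: 'a::{ring_1,star_algebra}))"
  using assms by (simp add: inverse_of_def)

lemma spec_nonmem_scaled:
  assumes "z \<noteq> 0" "1 / z \<notin> spec (a::'a::{ring_1,star_algebra})"
  shows "\<exists>y. inverse_of (1 - z *\<^sub>C a) y"
proof -
  obtain y where "inverse_of (a - (1 / z) *\<^sub>C 1) y"
    using assms(2) by (auto simp: spec_def)
  from inverse_of_scaleC[OF this, of "- z"] assms(1)
  have "inverse_of (1 - z *\<^sub>C a) ((1 / - z) *\<^sub>C y)"
    by (simp add: scaleC_diff_right)
  then show ?thesis ..
qed

text \<open>After division by any \<open>r > \<rho>\<close> the powers stay bounded. The C*-identity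
  makes the norm multiplicative on the powers \<open>2^k\<close>, so a norm above 1 would make them
  unbounded.\<close>

lemma norm_le_if_spec_le:
  fixes a :: "'a::unital_cstar_algebra"
  assumes "selfadj a" "\<rho> \<ge> 0" and le: "\<And>z. z \<in> spec a \<Longrightarrow> cmod z \<le> \<rho>"
  shows "norm a \<le> \<rho>"
proof (rule field_le_epsilon)
  fix e :: real assume e: "e > 0"
  define r where "r = \<rho> + e"
  have r: "r > 0" "\<rho> < r" using assms(2) e by (simp_all add: r_def)
  define b where "b = complex_of_real (1 / r) *\<^sub>C a"
  have "\<exists>y. inverse_of (1 - z *\<^sub>C b) y" if z: "cmod z \<le> 1" for z
  proof (cases "z = 0")
    case False
    have "cmod (1 / (z * complex_of_real (1 / r))) = r / cmod z"
      using r by (simp add: norm_divide norm_mult)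
    also have "\<dots> \<ge> r" using z False r by (simp add: field_simps)
    finally have "1 / (z * complex_of_real (1 / r)) \<notin> spec a"
      using le r by fastforce
    then show ?thesis
      using spec_nonmem_scaled[of "z * complex_of_real (1 / r)" a] False r by (simp add: b_def)
  qed (auto simp: inverse_of_def)
  from power_bounded_if_resolvent[OF this]
  obtain N where N: "\<And>n. n \<ge> N \<Longrightarrow> norm (b ^ n) \<le> 3"
    by (auto simp: eventually_at_top_linorder)
  have "selfadj b" using assms(1) by (simp add: b_def)
  have "norm b \<le> 1"
  proof (rule ccontr)
    assume "\<not> norm b \<le> 1"
    then have b: "norm b > 1" by simp
    obtain n where n: "norm b ^ n > 3" using real_arch_pow[OF b] by blast
    have lt: "max n N \<le> 2 ^ max n N" using less_exp[of "max n N"] by linarith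
    have "3 < norm b ^ (2 ^ max n N)"
      using lt b by (intro less_le_trans[OF n power_increasing]) auto
    also have "\<dots> \<le> 3"
      using N[of "2 ^ max n N"] lt selfadj_norm_power_two[OF \<open>selfadj b\<close>] by simp
    finally show False by simp
  qed
  then have "norm a \<le> r" using r by (simp add: b_def norm_scaleC norm_divide field_simps)
  then show "norm a \<le> \<rho> + e" by (simp add: r_def)
qed

lemma inverse_of_perturb:
  fixes x :: "'a::{real_normed_algebra_1,banach}"
  assumes "inverse_of x y" "norm y * norm h < 1"
  shows "\<exists>z. inverse_of (x - h) z"
proof -
  have "norm (y * h) < 1" "norm (h * y) < 1"
    using assms(2) norm_mult_ineq[of y h] norm_mult_ineq[of h y] by (auto simp: mult.commute)
  then obtain u v where u: "inverse_of (1 - y * h) u" and v: "inverse_of (1 - h * y) v"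
    using neumann_inverse by blast
  have "x - h = x * (1 - y * h)"
    using assms(1) by (simp add: inverse_of_def right_diff_distrib flip: mult.assoc)
  moreover have "x - h = (1 - h * y) * x"
    using assms(1) by (simp add: inverse_of_def left_diff_distrib mult.assoc)
  moreover have "(1 - h * y) * x * (y * v) = (1 - h * y) * (x * y) * v"
    "u * y * (x * (1 - y * h)) = u * (y * x) * (1 - y * h)"
    by (simp_all only: mult.assoc)
  ultimately have "(x - h) * (y * v) = 1" "(u * y) * (x - h) = 1"
    using assms(1) u v by (simp_all add: inverse_of_def)
  then show ?thesis using inverse_ofI_left_right by blast
qed

lemma spec_norm_le:
  fixes x :: "'a::unital_cstar_algebra"
  assumes "z \<in> spec x"
  shows "cmod z \<le> norm x"
proof (rule ccontr)
  assume "\<not> cmod z \<le> norm x"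
  then have z: "z \<noteq> 0" "norm x < cmod z" by auto
  then have "norm ((1 / z) *\<^sub>C x) < 1" by (simp add: norm_scaleC norm_divide)
  from neumann_inverse[OF this] obtain y where "inverse_of (1 - (1 / z) *\<^sub>C x) y" ..
  from inverse_of_scaleC[OF this, of "- z"] z have "inverse_of (x - z *\<^sub>C 1) ((1 / - z) *\<^sub>C y)"
    by (simp add: scaleC_diff_right)
  with assms show False by (auto simp: spec_def)
qed

lemma closed_spec: "closed (spec (x::'a::unital_cstar_algebra))"
  unfolding closed_def
proof (rule openI)
  fix z assume "z \<in> - spec x"
  then obtain y where y: "inverse_of (x - z *\<^sub>C 1) y" by (auto simp: spec_def)
  then have "y \<noteq> 0" by (auto simp: inverse_of_def)
  have "ball z (1 / norm y) \<subseteq> - spec x"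
  proof
    fix w assume "w \<in> ball z (1 / norm y)"
    then have "norm y * norm ((w - z) *\<^sub>C (1::'a)) < 1"
      using \<open>y \<noteq> 0\<close> by (simp add: norm_scaleC dist_norm norm_minus_commute field_simps)
    from inverse_of_perturb[OF y this] show "w \<in> - spec x"
      by (simp add: spec_def scaleC_diff_left)
  qed
  then show "\<exists>T>0. ball z T \<subseteq> - spec x"
    using \<open>y \<noteq> 0\<close> by (intro exI[of _ "1 / norm y"]) auto
qed

lemma compact_spec: "compact (spec (x::'a::unital_cstar_algebra))"
  unfolding compact_eq_bounded_closed
  using closed_spec spec_norm_le by (auto simp: bounded_iff)

text \<open>Shift by \<open>i t\<close>: the squared norm grows by at most \<open>t\<^sup>2\<close>,
  but \<open>|z + i t|\<^sup>2\<close> also contains the term \<open>2 t Im z\<close>, which is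
  unbounded in the real parameter \<open>t\<close> unless \<open>Im z = 0\<close>.\<close>

lemma selfadj_spec_real:
  fixes a :: "'a::unital_cstar_algebra"
  assumes "selfadj a" "z \<in> spec a"
  shows "Im z = 0"
proof (rule ccontr)
  assume nz: "Im z \<noteq> 0"
  have ineq: "(Re z)\<^sup>2 + (Im z + t)\<^sup>2 \<le> (norm a)\<^sup>2 + t\<^sup>2" for t :: real
  proof -
    let ?b = "a + (\<i> * complex_of_real t) *\<^sub>C 1"
    have "z + \<i> * complex_of_real t \<in> spec ?b"
      using assms(2) by (simp add: spec_def scaleC_add_left)
    then have "(cmod (z + \<i> * complex_of_real t))\<^sup>2 \<le> (norm ?b)\<^sup>2"
      using spec_norm_le by (intro power_mono) auto
    also have "(norm ?b)\<^sup>2 = norm (star ?b * ?b)" by (simp only: cstar_identity)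
    also have "star ?b * ?b = a * a + complex_of_real (t\<^sup>2) *\<^sub>C 1"
      using assms(1) by (simp add: star_add algebra_simps scaleC_add_right scaleC_diff_right power2_eq_square)
    also have "norm \<dots> \<le> (norm a)\<^sup>2 + t\<^sup>2"
      using norm_mult_ineq[of a a]
      by (intro norm_triangle_le add_mono) (simp_all add: power2_eq_square norm_scaleC norm_mult flip: of_real_mult)
    finally show ?thesis by (simp add: cmod_power2)
  qed
  have "2 * Im z * t \<le> (norm a)\<^sup>2" for t
    using ineq[of t] zero_le_power2[of "Re z"] zero_le_power2[of "Im z"]
    unfolding power2_sum by linarith
  from this[of "((norm a)\<^sup>2 + 1) / (2 * Im z)"] show False using nz by simp
qed

text \<open>An empty spectrum would force \<open>norm a <= 0\<close> by the preceding bound, but the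
  spectrum of 0 contains 0.\<close>

lemma spec_nonempty:
  fixes a :: "'a::unital_cstar_algebra"
  assumes "selfadj a"
  shows "spec a \<noteq> {}"
proof
  assume e: "spec a = {}"
  then have "norm a \<le> 0" by (intro norm_le_if_spec_le assms) auto
  then have "0 \<in> spec a" by (simp add: spec_def inverse_of_def)
  with e show False by simp
qed

section \<open>Polynomials in an element and spectral mapping\<close>

definition peval :: "complex poly \<Rightarrow> 'a::{ring_1,star_algebra} \<Rightarrow> 'a" where
  "peval p x = fold_coeffs (\<lambda>a y. a *\<^sub>C 1 + x * y) p 0"

lemma peval_0 [simp]: "peval 0 x = 0"
  by (simp add: peval_def)

lemma peval_pCons [simp]: "peval (pCons a p) x = a *\<^sub>C 1 + x * peval p x"
  by (cases "p = 0 \<and> a = 0") (auto simp: peval_def)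

lemma peval_add: "peval (p + q) x = peval p x + peval q x"
  by (induction p q rule: poly_induct2) (simp_all add: scaleC_add_left algebra_simps)

lemma peval_smult: "peval (smult c p) x = c *\<^sub>C peval p x"
  by (induction p) (simp_all add: scaleC_add_right)

lemma peval_minus: "peval (- q) x = - peval q x"
  using peval_smult[of "- 1" q x] by simp

lemma peval_diff: "peval (p - q) x = peval p x - peval q x"
  using peval_add[of p "- q" x] by (simp add: peval_minus)

lemma peval_mult: "peval (p * q) x = peval p x * peval q x"
  by (induction p) (simp_all add: peval_add peval_smult algebra_simps)

lemma peval_commute: "x * peval p x = peval p x * x"
proof (induction p)
  case (pCons a p)
  have "x * peval (pCons a p) x = a *\<^sub>C x + x * (x * peval p x)"
    by (simp add: distrib_left)
  also have "x * (x * peval p x) = x * (peval p x * x)"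
    by (simp only: pCons.IH)
  also have "a *\<^sub>C x + \<dots> = peval (pCons a p) x * x"
    by (simp add: distrib_right mult.assoc)
  finally show ?case .
qed simp

lemma peval_star:
  assumes "selfadj x"
  shows "star (peval p x) = peval (map_poly cnj p) x"
  by (induction p) (simp_all add: assms star_add star_mult map_poly_pCons peval_commute[symmetric])

lemma inverse_of_mult:
  "inverse_of x y \<Longrightarrow> inverse_of x' y' \<Longrightarrow> inverse_of (x * x') (y' * y)"
proof -
  assume a: "inverse_of x y" "inverse_of x' y'"
  have "x * x' * (y' * y) = x * (x' * y') * y" "y' * y * (x * x') = y' * (y * x) * x'"
    by (simp_all only: mult.assoc)
  with a show ?thesis by (simp add: inverse_of_def)
qed

text \<open>The fundamental theorem of algebra splits \<open>p\<close> into linear factors, each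
  invertible at \<open>x\<close> since its root avoids the spectrum.\<close>

lemma peval_invertible:
  fixes x :: "'a::{ring_1,star_algebra}"
  assumes "p \<noteq> 0" "\<And>z. poly p z = 0 \<Longrightarrow> z \<notin> spec x"
  shows "\<exists>y. inverse_of (peval p x) y"
  using assms
proof (induction "degree p" arbitrary: p rule: less_induct)
  case less
  show ?case
  proof (cases "degree p = 0")
    case True
    then obtain c where "p = [:c:]" by (metis degree_eq_zeroE)
    then show ?thesis using less(2)
      by (intro exI[of _ "(1 / c) *\<^sub>C 1"]) (simp add: inverse_of_def)
  next
    case False
    then obtain z where z: "poly p z = 0"
      using fundamental_theorem_of_algebra[of p] constant_degree[of p] by auto
    then obtain q where q: "p = [:- z, 1:] * q"
      by (auto simp: poly_eq_0_iff_dvd)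
    with less(2) have "q \<noteq> 0" by auto
    then have "degree q < degree p" by (simp add: q degree_mult_eq del: mult_pCons_left)
    moreover have "poly q w = 0 \<Longrightarrow> w \<notin> spec x" for w
      using less(3)[of w] by (simp add: q)
    ultimately obtain y where y: "inverse_of (peval q x) y"
      using less(1)[of q] \<open>q \<noteq> 0\<close> by blast
    obtain y' where "inverse_of (x - z *\<^sub>C 1) y'"
      using less(3)[OF z] by (auto simp: spec_def)
    from inverse_of_mult[OF this y] show ?thesis
      by (auto simp: q peval_mult simp del: mult_pCons_left)
  qed
qed

lemma spec_peval_subset:
  fixes x :: "'a::{ring_1,star_algebra}"
  assumes "w \<in> spec (peval p x)" "spec x \<noteq> {}"
  shows "\<exists>z\<in>spec x. poly p z = w"
proof (cases "p = [:w:]")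
  case True
  then show ?thesis using assms(2) by auto
next
  case False
  have "\<nexists>y. inverse_of (peval (p - [:w:]) x) y"
    using assms(1) by (simp add: spec_def peval_diff)
  then show ?thesis
    using peval_invertible[of "p - [:w:]" x] False by auto
qed

text \<open>\<open>p - p(z)\<close> is divisible by the linear factor at \<open>z\<close>. The two
  factors commute at \<open>x\<close>, so inverting their product would invert
  \<open>x - z\<close>.\<close>

lemma poly_in_spec_peval:
  fixes x :: "'a::{ring_1,star_algebra}"
  assumes "z \<in> spec x"
  shows "poly p z \<in> spec (peval p x)"
proof (rule ccontr)
  assume "poly p z \<notin> spec (peval p x)"
  then obtain y where y: "inverse_of (peval (p - [:poly p z:]) x) y"
    by (auto simp: spec_def peval_diff)
  have "poly (p - [:poly p z:]) z = 0" by simp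
  then have "[:- z, 1:] dvd p - [:poly p z:]"
    by (simp only: poly_eq_0_iff_dvd)
  then obtain q where q: "p - [:poly p z:] = [:- z, 1:] * q"
    by (rule dvdE)
  let ?Q = "peval q x"
  have 1: "peval (p - [:poly p z:]) x = (x - z *\<^sub>C 1) * ?Q"
    unfolding q peval_mult by simp
  have 2: "(x - z *\<^sub>C 1) * ?Q = ?Q * (x - z *\<^sub>C 1)"
    by (simp add: algebra_simps peval_commute)
  have "(x - z *\<^sub>C 1) * (?Q * y) = peval (p - [:poly p z:]) x * y"
    by (simp only: 1 mult.assoc)
  moreover have "(y * ?Q) * (x - z *\<^sub>C 1) = y * peval (p - [:poly p z:]) x"
    by (simp only: 1 2 mult.assoc)
  ultimately have "(x - z *\<^sub>C 1) * (?Q * y) = 1" "(y * ?Q) * (x - z *\<^sub>C 1) = 1"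
    using y by (simp_all add: inverse_of_def)
  from inverse_ofI_left_right[OF this] assms show False by (auto simp: spec_def)
qed

lemma norm_peval_ge:
  assumes "z \<in> spec (x::'a::unital_cstar_algebra)"
  shows "cmod (poly p z) \<le> norm (peval p x)"
  using spec_norm_le poly_in_spec_peval[OF assms] by blast

text \<open>For complex coefficients \<open>p(x)\<close> is merely normal. The bound for
  self-adjoint elements is therefore applied to \<open>star (p(x)) * p(x)\<close>, which is again a
  polynomial in \<open>x\<close>.\<close>

lemma norm_peval_le:
  fixes x :: "'a::unital_cstar_algebra"
  assumes "selfadj x" and le: "\<And>z. z \<in> spec x \<Longrightarrow> cmod (poly p z) \<le> B"
  shows "norm (peval p x) \<le> B"
proof -
  obtain z where "z \<in> spec x" using spec_nonempty[OF assms(1)] by blast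
  then have "B \<ge> 0" using le norm_ge_zero order_trans by blast
  let ?q = "map_poly cnj p * p"
  have eq: "peval ?q x = star (peval p x) * peval p x"
    by (simp add: peval_mult peval_star assms(1))
  have "(norm (peval p x))\<^sup>2 = norm (peval ?q x)"
    by (simp add: eq cstar_identity)
  also have "\<dots> \<le> B\<^sup>2"
  proof (rule norm_le_if_spec_le)
    show "selfadj (peval ?q x)" by (simp add: eq star_mult)
    fix w assume "w \<in> spec (peval ?q x)"
    then obtain v where v: "v \<in> spec x" "poly ?q v = w"
      using spec_peval_subset spec_nonempty[OF assms(1)] by blast
    moreover have "cnj v = v"
      using selfadj_spec_real[OF assms(1) v(1)] by (simp add: complex_eq_iff)
    ultimately have "w = cnj (poly p v) * poly p v"
      by auto
    then show "cmod w \<le> B\<^sup>2"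
      using mult_mono[OF le[OF v(1)] le[OF v(1)]] \<open>B \<ge> 0\<close> by (simp add: norm_mult power2_eq_square)
  qed simp
  finally show ?thesis using \<open>B \<ge> 0\<close> by (rule power2_le_imp_le)
qed

section \<open>Continuous functional calculus of self-adjoint elements\<close>

lemma complex_polynomial_approximation:
  fixes f :: "complex \<Rightarrow> complex"
  assumes K: "compact K" "\<And>z. z \<in> K \<Longrightarrow> Im z = 0" and f: "continuous_on K f" and e: "e > 0"
  shows "\<exists>p. \<forall>z\<in>K. cmod (poly p z - f z) < e"
proof -
  have K': "complex_of_real (Re z) = z" if "z \<in> K" for z
    using K(2)[OF that] by (simp add: complex_eq_iff)
  have comp: "compact (Re ` K)"
    by (rule compact_continuous_image[OF continuous_on_Re[OF continuous_on_id] K(1)])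
  have img: "complex_of_real ` Re ` K \<subseteq> K" using K' by auto
  have c: "continuous_on (Re ` K) (\<lambda>t. f (complex_of_real t))"
    by (rule continuous_on_compose2[OF f _ img]) (rule continuous_on_of_real[OF continuous_on_id])
  have poly_of: "\<exists>p. \<forall>t. poly p (complex_of_real t) = complex_of_real (g t)"
    if g0: "real_polynomial_function g" for g :: "real \<Rightarrow> real"
  proof -
    obtain a n where g: "g = (\<lambda>x. \<Sum>i\<le>n. a i * x ^ i)"
      using g0 unfolding real_polynomial_function_iff_sum by blast
    show ?thesis
      by (intro exI[of _ "\<Sum>i\<le>n. monom (complex_of_real (a i)) i"]) (simp add: g poly_sum poly_monom)
  qed
  obtain g where g: "real_polynomial_function g"
    "\<And>t. t \<in> Re ` K \<Longrightarrow> \<bar>Re (f (complex_of_real t)) - g t\<bar> < e / 2"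
    using Stone_Weierstrass_real_polynomial_function[OF comp, of "\<lambda>t. Re (f (complex_of_real t))" "e / 2"] c e
    by (metis continuous_on_Re half_gt_zero)
  obtain h where h: "real_polynomial_function h"
    "\<And>t. t \<in> Re ` K \<Longrightarrow> \<bar>Im (f (complex_of_real t)) - h t\<bar> < e / 2"
    using Stone_Weierstrass_real_polynomial_function[OF comp, of "\<lambda>t. Im (f (complex_of_real t))" "e / 2"] c e
    by (metis continuous_on_Im half_gt_zero)
  obtain p q where p: "\<And>t. poly p (complex_of_real t) = complex_of_real (g t)"
    and q: "\<And>t. poly q (complex_of_real t) = complex_of_real (h t)"
    using poly_of g(1) h(1) by meson
  have "cmod (poly (p + smult \<i> q) z - f z) < e" if z: "z \<in> K" for z
  proof -
    let ?t = "Re z"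
    have "poly (p + smult \<i> q) z = Complex (g ?t) (h ?t)"
      using p[of ?t] q[of ?t] K'[OF z] by (simp add: complex_eq_iff)
    then have "cmod (poly (p + smult \<i> q) z - f z) \<le> \<bar>g ?t - Re (f z)\<bar> + \<bar>h ?t - Im (f z)\<bar>"
      using cmod_le[of "poly (p + smult \<i> q) z - f z"] by simp
    also have "\<dots> < e / 2 + e / 2"
      using g(2)[of ?t] h(2)[of ?t] z K'[OF z] by (intro add_strict_mono) (auto simp: abs_minus_commute)
    finally show ?thesis by simp
  qed
  then show ?thesis by blast
qed

text \<open>A relation rather than a function at first: algebraic laws follow by combining arbitrary
  approximating sequences, and \<open>cfc_rel_unique\<close> afterwards makes the choice of sequence
  irrelevant.\<close>

definition cfc_rel :: "(complex \<Rightarrow> complex) \<Rightarrow> 'a::unital_cstar_algebra \<Rightarrow> 'a \<Rightarrow> bool" where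
  "cfc_rel f x y \<longleftrightarrow> (\<exists>P. uniform_limit (spec x) (\<lambda>n. poly (P n)) f sequentially \<and>
    (\<lambda>n. peval (P n) x) \<longlonglongrightarrow> y)"

definition cfc :: "(complex \<Rightarrow> complex) \<Rightarrow> 'a::unital_cstar_algebra \<Rightarrow> 'a" where
  "cfc f x = (THE y. cfc_rel f x y)"

lemma bounded_continuous_image_spec:
  assumes "continuous_on (spec (x::'a::unital_cstar_algebra)) (f :: complex \<Rightarrow> complex)"
  shows "bounded (f ` spec x)"
  by (intro compact_imp_bounded compact_continuous_image assms compact_spec)

lemma poly_add_fun: "poly (p + q) = (\<lambda>z. poly p z + poly q z)"
  by (simp add: fun_eq_iff)

lemma poly_mult_fun: "poly (p * q) = (\<lambda>z. poly p z * poly q z)"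
  by (simp add: fun_eq_iff)

lemma poly_minus_fun: "poly (- p) = (\<lambda>z. - poly (p::complex poly) z)"
  by (simp add: fun_eq_iff)

lemma cfc_rel_add: "cfc_rel f x y \<Longrightarrow> cfc_rel g x z \<Longrightarrow> cfc_rel (\<lambda>w. f w + g w) x (y + z)"
proof -
  assume "cfc_rel f x y" "cfc_rel g x z"
  then obtain P Q where "uniform_limit (spec x) (\<lambda>n. poly (P n)) f sequentially"
    "uniform_limit (spec x) (\<lambda>n. poly (Q n)) g sequentially"
    "(\<lambda>n. peval (P n) x) \<longlonglongrightarrow> y" "(\<lambda>n. peval (Q n) x) \<longlonglongrightarrow> z"
    unfolding cfc_rel_def by blast
  then show ?thesis unfolding cfc_rel_def
    by (intro exI[of _ "\<lambda>n. P n + Q n"] conjI)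
      (auto simp: peval_add poly_add_fun intro!: uniform_limit_add tendsto_add)
qed

lemma cfc_rel_mult:
  assumes "continuous_on (spec x) f" "continuous_on (spec x) g" "cfc_rel f x y" "cfc_rel g x z"
  shows "cfc_rel (\<lambda>w. f w * g w) x (y * z)"
proof -
  obtain P Q where "uniform_limit (spec x) (\<lambda>n. poly (P n)) f sequentially"
    "uniform_limit (spec x) (\<lambda>n. poly (Q n)) g sequentially"
    "(\<lambda>n. peval (P n) x) \<longlonglongrightarrow> y" "(\<lambda>n. peval (Q n) x) \<longlonglongrightarrow> z"
    using assms(3,4) unfolding cfc_rel_def by blast
  then show ?thesis unfolding cfc_rel_def using bounded_continuous_image_spec assms(1,2)
    by (intro exI[of _ "\<lambda>n. P n * Q n"] conjI)
      (auto simp: peval_mult poly_mult_fun intro!: uniform_lim_mult tendsto_mult)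
qed

lemma cfc_rel_poly: "cfc_rel (poly p) x (peval p x)"
  unfolding cfc_rel_def by (intro exI[of _ "\<lambda>_. p"]) (auto intro: uniform_limit_const)

lemma cfc_rel_cnj:
  assumes "selfadj x" "cfc_rel f x y"
  shows "cfc_rel (\<lambda>z. cnj (f z)) x (star y)"
proof -
  obtain P where P: "uniform_limit (spec x) (\<lambda>n. poly (P n)) f sequentially"
    "(\<lambda>n. peval (P n) x) \<longlonglongrightarrow> y"
    using assms(2) unfolding cfc_rel_def by blast
  have "uniform_limit (spec x) (\<lambda>n. poly (map_poly cnj (P n))) (\<lambda>z. cnj (f z)) sequentially"
    unfolding uniform_limit_iff
  proof (intro allI impI)
    fix e :: real assume "e > 0"
    with P(1) have "\<forall>\<^sub>F n in sequentially. \<forall>z\<in>spec x. dist (poly (P n) z) (f z) < e"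
      unfolding uniform_limit_iff by blast
    then show "\<forall>\<^sub>F n in sequentially. \<forall>z\<in>spec x. dist (poly (map_poly cnj (P n)) z) (cnj (f z)) < e"
    proof eventually_elim
      case (elim n)
      have "poly (map_poly cnj (P n)) z = cnj (poly (P n) z)" if "z \<in> spec x" for z
      proof -
        have "cnj z = z" using selfadj_spec_real[OF assms(1) that] by (simp add: complex_eq_iff)
        then show ?thesis by simp
      qed
      then show ?case using elim by (simp add: dist_norm flip: complex_cnj_diff)
    qed
  qed
  moreover have "(\<lambda>n. peval (map_poly cnj (P n)) x) \<longlonglongrightarrow> star y"
    using tendsto_star[OF P(2)] by (simp add: peval_star assms(1))
  ultimately show ?thesis unfolding cfc_rel_def
    by (intro exI[of _ "\<lambda>n. map_poly cnj (P n)"] conjI)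
qed

lemma cfc_rel_norm_le:
  assumes "selfadj x" "cfc_rel f x y" "\<And>z. z \<in> spec x \<Longrightarrow> cmod (f z) \<le> B"
  shows "norm y \<le> B"
proof -
  obtain P where P: "uniform_limit (spec x) (\<lambda>n. poly (P n)) f sequentially"
    "(\<lambda>n. peval (P n) x) \<longlonglongrightarrow> y"
    using assms(2) unfolding cfc_rel_def by blast
  show ?thesis
  proof (rule field_le_epsilon)
    fix e :: real assume "e > 0"
    with P(1) have "\<forall>\<^sub>F n in sequentially. \<forall>z\<in>spec x. dist (poly (P n) z) (f z) < e"
      unfolding uniform_limit_iff by blast
    then have "\<forall>\<^sub>F n in sequentially. norm (peval (P n) x) \<le> B + e"
    proof eventually_elim
      case (elim n)
      have "cmod (poly (P n) z) \<le> B + e" if "z \<in> spec x" for z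
      proof -
        have "cmod (poly (P n) z - f z) < e"
          using elim that by (simp add: dist_norm)
        then show ?thesis
          using norm_triangle_ineq2[of "poly (P n) z" "f z"] assms(3)[OF that] by linarith
      qed
      then show ?case by (rule norm_peval_le[OF assms(1)])
    qed
    then show "norm y \<le> B + e"
      by (intro tendsto_upperbound[OF tendsto_norm[OF P(2)]]) auto
  qed
qed

lemma cfc_rel_unique:
  assumes "selfadj x" "cfc_rel f x y" "cfc_rel g x z" "\<And>w. w \<in> spec x \<Longrightarrow> f w = g w"
  shows "y = z"
proof -
  obtain P where P: "uniform_limit (spec x) (\<lambda>n. poly (P n)) g sequentially"
    "(\<lambda>n. peval (P n) x) \<longlonglongrightarrow> z"
    using assms(3) unfolding cfc_rel_def by blast
  have "cfc_rel (\<lambda>w. - g w) x (- z)" unfolding cfc_rel_def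
    using uniform_limit_uminus[OF P(1)] tendsto_minus[OF P(2)]
    by (intro exI[of _ "\<lambda>n. - P n"]) (simp add: poly_minus_fun peval_minus)
  from cfc_rel_add[OF assms(2) this] have "norm (y + - z) \<le> 0"
    by (rule cfc_rel_norm_le[OF assms(1)]) (simp add: assms(4))
  then show ?thesis by simp
qed

lemma cfc_eqI: "selfadj x \<Longrightarrow> cfc_rel f x y \<Longrightarrow> cfc f x = y"
  unfolding cfc_def using cfc_rel_unique by blast

lemma cfc_rel_cfc:
  assumes "selfadj x" "continuous_on (spec x) f"
  shows "cfc_rel f x (cfc f x)"
proof -
  have "\<forall>n. \<exists>p. \<forall>z\<in>spec x. cmod (poly p z - f z) < inverse (real (Suc n))"
    using complex_polynomial_approximation[OF compact_spec selfadj_spec_real[OF assms(1)] assms(2)]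
    by simp
  then obtain P where P: "\<And>n z. z \<in> spec x \<Longrightarrow> cmod (poly (P n) z - f z) < inverse (real (Suc n))"
    by metis
  have ul: "uniform_limit (spec x) (\<lambda>n. poly (P n)) f sequentially"
    unfolding uniform_limit_iff
  proof (intro allI impI)
    fix e :: real assume "e > 0"
    then obtain N where N: "inverse (real (Suc N)) < e" using reals_Archimedean by blast
    have "cmod (poly (P n) z - f z) < e" if "z \<in> spec x" "n \<ge> N" for n z
    proof -
      have "inverse (real (Suc n)) \<le> inverse (real (Suc N))" using that by simp
      then show ?thesis using P[OF that(1), of n] N by linarith
    qed
    then show "\<forall>\<^sub>F n in sequentially. \<forall>z\<in>spec x. dist (poly (P n) z) (f z) < e"
      unfolding eventually_at_top_linorder by (auto simp: dist_norm)
  qed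
  have "Cauchy (\<lambda>n. peval (P n) x)"
  proof (rule metric_CauchyI)
    fix e :: real assume "e > 0"
    then obtain N where N: "inverse (real (Suc N)) < e / 3" using reals_Archimedean[of "e / 3"] by auto
    have "dist (peval (P m) x) (peval (P n) x) < e" if "m \<ge> N" "n \<ge> N" for m n
    proof -
      have "norm (peval (P m - P n) x) \<le> 2 * (e / 3)"
      proof (rule norm_peval_le[OF assms(1)])
        fix z assume z: "z \<in> spec x"
        have "inverse (real (Suc n)) \<le> inverse (real (Suc N))" "inverse (real (Suc m)) \<le> inverse (real (Suc N))"
          using that by simp_all
        then have "cmod (poly (P m) z - f z) \<le> e / 3" "cmod (poly (P n) z - f z) \<le> e / 3"
          using P[OF z, of n] P[OF z, of m] N by linarith+
        then show "cmod (poly (P m - P n) z) \<le> 2 * (e / 3)"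
          using norm_triangle_ineq4[of "poly (P m) z - f z" "poly (P n) z - f z"] by simp
      qed
      then show ?thesis using \<open>e > 0\<close> by (simp add: dist_norm peval_diff)
    qed
    then show "\<exists>M. \<forall>m\<ge>M. \<forall>n\<ge>M. dist (peval (P m) x) (peval (P n) x) < e" by blast
  qed
  then obtain y where "(\<lambda>n. peval (P n) x) \<longlonglongrightarrow> y"
    using Cauchy_convergent_iff convergent_def by blast
  with ul have "cfc_rel f x y" unfolding cfc_rel_def by blast
  with cfc_eqI[OF assms(1) this] show ?thesis by simp
qed

lemma cfc_cong:
  assumes "selfadj x" "continuous_on (spec x) f" "\<And>z. z \<in> spec x \<Longrightarrow> f z = g z"
  shows "cfc f x = cfc g x"
proof -
  have "continuous_on (spec x) g" using assms(2,3) by (simp cong: continuous_on_cong)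
  then show ?thesis using cfc_rel_unique cfc_rel_cfc assms by metis
qed

lemma cfc_add:
  assumes "selfadj x" "continuous_on (spec x) f" "continuous_on (spec x) g"
  shows "cfc (\<lambda>z. f z + g z) x = cfc f x + cfc g x"
  by (intro cfc_eqI cfc_rel_add cfc_rel_cfc assms)

lemma cfc_mult:
  assumes "selfadj x" "continuous_on (spec x) f" "continuous_on (spec x) g"
  shows "cfc (\<lambda>z. f z * g z) x = cfc f x * cfc g x"
  by (intro cfc_eqI cfc_rel_mult cfc_rel_cfc assms)

lemma cfc_star:
  assumes "selfadj x" "continuous_on (spec x) f"
  shows "cfc (\<lambda>z. cnj (f z)) x = star (cfc f x)"
  by (intro cfc_eqI cfc_rel_cnj cfc_rel_cfc assms)

lemma cfc_poly: "selfadj x \<Longrightarrow> cfc (poly p) x = peval p x"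
  by (intro cfc_eqI cfc_rel_poly)

lemma cfc_id: "selfadj x \<Longrightarrow> cfc (\<lambda>z. z) x = x"
proof -
  have "poly [:0, 1:] = (\<lambda>z::complex. z)" by (simp add: fun_eq_iff)
  then show "selfadj x \<Longrightarrow> ?thesis" using cfc_poly[of x "[:0, 1:]"] by simp
qed

lemma cfc_const: "selfadj x \<Longrightarrow> cfc (\<lambda>_. c) x = c *\<^sub>C 1"
proof -
  have "poly [:c:] = (\<lambda>_. c)" by (simp add: fun_eq_iff)
  then show "selfadj x \<Longrightarrow> ?thesis" using cfc_poly[of x "[:c:]"] by simp
qed

lemma cfc_cmult:
  assumes "selfadj x" "continuous_on (spec x) f"
  shows "cfc (\<lambda>z. c * f z) x = c *\<^sub>C cfc f x"
  using cfc_mult[OF assms(1) continuous_on_const assms(2), of c] by (simp add: cfc_const assms(1))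

lemma norm_cfc_le:
  assumes "selfadj x" "continuous_on (spec x) f" "\<And>z. z \<in> spec x \<Longrightarrow> cmod (f z) \<le> B"
  shows "norm (cfc f x) \<le> B"
  using cfc_rel_norm_le[OF assms(1) cfc_rel_cfc[OF assms(1,2)]] assms(3) by blast

lemma cfc_limit:
  assumes "selfadj x" "continuous_on (spec x) f"
  obtains P where "\<And>z. z \<in> spec x \<Longrightarrow> (\<lambda>n. poly (P n) z) \<longlonglongrightarrow> f z"
    "(\<lambda>n. peval (P n) x) \<longlonglongrightarrow> cfc f x"
proof -
  obtain P where "uniform_limit (spec x) (\<lambda>n. poly (P n)) f sequentially"
    "(\<lambda>n. peval (P n) x) \<longlonglongrightarrow> cfc f x"
    using cfc_rel_cfc[OF assms] unfolding cfc_rel_def by blast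
  with tendsto_uniform_limitI show thesis by (intro that[of P])
qed

lemma norm_cfc_ge:
  assumes "selfadj x" "continuous_on (spec x) f" "z \<in> spec x"
  shows "cmod (f z) \<le> norm (cfc f x)"
proof -
  obtain P where P: "\<And>z. z \<in> spec x \<Longrightarrow> (\<lambda>n. poly (P n) z) \<longlonglongrightarrow> f z"
    "(\<lambda>n. peval (P n) x) \<longlonglongrightarrow> cfc f x"
    using cfc_limit assms(1,2) by blast
  show ?thesis
    by (rule tendsto_le[OF _ tendsto_norm[OF P(2)] tendsto_norm[OF P(1)[OF assms(3)]]])
      (simp_all add: norm_peval_ge[OF assms(3)])
qed

lemma cfc_eigen:
  assumes "selfadj x" "continuous_on (spec x) f" "x * s = l *\<^sub>C s" "l \<in> spec x"
  shows "cfc f x * s = f l *\<^sub>C s"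
proof -
  obtain P where P: "\<And>z. z \<in> spec x \<Longrightarrow> (\<lambda>n. poly (P n) z) \<longlonglongrightarrow> f z"
    "(\<lambda>n. peval (P n) x) \<longlonglongrightarrow> cfc f x"
    using cfc_limit assms(1,2) by blast
  have "peval p x * s = poly p l *\<^sub>C s" for p
    by (induction p) (simp_all add: distrib_right mult.assoc assms(3) scaleC_add_left mult.commute)
  moreover have "(\<lambda>n. peval (P n) x * s) \<longlonglongrightarrow> cfc f x * s"
    by (intro tendsto_intros P)
  moreover have "(\<lambda>n. poly (P n) l *\<^sub>C s) \<longlonglongrightarrow> f l *\<^sub>C s"
    by (intro tendsto_scaleC_left P assms)
  ultimately show ?thesis by (simp add: LIMSEQ_unique)
qed

section \<open>Positivity\<close>

definition rspec :: "'a::{ring_1,star_algebra} \<Rightarrow> real set" where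
  "rspec x = Re ` spec x"

definition rfc :: "(real \<Rightarrow> real) \<Rightarrow> 'a::unital_cstar_algebra \<Rightarrow> 'a" where
  "rfc f x = cfc (\<lambda>z. complex_of_real (f (Re z))) x"

lemma mem_rspec:
  assumes "selfadj (x::'a::unital_cstar_algebra)"
  shows "t \<in> rspec x \<longleftrightarrow> complex_of_real t \<in> spec x"
proof
  assume "t \<in> rspec x"
  then obtain z where "z \<in> spec x" "t = Re z" by (auto simp: rspec_def)
  moreover from this have "complex_of_real t = z"
    using selfadj_spec_real[OF assms] by (simp add: complex_eq_iff)
  ultimately show "complex_of_real t \<in> spec x" by (simp only:)
next
  assume "complex_of_real t \<in> spec x"
  from imageI[OF this, of Re] show "t \<in> rspec x" by (simp add: rspec_def)
qed

lemma rfc_continuous: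
  "continuous_on (rspec x) f \<Longrightarrow> continuous_on (spec x) (\<lambda>z. complex_of_real (f (Re z)))"
  unfolding rspec_def
  by (rule continuous_on_of_real, rule continuous_on_compose2[of _ f _ Re], assumption)
    (auto intro: continuous_on_Re continuous_on_id)

lemma rfc_cong:
  assumes "selfadj x" "continuous_on (rspec x) f" "\<And>t. t \<in> rspec x \<Longrightarrow> f t = g t"
  shows "rfc f x = rfc g x"
  unfolding rfc_def by (rule cfc_cong[OF assms(1) rfc_continuous[OF assms(2)]]) (simp add: assms(3) rspec_def)

lemma rfc_add:
  assumes "selfadj x" "continuous_on (rspec x) f" "continuous_on (rspec x) g"
  shows "rfc (\<lambda>t. f t + g t) x = rfc f x + rfc g x"
  using cfc_add[OF assms(1) rfc_continuous[OF assms(2)] rfc_continuous[OF assms(3)]] by (simp add: rfc_def)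

lemma rfc_mult:
  assumes "selfadj x" "continuous_on (rspec x) f" "continuous_on (rspec x) g"
  shows "rfc (\<lambda>t. f t * g t) x = rfc f x * rfc g x"
  using cfc_mult[OF assms(1) rfc_continuous[OF assms(2)] rfc_continuous[OF assms(3)]] by (simp add: rfc_def)

lemma rfc_cmult:
  assumes "selfadj x" "continuous_on (rspec x) f"
  shows "rfc (\<lambda>t. c * f t) x = c *\<^sub>R rfc f x"
  using cfc_cmult[OF assms(1) rfc_continuous[OF assms(2)]] by (simp add: rfc_def scaleR_scaleC)

lemma rfc_id: "selfadj x \<Longrightarrow> rfc (\<lambda>t. t) x = x"
proof -
  assume x: "selfadj x"
  have "cfc (\<lambda>z. complex_of_real (Re z)) x = cfc (\<lambda>z. z) x"
    using selfadj_spec_real[OF x]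
    by (intro cfc_cong[OF x] continuous_on_of_real continuous_on_Re continuous_on_id) (simp add: complex_eq_iff)
  then show ?thesis using x by (simp add: rfc_def cfc_id)
qed

lemma rfc_const: "selfadj x \<Longrightarrow> rfc (\<lambda>_. c) x = c *\<^sub>R 1"
  by (simp add: rfc_def cfc_const scaleR_scaleC)

lemma rfc_diff:
  assumes "selfadj x" "continuous_on (rspec x) f" "continuous_on (rspec x) g"
  shows "rfc (\<lambda>t. f t - g t) x = rfc f x - rfc g x"
  using rfc_add[OF assms(1,2), of "\<lambda>t. (- 1) * g t"] rfc_cmult[OF assms(1,3), of "- 1"] assms(3)
  by (simp add: continuous_on_minus)

lemma rfc_selfadj:
  assumes "selfadj x" "continuous_on (rspec x) f"
  shows "selfadj (rfc f x)"
  using cfc_star[OF assms(1) rfc_continuous[OF assms(2)]] by (simp add: rfc_def)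

lemma norm_rfc_le:
  assumes "selfadj x" "continuous_on (rspec x) f" "\<And>t. t \<in> rspec x \<Longrightarrow> \<bar>f t\<bar> \<le> B"
  shows "norm (rfc f x) \<le> B"
  unfolding rfc_def by (rule norm_cfc_le[OF assms(1) rfc_continuous[OF assms(2)]]) (simp add: assms(3) rspec_def)

lemma norm_rfc_ge:
  assumes "selfadj x" "continuous_on (rspec x) f" "t \<in> rspec x"
  shows "\<bar>f t\<bar> \<le> norm (rfc f x)"
  using norm_cfc_ge[OF assms(1) rfc_continuous[OF assms(2)], of "complex_of_real t"] assms(1,3)
  by (simp add: rfc_def mem_rspec)

lemma rfc_eigen:
  assumes "selfadj x" "continuous_on (rspec x) f" "x * s = l *\<^sub>R s" "l \<in> rspec x"
  shows "rfc f x * s = f l *\<^sub>R s"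
  using cfc_eigen[OF assms(1) rfc_continuous[OF assms(2)], of s "complex_of_real l"] assms
  by (simp add: rfc_def mem_rspec scaleR_scaleC)

lemma rspec_norm: "selfadj x \<Longrightarrow> t \<in> rspec x \<Longrightarrow> \<bar>t\<bar> \<le> norm (x::'a::unital_cstar_algebra)"
  using spec_norm_le[of "complex_of_real t" x] by (simp add: mem_rspec)

lemma norm_le_if_rspec_le:
  assumes "selfadj x" "\<And>t. t \<in> rspec x \<Longrightarrow> \<bar>t\<bar> \<le> B"
  shows "norm (x::'a::unital_cstar_algebra) \<le> B"
  using norm_rfc_le[OF assms(1) continuous_on_id assms(2)] by (simp add: rfc_id assms(1))

lemma rspec_nonempty: "selfadj (x::'a::unital_cstar_algebra) \<Longrightarrow> rspec x \<noteq> {}"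
  using spec_nonempty by (auto simp: rspec_def)

lemma compact_rspec: "compact (rspec (x::'a::unital_cstar_algebra))"
  unfolding rspec_def by (intro compact_continuous_image continuous_on_Re continuous_on_id compact_spec)

lemma spec_shift: "z \<in> spec (c *\<^sub>C 1 - x) \<longleftrightarrow> c - z \<in> spec (x::'a::{ring_1,star_algebra})"
proof -
  have eq: "c *\<^sub>C 1 - x - z *\<^sub>C 1 = - (x - (c - z) *\<^sub>C 1)"
    by (simp add: scaleC_diff_left)
  have "(\<exists>y. inverse_of (- u) y) \<longleftrightarrow> (\<exists>y. inverse_of u y)" for u :: 'a
  proof -
    have "inverse_of (- u) y \<longleftrightarrow> inverse_of u (- y)" for y by (simp add: inverse_of_def)
    then show ?thesis by (metis minus_minus)
  qed
  then show ?thesis unfolding spec_def mem_Collect_eq eq by (simp del: minus_diff_eq)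
qed

lemma rspec_shift:
  assumes "selfadj (x::'a::unital_cstar_algebra)"
  shows "t \<in> rspec (c *\<^sub>R 1 - x) \<longleftrightarrow> c - t \<in> rspec x"
proof -
  have "selfadj (c *\<^sub>R 1 - x)" using assms by (simp add: star_diff)
  then show ?thesis using assms spec_shift[of "complex_of_real t" "complex_of_real c" x]
    by (simp add: mem_rspec scaleR_scaleC)
qed

lemma spec_mult_commute:
  assumes "z \<noteq> 0" "z \<in> spec (x * y)"
  shows "z \<in> spec (y * (x::'a::{ring_1,star_algebra}))"
proof (rule ccontr)
  assume "z \<notin> spec (y * x)"
  then obtain u where u: "inverse_of (y * x - z *\<^sub>C 1) u" by (auto simp: spec_def)
  \<comment> \<open>Formally, the geometric series of \<open>x y\<close> is 1 plus \<open>x\<close>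
    times that of \<open>y x\<close> times \<open>y\<close>; this suggests
    \<open>(x u y - 1) / z\<close> as the inverse.\<close>
  let ?w = "x * u * y - 1"
  have "(x * y - z *\<^sub>C 1) * ?w = x * ((y * x - z *\<^sub>C 1) * u) * y - x * y + z *\<^sub>C 1"
    by (simp add: algebra_simps scaleC_diff_right)
  moreover have "?w * (x * y - z *\<^sub>C 1) = x * (u * (y * x - z *\<^sub>C 1)) * y - x * y + z *\<^sub>C 1"
    by (simp add: algebra_simps scaleC_diff_right)
  ultimately have "inverse_of (x * y - z *\<^sub>C 1) ((1 / z) *\<^sub>C ?w)"
    using u assms(1) by (simp add: inverse_of_def)
  with assms(2) show False by (auto simp: spec_def)
qed

text \<open>Spectral positivity, which is convenient for sums and functional calculus. That it
  agrees with the factorization in \<open>positive\<close> rests on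
  \<open>nonneg_star_mult\<close>.\<close>

definition nonneg :: "'a::unital_cstar_algebra \<Rightarrow> bool" where
  "nonneg a \<longleftrightarrow> selfadj a \<and> (\<forall>t\<in>rspec a. t \<ge> 0)"

text \<open>Together with \<open>nonneg_norm_le\<close> this makes positivity a norm inequality, so
  that closure under sums becomes the triangle inequality.\<close>

lemma nonneg_if_norm_le:
  assumes "selfadj a" "norm (r *\<^sub>R 1 - a) \<le> r"
  shows "nonneg a"
  unfolding nonneg_def
proof (intro conjI ballI assms(1))
  fix t assume "t \<in> rspec a"
  then have "r - t \<in> rspec (r *\<^sub>R 1 - a)" by (simp add: rspec_shift assms(1))
  then have "\<bar>r - t\<bar> \<le> r"
    using rspec_norm[of "r *\<^sub>R 1 - a"] assms by (simp add: star_diff) force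
  then show "t \<ge> 0" by simp
qed

lemma nonneg_norm_le:
  assumes "nonneg a" "norm a \<le> r"
  shows "norm (r *\<^sub>R 1 - a) \<le> r"
proof (rule norm_le_if_rspec_le)
  show "selfadj (r *\<^sub>R 1 - a)" using assms(1) by (simp add: star_diff nonneg_def)
  fix t assume "t \<in> rspec (r *\<^sub>R 1 - a)"
  then have "r - t \<in> rspec a" using assms(1) by (simp add: rspec_shift nonneg_def)
  then have "0 \<le> r - t" "\<bar>r - t\<bar> \<le> r"
    using assms rspec_norm[of a "r - t"] by (auto simp: nonneg_def)
  then show "\<bar>t\<bar> \<le> r" by linarith
qed

lemma nonneg_add:
  assumes "nonneg a" "nonneg b"
  shows "nonneg (a + b)"
proof (rule nonneg_if_norm_le)
  show "selfadj (a + b)" using assms by (simp add: nonneg_def star_add)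
  have "(norm a + norm b) *\<^sub>R 1 - (a + b) = (norm a *\<^sub>R 1 - a) + (norm b *\<^sub>R 1 - b)"
    by (simp add: scaleR_add_left)
  then show "norm ((norm a + norm b) *\<^sub>R 1 - (a + b)) \<le> norm a + norm b"
    using nonneg_norm_le[OF assms(1) order_refl] nonneg_norm_le[OF assms(2) order_refl]
    by (simp only: norm_triangle_mono)
qed

lemma nonneg_rfc:
  assumes "selfadj x" "continuous_on (rspec x) f" "\<And>t. t \<in> rspec x \<Longrightarrow> f t \<ge> 0"
  shows "nonneg (rfc f x)"
proof (rule nonneg_if_norm_le)
  show "selfadj (rfc f x)" using assms by (intro rfc_selfadj)
  let ?B = "norm (rfc f x)"
  have "norm (rfc (\<lambda>t. ?B - f t) x) \<le> ?B"
  proof (rule norm_rfc_le)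
    fix t assume "t \<in> rspec x"
    then show "\<bar>?B - f t\<bar> \<le> ?B"
      using assms(3)[of t] norm_rfc_ge[OF assms(1,2), of t] by auto
  qed (auto intro!: assms continuous_intros)
  then show "norm (?B *\<^sub>R 1 - rfc f x) \<le> ?B"
    using assms by (simp add: rfc_diff rfc_const)
qed

lemma nonneg_square:
  assumes "selfadj u"
  shows "nonneg (u * u)"
  using nonneg_rfc[OF assms, of "\<lambda>t. t * t"] assms
  by (simp add: rfc_mult rfc_id continuous_on_mult continuous_on_id)

lemma nonneg_antisym:
  assumes "nonneg a" "nonneg (- a)"
  shows "a = 0"
proof -
  have sa: "selfadj a" using assms(1) by (simp add: nonneg_def)
  have "norm a \<le> 0"
  proof (rule norm_le_if_rspec_le[OF sa])
    fix t assume t: "t \<in> rspec a"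
    then have "- t \<in> rspec (- a)" using rspec_shift[OF sa, of "- t" 0] by simp
    then show "\<bar>t\<bar> \<le> 0" using t assms by (force simp: nonneg_def)
  qed
  then show ?thesis by simp
qed

lemma nonneg_scaleR:
  assumes "nonneg a" "r \<ge> 0"
  shows "nonneg (r *\<^sub>R a)"
proof -
  have a: "selfadj a" "\<And>t. t \<in> rspec a \<Longrightarrow> 0 \<le> t" using assms(1) by (auto simp: nonneg_def)
  have "rfc (\<lambda>t. r * t) a = r *\<^sub>R a"
    using rfc_cmult[OF a(1) continuous_on_id] rfc_id[OF a(1)] by simp
  moreover have "nonneg (rfc (\<lambda>t. r * t) a)"
    using assms(2) a by (intro nonneg_rfc continuous_intros) auto
  ultimately show ?thesis by simp
qed

lemma selfadj_decomposition:
  fixes y :: "'a::star_algebra"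
  obtains u v where "selfadj u" "selfadj v" "y = u + \<i> *\<^sub>C v"
proof (rule that)
  let ?u = "(1 / 2) *\<^sub>C (y + star y)" and ?v = "(- \<i> / 2) *\<^sub>C (y - star y)"
  show "selfadj ?u" "selfadj ?v"
    by (simp_all add: star_add star_diff scaleC_diff_right algebra_simps)
  show "y = ?u + \<i> *\<^sub>C ?v"
    by (simp add: scaleC_add_right scaleC_diff_right flip: scaleC_add_left)
qed

text \<open>\<open>t\<^sup>*t + t t\<^sup>*\<close> is a sum of squares, and \<open>t\<^sup>*t\<close>, \<open>t t\<^sup>*\<close> have the same nonzero spectrum.\<close>

lemma star_mult_eq_0_if_nonpos:
  fixes t :: "'a::unital_cstar_algebra"
  assumes neg: "nonneg (- (star t * t))"
  shows "star t * t = 0"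
proof -
  have sa: "selfadj (star t * t)" "selfadj (t * star t)" by (simp_all add: star_mult)
  obtain u v where suv: "selfadj u" "selfadj v" and t: "t = u + \<i> *\<^sub>C v"
    by (rule selfadj_decomposition)
  have "star t * t + t * star t = 2 *\<^sub>R (u * u + v * v)"
    unfolding t using suv
    by (simp add: star_add algebra_simps scaleR_2 scaleC_add_right scaleC_diff_right)
  moreover have "nonneg (2 *\<^sub>R (u * u + v * v))"
    by (intro nonneg_scaleR nonneg_add nonneg_square suv) simp
  ultimately have "nonneg (star t * t + t * star t)" by (simp only:)
  from nonneg_add[OF this neg] have ts: "nonneg (t * star t)" by simp
  have "nonneg (star t * t)"
    unfolding nonneg_def
  proof (intro conjI ballI sa)
    fix r assume r: "r \<in> rspec (star t * t)"
    show "r \<ge> 0"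
    proof (cases "r = 0")
      case False
      have "complex_of_real r \<in> spec (t * star t)"
        using r False by (intro spec_mult_commute[of _ "star t" t]) (simp_all add: mem_rspec sa)
      then have "r \<in> rspec (t * star t)" by (simp add: mem_rspec sa)
      then show ?thesis using ts by (simp add: nonneg_def)
    qed simp
  qed
  with neg show ?thesis using nonneg_antisym by blast
qed

text \<open>With \<open>n\<close> the negative part of \<open>y\<^sup>*y\<close> and \<open>t = y n\<close> one has \<open>t\<^sup>*t = - n\<^sup>3\<close>.\<close>

lemma nonneg_star_mult: "nonneg (star y * (y::'a::unital_cstar_algebra))"
proof -
  let ?h = "star y * y"
  have sa: "selfadj ?h" by (simp add: star_mult)
  define m :: "real \<Rightarrow> real" where "m t = max (- t) 0" for t
  have m: "continuous_on S m" for S unfolding m_def by (intro continuous_intros)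
  let ?n = "rfc m ?h"
  define t where "t = y * ?n"
  have sn: "selfadj ?n" by (rule rfc_selfadj[OF sa m])
  have "star t * t = ?n * ?h * ?n" using sn by (simp add: t_def star_mult mult.assoc)
  also have "\<dots> = rfc (\<lambda>s. m s * s * m s) ?h"
    by (simp add: rfc_mult[OF sa] rfc_id[OF sa] m continuous_on_mult continuous_on_id)
  also have "\<dots> = rfc (\<lambda>s. (- 1) * (m s * m s * m s)) ?h"
  proof (rule rfc_cong[OF sa])
    show "continuous_on (rspec ?h) (\<lambda>s. m s * s * m s)" by (intro continuous_intros m)
  qed (simp add: m_def max_def)
  finally have tt: "star t * t = - rfc (\<lambda>s. m s * m s * m s) ?h"
    by (subst (asm) rfc_cmult[OF sa]) (auto intro!: continuous_intros m)
  have "nonneg (- (star t * t))"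
    unfolding tt minus_minus by (rule nonneg_rfc[OF sa]) (auto intro!: continuous_intros m simp: m_def)
  then have "star t * t = 0" by (rule star_mult_eq_0_if_nonpos)
  with tt have z: "rfc (\<lambda>s. m s * m s * m s) ?h = 0" by simp
  have "s \<ge> 0" if s: "s \<in> rspec ?h" for s
  proof -
    have "\<bar>m s * m s * m s\<bar> \<le> norm (rfc (\<lambda>s. m s * m s * m s) ?h)"
      by (rule norm_rfc_ge[OF sa _ s]) (intro continuous_intros m)
    then have "m s * m s * m s = 0" unfolding z by simp
    then have "m s = 0" by simp
    then show ?thesis by (simp add: m_def max_def split: if_splits)
  qed
  then show ?thesis using sa by (simp add: nonneg_def)
qed

lemma positive_iff_nonneg: "positive a \<longleftrightarrow> nonneg (a::'a::unital_cstar_algebra)"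
proof
  assume "nonneg a"
  then have a: "selfadj a" "\<And>t. t \<in> rspec a \<Longrightarrow> t \<ge> 0" by (auto simp: nonneg_def)
  have c: "continuous_on (rspec a) sqrt" by (intro continuous_intros)
  have "rfc sqrt a * rfc sqrt a = rfc (\<lambda>t. sqrt t * sqrt t) a"
    by (rule rfc_mult[OF a(1) c c, symmetric])
  also have "\<dots> = rfc (\<lambda>t. t) a"
    by (rule rfc_cong[OF a(1)]) (use a(2) in \<open>auto intro!: continuous_intros\<close>)
  finally have "a = star (rfc sqrt a) * rfc sqrt a"
    using rfc_selfadj[OF a(1) c] by (simp add: rfc_id a)
  then show "positive a" unfolding positive_def by blast
qed (auto simp: positive_def nonneg_star_mult)

section \<open>The order given by positive differences\<close>

definition cstar_le :: "'a::star_algebra \<Rightarrow> 'a \<Rightarrow> bool" (infix "\<preceq>" 50) where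
  "a \<preceq> b \<longleftrightarrow> positive (b - a)"

lemma positive_selfadj: "positive a \<Longrightarrow> selfadj a"
  by (auto simp: positive_def star_mult)

lemma positive_conj: "positive a \<Longrightarrow> positive (z * a * star z)"
proof -
  assume "positive a"
  then obtain y where "a = star y * y" by (auto simp: positive_def)
  then have "z * a * star z = star (y * star z) * (y * star z)" by (simp add: star_mult mult.assoc)
  then show ?thesis unfolding positive_def by blast
qed

lemma positive_square: "selfadj a \<Longrightarrow> positive (a * a)"
  unfolding positive_def by (intro exI[of _ a]) simp

lemma positive_add: "positive a \<Longrightarrow> positive b \<Longrightarrow> positive (a + b :: 'a::unital_cstar_algebra)"
  by (simp add: positive_iff_nonneg nonneg_add)

lemma positive_scaleR: "positive a \<Longrightarrow> r \<ge> 0 \<Longrightarrow> positive (r *\<^sub>R (a :: 'a::unital_cstar_algebra))"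
  by (simp add: positive_iff_nonneg nonneg_scaleR)

lemma positive_rfc:
  assumes "selfadj x" "continuous_on (rspec x) f" "\<And>t. t \<in> rspec x \<Longrightarrow> f t \<ge> 0"
  shows "positive (rfc f x)"
  using nonneg_rfc[OF assms] by (simp add: positive_iff_nonneg)

lemma positive_rspec: "positive (a::'a::unital_cstar_algebra) \<Longrightarrow> t \<in> rspec a \<Longrightarrow> t \<ge> 0"
  by (simp add: positive_iff_nonneg nonneg_def)

lemma cstar_le_refl: "a \<preceq> (a::'a::star_algebra)"
  unfolding cstar_le_def positive_def by (intro exI[of _ 0]) simp

lemma cstar_le_trans [trans]: "a \<preceq> b \<Longrightarrow> b \<preceq> c \<Longrightarrow> a \<preceq> (c::'a::unital_cstar_algebra)"
  using positive_add[of "b - a" "c - b"] by (simp add: cstar_le_def)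

lemma cstar_le_add: "a \<preceq> b \<Longrightarrow> c \<preceq> d \<Longrightarrow> a + c \<preceq> b + (d::'a::unital_cstar_algebra)"
  using positive_add[of "b - a" "d - c"] by (simp add: cstar_le_def algebra_simps)

lemma cstar_le_scaleR: "a \<preceq> b \<Longrightarrow> r \<ge> 0 \<Longrightarrow> r *\<^sub>R a \<preceq> r *\<^sub>R (b::'a::unital_cstar_algebra)"
  using positive_scaleR[of "b - a" r] by (simp add: cstar_le_def scaleR_diff_right)

lemma cstar_le_conj: "a \<preceq> b \<Longrightarrow> z * a * star z \<preceq> z * (b::'a::star_algebra) * star z"
  using positive_conj[of "b - a" z] by (simp add: cstar_le_def algebra_simps)

lemma cstar_le_conj_selfadj:
  "a \<preceq> b \<Longrightarrow> selfadj z \<Longrightarrow> z * a * z \<preceq> z * (b::'a::star_algebra) * z"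
  using cstar_le_conj[of a b z] by simp

lemma rfc_mono:
  assumes "selfadj x" "continuous_on (rspec x) f" "continuous_on (rspec x) g"
    "\<And>t. t \<in> rspec x \<Longrightarrow> f t \<le> g t"
  shows "rfc f x \<preceq> rfc g x"
  unfolding cstar_le_def rfc_diff[OF assms(1,3,2), symmetric]
  by (rule positive_rfc) (auto intro!: assms continuous_intros)

lemma cstar_le_norm:
  assumes "selfadj a" "norm (a::'a::unital_cstar_algebra) \<le> r"
  shows "a \<preceq> r *\<^sub>R 1"
proof -
  have "rfc (\<lambda>t. t) a \<preceq> rfc (\<lambda>_. r) a"
    by (rule rfc_mono) (use assms rspec_norm[OF assms(1)] in \<open>force intro: continuous_on_id continuous_on_const\<close>)+
  then show ?thesis by (simp add: rfc_id rfc_const assms(1))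
qed

lemma norm_le_if_cstar_le:
  assumes "positive a" "a \<preceq> r *\<^sub>R (1::'a::unital_cstar_algebra)"
  shows "norm a \<le> r"
proof (rule norm_le_if_rspec_le[OF positive_selfadj[OF assms(1)]])
  fix t assume t: "t \<in> rspec a"
  then have "r - t \<in> rspec (r *\<^sub>R 1 - a)"
    using rspec_shift[OF positive_selfadj[OF assms(1)]] by simp
  then have "r - t \<ge> 0"
    using assms(2) positive_rspec[of "r *\<^sub>R 1 - a" "r - t"] by (simp add: cstar_le_def)
  then show "\<bar>t\<bar> \<le> r" using positive_rspec[OF assms(1) t] by simp
qed

lemma norm_mono:
  assumes "positive a" "a \<preceq> (b::'a::unital_cstar_algebra)" "selfadj b"
  shows "norm a \<le> norm b"
  using norm_le_if_cstar_le[OF assms(1)] cstar_le_trans[OF assms(2) cstar_le_norm[OF assms(3) order_refl]]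
  by blast

lemma rfc_sqrt:
  assumes "positive (a::'a::unital_cstar_algebra)"
  shows "selfadj (rfc sqrt a)" "rfc sqrt a * rfc sqrt a = a"
proof -
  have sa: "selfadj a" using assms by (rule positive_selfadj)
  have c: "continuous_on (rspec a) sqrt" by (intro continuous_intros)
  show "selfadj (rfc sqrt a)" by (rule rfc_selfadj[OF sa c])
  have "rfc sqrt a * rfc sqrt a = rfc (\<lambda>t. sqrt t * sqrt t) a"
    by (rule rfc_mult[OF sa c c, symmetric])
  also have "\<dots> = rfc (\<lambda>t. t) a"
    by (rule rfc_cong[OF sa]) (use positive_rspec[OF assms] in \<open>auto intro!: continuous_intros\<close>)
  finally show "rfc sqrt a * rfc sqrt a = a" by (simp add: rfc_id sa)
qed

text \<open>The witness is \<open>v = G\<^sup>1\<^sup>/\<^sup>2 (Y + \<kappa>)\<^sup>-\<^sup>1\<^sup>/\<^sup>2\<close>: with \<open>k = (Y + \<kappa>)\<^sup>-\<^sup>1\<^sup>/\<^sup>2\<close> one has \<open>1 - k Y k = \<kappa> k\<^sup>2\<close>,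
  so that \<open>G - v Y v\<^sup>*\<close> has norm \<open>\<kappa> \<parallel>k G k\<parallel>\<close>.\<close>

lemma norm_diff_conj_le_if_le:
  fixes G Y :: "'a::unital_cstar_algebra"
  assumes G: "positive G" and Y: "positive Y" and le: "G \<preceq> Y + \<mu> *\<^sub>R 1" and "\<mu> \<ge> 0" "\<kappa> > 0"
  defines "v \<equiv> rfc sqrt G * rfc (\<lambda>t. 1 / sqrt (t + \<kappa>)) Y"
  shows "norm (G - v * Y * star v) \<le> \<mu> + \<kappa>"
proof -
  have sY: "selfadj Y" using Y by (rule positive_selfadj)
  have pos: "t + \<kappa> > 0" "t \<ge> 0" if "t \<in> rspec Y" for t
    using positive_rspec[OF Y that] \<open>\<kappa> > 0\<close> by auto
  have c: "continuous_on (rspec Y) (\<lambda>t. 1 / sqrt (t + \<kappa>))"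
    using pos by (intro continuous_intros) force+
  define k where "k = rfc (\<lambda>t. 1 / sqrt (t + \<kappa>)) Y"
  define g where "g = rfc sqrt G"
  have sk: "selfadj k" unfolding k_def by (rule rfc_selfadj[OF sY c])
  have g: "selfadj g" "g * g = G" unfolding g_def using rfc_sqrt[OF G] by auto
  have kk: "k * k = rfc (\<lambda>t. 1 / (t + \<kappa>)) Y"
  proof -
    have "k * k = rfc (\<lambda>t. 1 / sqrt (t + \<kappa>) * (1 / sqrt (t + \<kappa>))) Y"
      unfolding k_def by (rule rfc_mult[OF sY c c, symmetric])
    also have "\<dots> = rfc (\<lambda>t. 1 / (t + \<kappa>)) Y"
    proof (rule rfc_cong[OF sY])
      fix t assume "t \<in> rspec Y"
      then show "1 / sqrt (t + \<kappa>) * (1 / sqrt (t + \<kappa>)) = 1 / (t + \<kappa>)"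
        using pos[of t] by simp
    qed (intro continuous_intros c)
    finally show ?thesis .
  qed
  have c': "continuous_on (rspec Y) (\<lambda>t. 1 / (t + \<kappa>))"
    using pos by (intro continuous_intros) force+
  have kYk: "k * (Y + \<mu> *\<^sub>R 1) * k = rfc (\<lambda>t. 1 / sqrt (t + \<kappa>) * (t + \<mu>) * (1 / sqrt (t + \<kappa>))) Y" for \<mu>
  proof -
    have "Y + \<mu> *\<^sub>R 1 = rfc (\<lambda>t. t + \<mu>) Y"
      by (simp add: rfc_add[OF sY] rfc_id[OF sY] rfc_const[OF sY] continuous_on_id continuous_on_const)
    moreover have "continuous_on (rspec Y) (\<lambda>t. t + \<mu>)" by (intro continuous_intros)
    ultimately show ?thesis
      using rfc_mult[OF sY continuous_on_mult[OF c] c, of "\<lambda>t. t + \<mu>"] rfc_mult[OF sY c, of "\<lambda>t. t + \<mu>"]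
      by (simp only: k_def)
  qed
  have frac: "1 / sqrt (t + \<kappa>) * (t + \<mu>) * (1 / sqrt (t + \<kappa>)) = (t + \<mu>) / (t + \<kappa>)" if "t \<in> rspec Y" for t \<mu>
    using pos[OF that] by (simp add: field_simps)
  have *: "1 - k * Y * k = \<kappa> *\<^sub>R (k * k)"
  proof -
    have "k * Y * k = rfc (\<lambda>t. 1 - \<kappa> * (1 / (t + \<kappa>))) Y"
    proof -
      have "rfc (\<lambda>t. 1 - \<kappa> * (1 / (t + \<kappa>))) Y = rfc (\<lambda>t. 1 / sqrt (t + \<kappa>) * (t + 0) * (1 / sqrt (t + \<kappa>))) Y"
      proof (rule rfc_cong[OF sY])
        fix t assume t: "t \<in> rspec Y"
        show "1 - \<kappa> * (1 / (t + \<kappa>)) = 1 / sqrt (t + \<kappa>) * (t + 0) * (1 / sqrt (t + \<kappa>))"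
          unfolding frac[OF t] using pos[OF t] by (simp add: field_simps)
      qed (intro continuous_intros c')
      then show ?thesis using kYk[of 0] by simp
    qed
    also have "\<dots> = 1 - \<kappa> *\<^sub>R (k * k)"
      by (simp only: rfc_diff[OF sY continuous_on_const continuous_on_mult[OF continuous_on_const c']]
          rfc_cmult[OF sY c'] rfc_const[OF sY] kk scaleR_one)
    finally show ?thesis by simp
  qed
  have "G - v * Y * star v = \<kappa> *\<^sub>R (g * k * (star (g * k)))"
  proof -
    have "G - v * Y * star v = g * (1 - k * Y * k) * g"
      using g sk by (simp add: v_def k_def[symmetric] g_def[symmetric] star_mult algebra_simps)
    then show ?thesis unfolding * using g sk by (simp add: star_mult mult.assoc)
  qed
  then have "norm (G - v * Y * star v) = \<kappa> * norm (star (g * k) * (g * k))"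
    using \<open>\<kappa> > 0\<close> by (simp add: cstar_identity cstar_identity')
  also have "star (g * k) * (g * k) = k * G * k"
    unfolding g(2)[symmetric] using g(1) sk by (simp add: star_mult mult.assoc)
  also have "norm (k * G * k) \<le> (\<mu> + \<kappa>) / \<kappa>"
  proof (rule norm_le_if_cstar_le)
    show "positive (k * G * k)" using positive_conj[OF G, of k] sk by simp
    have "k * G * k \<preceq> k * (Y + \<mu> *\<^sub>R 1) * k" by (rule cstar_le_conj_selfadj[OF le sk])
    also have "\<dots> \<preceq> ((\<mu> + \<kappa>) / \<kappa>) *\<^sub>R 1"
    proof -
      have "rfc (\<lambda>t. 1 / sqrt (t + \<kappa>) * (t + \<mu>) * (1 / sqrt (t + \<kappa>))) Y \<preceq> rfc (\<lambda>_. (\<mu> + \<kappa>) / \<kappa>) Y"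
      proof (rule rfc_mono[OF sY])
        fix t assume t: "t \<in> rspec Y"
        have "(t + \<mu>) * \<kappa> \<le> (\<mu> + \<kappa>) * (t + \<kappa>)"
          using mult_nonneg_nonneg[OF \<open>\<mu> \<ge> 0\<close> pos(2)[OF t]] mult_nonneg_nonneg[of \<kappa> \<kappa>] \<open>\<kappa> > 0\<close>
          by (simp add: algebra_simps)
        then show "1 / sqrt (t + \<kappa>) * (t + \<mu>) * (1 / sqrt (t + \<kappa>)) \<le> (\<mu> + \<kappa>) / \<kappa>"
          unfolding frac[OF t] using pos[OF t] \<open>\<kappa> > 0\<close>
          by (simp add: divide_le_eq pos_le_divide_eq)
      qed (intro continuous_intros c)+
      then show ?thesis by (simp only: kYk rfc_const[OF sY])
    qed
    finally show "k * G * k \<preceq> ((\<mu> + \<kappa>) / \<kappa>) *\<^sub>R 1" .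
  qed
  finally show ?thesis using \<open>\<kappa> > 0\<close> by (simp add: mult_left_mono)
qed

section \<open>The norm on the unitization\<close>

text \<open>The algebra is an ideal of its unitization; this is the action on it, whose operator
  norm enters the norm of the unitization.\<close>

definition left_mult :: "'a::cstar_algebra unitization \<Rightarrow> 'a \<Rightarrow> 'a" where
  "left_mult y b = scalar_part y *\<^sub>C b + algebra_part y * b"

lemma unitization_simps [simp]:
  "scalar_part (x + y) = scalar_part x + scalar_part y"
  "algebra_part (x + y) = algebra_part x + algebra_part y"
  "scalar_part (x - y) = scalar_part x - scalar_part y"
  "algebra_part (x - y) = algebra_part x - algebra_part y"
  "scalar_part (x * y) = scalar_part x * scalar_part y"
  "algebra_part (x * y) = scalar_part x *\<^sub>C algebra_part y + scalar_part y *\<^sub>C algebra_part x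
    + algebra_part x * algebra_part y"
  "scalar_part (c *\<^sub>C x) = c * scalar_part x"
  "algebra_part (c *\<^sub>C x) = c *\<^sub>C algebra_part x"
  "scalar_part (star x) = cnj (scalar_part x)"
  "algebra_part (star x) = star (algebra_part x)"
  "scalar_part 0 = 0" "algebra_part 0 = 0" "scalar_part 1 = 1" "algebra_part 1 = 0"
  for x y :: "'a::star_algebra unitization"
  by (cases x; cases y; simp add: zero_unitization_def one_unitization_def)+

lemma bounded_linear_left_mult: "bounded_linear (left_mult y)"
  unfolding left_mult_def
  by (intro bounded_linear_add bounded_linear_scaleC_right bounded_linear_mult_right)

lemma left_mult_add: "left_mult (x + y) = (\<lambda>b. left_mult x b + left_mult y b)"
  by (simp add: left_mult_def fun_eq_iff scaleC_add_left algebra_simps)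

lemma left_mult_scaleC: "left_mult (c *\<^sub>C x) b = c *\<^sub>C left_mult x b"
  by (simp add: left_mult_def scaleC_add_right)

lemma left_mult_mult: "left_mult (x * y) = left_mult x \<circ> left_mult y"
  by (simp add: left_mult_def fun_eq_iff scaleC_add_right scaleC_add_left algebra_simps)

lemma star_left_mult: "star (left_mult y b) * left_mult y b = star b * left_mult (star y * y) b"
  by (simp add: left_mult_def star_add star_mult scaleC_add_right scaleC_add_left algebra_simps)

text \<open>\<open>|y b|\<^sup>2 = |b* (y* y) b|\<close> in norm gives
  \<open>|y|\<^sup>2 <= |y* y| <= |y*| |y|\<close>. Hence \<open>|y| <= |y*|\<close>, by symmetry
  both are equal, and the chain collapses.\<close>

lemma onorm_left_mult_star_mult: "onorm (left_mult (star y * y)) = (onorm (left_mult y))\<^sup>2"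
proof -
  have sq: "(onorm (left_mult y))\<^sup>2 \<le> onorm (left_mult (star y * y))" for y :: "'a unitization"
  proof -
    let ?N = "onorm (left_mult (star y * y))"
    have N: "?N \<ge> 0" by (rule onorm_pos_le[OF bounded_linear_left_mult])
    have "onorm (left_mult y) \<le> sqrt ?N"
    proof (rule onorm_bound)
      show "0 \<le> sqrt ?N" using N by simp
      fix b
      have "(norm (left_mult y b))\<^sup>2 = norm (star b * left_mult (star y * y) b)"
        by (simp only: cstar_identity[symmetric] star_left_mult)
      also have "\<dots> \<le> norm b * (?N * norm b)"
        using order_trans[OF norm_mult_ineq[of "star b" "left_mult (star y * y) b", unfolded norm_star]
          mult_left_mono[OF onorm[OF bounded_linear_left_mult, of "star y * y" b] norm_ge_zero]] .
      finally have "(norm (left_mult y b))\<^sup>2 \<le> (sqrt ?N * norm b)\<^sup>2"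
        using N by (simp add: power_mult_distrib power2_eq_square mult_ac)
      then show "norm (left_mult y b) \<le> sqrt ?N * norm b"
        by (rule power2_le_imp_le) (simp add: N)
    qed
    then have "(onorm (left_mult y))\<^sup>2 \<le> (sqrt ?N)\<^sup>2"
      by (rule power_mono) (rule onorm_pos_le[OF bounded_linear_left_mult])
    then show ?thesis using N by simp
  qed
  have prod: "onorm (left_mult (star y * y)) \<le> onorm (left_mult (star y)) * onorm (left_mult y)"
    for y :: "'a unitization"
    unfolding left_mult_mult by (rule onorm_compose[OF bounded_linear_left_mult bounded_linear_left_mult])
  have le: "onorm (left_mult y) \<le> onorm (left_mult (star y))" for y :: "'a unitization"
  proof (cases "onorm (left_mult y) = 0")
    case False
    then have "onorm (left_mult y) > 0"
      using onorm_pos_le[OF bounded_linear_left_mult, of y] by simp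
    then show ?thesis using order_trans[OF sq prod, of y] by (simp add: power2_eq_square)
  qed (simp add: onorm_pos_le[OF bounded_linear_left_mult])
  have "onorm (left_mult (star y)) = onorm (left_mult y)"
    using le[of y] le[of "star y"] by simp
  then show ?thesis using sq[of y] prod[of y] by (simp add: power2_eq_square)
qed

text \<open>The lower bound is seen on \<open>star x\<close>, by the C*-identity.\<close>

lemma onorm_left_mult_embed: "onorm (left_mult (Unitization 0 x)) = norm (x::'a::cstar_algebra)"
proof (rule antisym)
  show "onorm (left_mult (Unitization 0 x)) \<le> norm x"
    by (rule onorm_bound) (simp_all add: left_mult_def norm_mult_ineq)
  have "(norm x)\<^sup>2 \<le> onorm (left_mult (Unitization 0 x)) * norm x"
    using onorm[OF bounded_linear_left_mult, of "Unitization 0 x" "star x"]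
    by (simp add: left_mult_def cstar_identity')
  then show "norm x \<le> onorm (left_mult (Unitization 0 x))"
    by (cases "x = 0") (simp_all add: power2_eq_square onorm_pos_le[OF bounded_linear_left_mult])
qed

lemma onorm_left_mult_scaleC: "onorm (left_mult (c *\<^sub>C x)) = cmod c * onorm (left_mult x)"
proof -
  have on: "onorm (left_mult x) \<ge> 0" for x :: "'a unitization"
    by (rule onorm_pos_le[OF bounded_linear_left_mult])
  have le: "onorm (left_mult (c *\<^sub>C x)) \<le> cmod c * onorm (left_mult x)" for c and x :: "'a unitization"
  proof (rule onorm_bound)
    show "0 \<le> cmod c * onorm (left_mult x)" by (simp add: on)
    fix b show "norm (left_mult (c *\<^sub>C x) b) \<le> cmod c * onorm (left_mult x) * norm b"
      using onorm[OF bounded_linear_left_mult, of x b]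
      by (simp add: left_mult_scaleC norm_scaleC mult.assoc mult_left_mono)
  qed
  show ?thesis
  proof (cases "c = 0")
    case True
    then show ?thesis using le[of 0 x] on[of "0 *\<^sub>C x"] by simp
  next
    case False
    then have "onorm (left_mult x) \<le> cmod (1 / c) * onorm (left_mult (c *\<^sub>C x))"
      using le[of "1 / c" "c *\<^sub>C x"] by simp
    then have "cmod c * onorm (left_mult x) \<le> onorm (left_mult (c *\<^sub>C x))"
      using False by (simp add: norm_divide field_simps)
    then show ?thesis using le[of c x] by simp
  qed
qed

instantiation unitization :: (cstar_algebra) real_algebra_1
begin

definition scaleR_unitization :: "real \<Rightarrow> 'a::cstar_algebra unitization \<Rightarrow> 'a unitization"
  where "scaleR_unitization r y = complex_of_real r *\<^sub>C y"

instance
  by standard (simp_all add: scaleR_unitization_def scaleC_add_right scaleC_add_left)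

end

text \<open>If \<open>A\<close> has a unit \<open>e\<close>, then \<open>1 - e\<close> annihilates \<open>A\<close>, so the operator norm of left
  multiplication alone is only a seminorm.\<close>

instantiation unitization :: (cstar_algebra) real_normed_algebra_1
begin

definition norm_unitization :: "'a::cstar_algebra unitization \<Rightarrow> real"
  where "norm_unitization y = max (cmod (scalar_part y)) (onorm (left_mult y))"

definition sgn_unitization :: "'a::cstar_algebra unitization \<Rightarrow> 'a unitization"
  where "sgn_unitization x = x /\<^sub>R max (cmod (scalar_part x)) (onorm (left_mult x))"

definition dist_unitization :: "'a::cstar_algebra unitization \<Rightarrow> 'a unitization \<Rightarrow> real"
  where "dist_unitization x y = norm (x - y)"

definition uniformity_unitization :: "('a::cstar_algebra unitization \<times> 'a unitization) filter"
  where "uniformity_unitization = (INF e\<in>{0<..}. principal {(x, y). dist x y < e})"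

definition open_unitization :: "'a::cstar_algebra unitization set \<Rightarrow> bool"
  where "open_unitization S \<longleftrightarrow> (\<forall>x\<in>S. \<forall>\<^sub>F (x', y) in uniformity. x' = x \<longrightarrow> y \<in> S)"

instance
proof
  fix x y z :: "'a unitization" and a b :: real and S :: "'a unitization set"
  show "dist x y = norm (x - y)" "sgn x = x /\<^sub>R norm x"
    "uniformity = (INF e\<in>{0<..}. principal {(x, y :: 'a unitization). dist x y < e})"
    "open S \<longleftrightarrow> (\<forall>x\<in>S. \<forall>\<^sub>F (x', y) in uniformity. x' = x \<longrightarrow> y \<in> S)"
    by (simp_all add: dist_unitization_def sgn_unitization_def norm_unitization_def
        uniformity_unitization_def open_unitization_def)
  have on: "onorm (left_mult x) \<ge> 0" for x :: "'a unitization"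
    by (rule onorm_pos_le[OF bounded_linear_left_mult])
  show "norm x = 0 \<longleftrightarrow> x = 0"
  proof
    assume n: "norm x = 0"
    then have s: "scalar_part x = 0" using on[of x]
      by (simp add: norm_unitization_def max_def split: if_splits)
    then have x: "x = Unitization 0 (algebra_part x)" by (cases x) simp
    have "onorm (left_mult x) = 0" using n on[of x] unfolding norm_unitization_def by linarith
    then have "algebra_part x = 0" using onorm_left_mult_embed[of "algebra_part x"] x by simp
    then show "x = 0" using x by (simp add: zero_unitization_def)
  next
    assume "x = 0"
    moreover have "left_mult (0 :: 'a unitization) = (\<lambda>_. 0)" by (simp add: left_mult_def fun_eq_iff)
    ultimately show "norm x = 0" by (simp add: norm_unitization_def onorm_zero)
  qed
  show "norm (x + y) \<le> norm x + norm y"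
  proof -
    have "onorm (left_mult (x + y)) \<le> onorm (left_mult x) + onorm (left_mult y)"
      unfolding left_mult_add by (rule onorm_triangle[OF bounded_linear_left_mult bounded_linear_left_mult])
    moreover have "cmod (scalar_part (x + y)) \<le> cmod (scalar_part x) + cmod (scalar_part y)"
      by (simp add: norm_triangle_ineq)
    ultimately show ?thesis unfolding norm_unitization_def by linarith
  qed
  show "norm (scaleR a x) = \<bar>a\<bar> * norm x"
    by (simp add: scaleR_unitization_def norm_unitization_def onorm_left_mult_scaleC norm_mult
        max_mult_distrib_left)
  show "norm (x * y) \<le> norm x * norm y"
  proof -
    have "onorm (left_mult (x * y)) \<le> onorm (left_mult x) * onorm (left_mult y)"
      unfolding left_mult_mult by (rule onorm_compose[OF bounded_linear_left_mult bounded_linear_left_mult])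
    also have "\<dots> \<le> norm x * norm y"
      by (rule mult_mono) (auto simp: norm_unitization_def on le_max_iff_disj)
    finally have "onorm (left_mult (x * y)) \<le> norm x * norm y" .
    moreover have "cmod (scalar_part (x * y)) \<le> norm x * norm y"
      unfolding unitization_simps norm_mult
      by (rule mult_mono) (auto simp: norm_unitization_def on le_max_iff_disj)
    ultimately show ?thesis unfolding norm_unitization_def[of "x * y"] by simp
  qed
  show "norm (1 :: 'a unitization) = 1"
  proof -
    have "onorm (left_mult (1 :: 'a unitization)) \<le> 1" by (rule onorm_bound) (simp_all add: left_mult_def)
    then show ?thesis by (simp add: norm_unitization_def)
  qed
qed

end

lemma norm_unitization_eq: "norm y = max (cmod (scalar_part y)) (onorm (left_mult y))"
  by (rule norm_unitization_def)

lemma norm_Unitization_0: "norm (Unitization 0 x) = norm (x :: 'a::cstar_algebra)"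
  by (simp add: norm_unitization_eq onorm_left_mult_embed)

lemma norm_scalar_part: "cmod (scalar_part y) \<le> norm y"
  by (simp add: norm_unitization_eq)

lemma norm_scaleC_unitization: "norm (c *\<^sub>C y) = cmod c * norm (y :: 'a::cstar_algebra unitization)"
  by (simp add: norm_unitization_eq onorm_left_mult_scaleC norm_mult max_mult_distrib_left)

lemma norm_algebra_part: "norm (algebra_part y) \<le> 2 * norm y"
proof -
  have "Unitization 0 (algebra_part y) = y - scalar_part y *\<^sub>C 1"
    by (cases y) (simp add: one_unitization_def)
  moreover have "norm (scalar_part y *\<^sub>C (1 :: 'a unitization)) = cmod (scalar_part y)"
    by (simp add: norm_scaleC_unitization)
  ultimately show ?thesis
    using norm_triangle_ineq4[of y "scalar_part y *\<^sub>C 1"] norm_scalar_part[of y]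
    by (simp add: norm_Unitization_0[symmetric])
qed

instance unitization :: (cstar_algebra) unital_cstar_algebra
proof
  fix x :: "'a unitization" and r :: real and c :: complex
  have on: "onorm (left_mult x) \<ge> 0" for x :: "'a unitization"
    by (rule onorm_pos_le[OF bounded_linear_left_mult])
  show "scaleR r x = complex_of_real r *\<^sub>C x" by (rule scaleR_unitization_def)
  show "norm (c *\<^sub>C x) = cmod c * norm x" by (rule norm_scaleC_unitization)
  show "norm (star x * x) = (norm x)\<^sup>2"
  proof -
    have "norm (star x * x) = max ((cmod (scalar_part x))\<^sup>2) ((onorm (left_mult x))\<^sup>2)"
      unfolding norm_unitization_eq onorm_left_mult_star_mult
      by (simp add: norm_mult power2_eq_square)
    also have "\<dots> = (norm x)\<^sup>2"
      using power_mono[of "cmod (scalar_part x)" "onorm (left_mult x)" 2]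
        power_mono[of "onorm (left_mult x)" "cmod (scalar_part x)" 2] on[of x]
      by (cases "cmod (scalar_part x) \<le> onorm (left_mult x)") (auto simp: norm_unitization_eq max_def)
    finally show ?thesis .
  qed
next
  fix X :: "nat \<Rightarrow> 'a unitization"
  assume X: "Cauchy X"
  have "Cauchy (\<lambda>n. scalar_part (X n))"
  proof (rule metric_CauchyI)
    fix e :: real assume "e > 0"
    then obtain M where M: "\<And>m n. m \<ge> M \<Longrightarrow> n \<ge> M \<Longrightarrow> dist (X m) (X n) < e"
      using metric_CauchyD[OF X] by blast
    have "dist (scalar_part (X m)) (scalar_part (X n)) \<le> dist (X m) (X n)" for m n
      using norm_scalar_part[of "X m - X n"] by (simp add: dist_norm)
    with M show "\<exists>M. \<forall>m\<ge>M. \<forall>n\<ge>M. dist (scalar_part (X m)) (scalar_part (X n)) < e"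
      by (meson le_less_trans)
  qed
  then obtain c where c: "(\<lambda>n. scalar_part (X n)) \<longlonglongrightarrow> c"
    using Cauchy_convergent_iff convergent_def by blast
  have "Cauchy (\<lambda>n. algebra_part (X n))"
  proof (rule metric_CauchyI)
    fix e :: real assume "e > 0"
    then obtain M where M: "\<And>m n. m \<ge> M \<Longrightarrow> n \<ge> M \<Longrightarrow> dist (X m) (X n) < e / 2"
      using metric_CauchyD[OF X, of "e / 2"] by auto
    have "dist (algebra_part (X m)) (algebra_part (X n)) \<le> 2 * dist (X m) (X n)" for m n
      using norm_algebra_part[of "X m - X n"] by (simp add: dist_norm)
    moreover have "2 * dist (X m) (X n) < e" if "m \<ge> M" "n \<ge> M" for m n
      using M[OF that] by simp
    ultimately show "\<exists>M. \<forall>m\<ge>M. \<forall>n\<ge>M. dist (algebra_part (X m)) (algebra_part (X n)) < e"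
      by (meson le_less_trans)
  qed
  then obtain x where x: "(\<lambda>n. algebra_part (X n)) \<longlonglongrightarrow> x"
    using Cauchy_convergent_iff convergent_def by blast
  have "(\<lambda>n. cmod (scalar_part (X n) - c) + norm (algebra_part (X n) - x)) \<longlonglongrightarrow> 0 + 0"
    using c x by (intro tendsto_add) (simp_all add: LIM_zero tendsto_norm_zero)
  then have "X \<longlonglongrightarrow> Unitization c x"
  proof (rule metric_tendsto_imp_tendsto, intro always_eventually allI)
    fix n
    have "X n - Unitization c x = (scalar_part (X n) - c) *\<^sub>C 1 + Unitization 0 (algebra_part (X n) - x)"
      by (cases "X n") (simp add: one_unitization_def)
    then have "norm (X n - Unitization c x) \<le> cmod (scalar_part (X n) - c) + norm (algebra_part (X n) - x)"
      using norm_triangle_ineq[of "(scalar_part (X n) - c) *\<^sub>C 1" "Unitization 0 (algebra_part (X n) - x)"]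
      by (simp add: norm_Unitization_0 norm_scaleC_unitization)
    then show "dist (X n) (Unitization c x)
        \<le> dist (cmod (scalar_part (X n) - c) + norm (algebra_part (X n) - x)) (0 + 0)"
      by (simp add: dist_norm)
  qed
  then show "convergent X" by (auto simp: convergent_def)
qed

section \<open>Functional calculus in nonunital algebras\<close>

definition embed :: "'a::star_algebra \<Rightarrow> 'a unitization" where
  "embed x = Unitization 0 x"

lemma scalar_part_embed [simp]: "scalar_part (embed x) = 0"
  and algebra_part_embed [simp]: "algebra_part (embed x) = x"
  by (simp_all add: embed_def)

lemma unitization_eq_iff:
  "x = y \<longleftrightarrow> scalar_part x = scalar_part y \<and> algebra_part x = algebra_part y"
  by (cases x; cases y) simp

lemma embed_algebra_part: "scalar_part y = 0 \<Longrightarrow> embed (algebra_part y) = y"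
  by (simp add: unitization_eq_iff)

lemma embed_eq_iff [simp]: "embed x = embed y \<longleftrightarrow> x = y"
  by (simp add: embed_def)

lemma embed_zero [simp]: "embed 0 = 0"
  by (simp add: embed_def zero_unitization_def)

lemma embed_eq_0_iff [simp]: "embed x = 0 \<longleftrightarrow> x = 0"
  by (simp add: embed_def zero_unitization_def)

lemma embed_add: "embed (x + y) = embed x + embed y"
  and embed_diff: "embed (x - y) = embed x - embed y"
  and embed_minus: "embed (- x) = - embed x"
  and embed_mult: "embed (x * y) = embed x * embed y"
  and embed_star: "embed (star x) = star (embed x)"
  and embed_scaleC: "embed (c *\<^sub>C x) = c *\<^sub>C embed x"
  by (simp_all add: embed_def)

lemma embed_scaleR: "embed (r *\<^sub>R x) = r *\<^sub>R embed (x :: 'a::cstar_algebra)"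
  by (simp add: scaleR_scaleC embed_scaleC)

lemma norm_embed [simp]: "norm (embed x) = norm (x :: 'a::cstar_algebra)"
  by (simp add: embed_def norm_Unitization_0)

lemmas embed_hom = embed_add embed_diff embed_minus embed_mult embed_star embed_scaleC embed_scaleR

lemma selfadj_embed [simp]: "selfadj (embed x) \<longleftrightarrow> selfadj x"
  by (simp flip: embed_star)

lemma scalar_part_scaleR [simp]:
  "scalar_part (r *\<^sub>R y) = complex_of_real r * scalar_part (y :: 'a::cstar_algebra unitization)"
  by (simp add: scaleR_scaleC)

lemma bounded_linear_scalar_part: "bounded_linear (scalar_part :: 'a::cstar_algebra unitization \<Rightarrow> complex)"
  by (intro bounded_linear_intro[where K=1]) (simp_all add: norm_scalar_part scaleR_conv_of_real[where 'a=complex])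

text \<open>The scalar part is multiplicative and vanishes on \<open>x - scalar_part x\<close>,
  which therefore has no inverse.\<close>

lemma scalar_part_in_spec: "scalar_part (x :: 'a::star_algebra unitization) \<in> spec x"
proof (rule ccontr)
  assume "scalar_part x \<notin> spec x"
  then obtain y where "(x - scalar_part x *\<^sub>C 1) * y = 1"
    by (auto simp: spec_def inverse_of_def)
  then have "scalar_part ((x - scalar_part x *\<^sub>C 1) * y) = 1" by (simp only: unitization_simps)
  then show False by simp
qed

lemma zero_in_spec_embed: "0 \<in> spec (embed x)"
  using scalar_part_in_spec[of "embed x"] by simp

text \<open>The scalar part is a continuous character and so passes through polynomials and limits.
  In particular, functions vanishing at 0 do not lead out of the embedded algebra.\<close>

lemma scalar_part_cfc:
  fixes x :: "'a::cstar_algebra unitization"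
  assumes "selfadj x" "continuous_on (spec x) f"
  shows "scalar_part (cfc f x) = f (scalar_part x)"
proof -
  obtain P where P: "\<And>z. z \<in> spec x \<Longrightarrow> (\<lambda>n. poly (P n) z) \<longlonglongrightarrow> f z"
    "(\<lambda>n. peval (P n) x) \<longlonglongrightarrow> cfc f x"
    using cfc_limit assms by blast
  have "scalar_part (peval p x) = poly p (scalar_part x)" for p
    by (induction p) simp_all
  then have "(\<lambda>n. poly (P n) (scalar_part x)) \<longlonglongrightarrow> scalar_part (cfc f x)"
    using bounded_linear.tendsto[OF bounded_linear_scalar_part P(2)] by simp
  from LIMSEQ_unique[OF this P(1)[OF scalar_part_in_spec]] show ?thesis .
qed

text \<open>Nonunital calculus, meant for \<open>f 0 = 0\<close>; otherwise the scalar
  \<open>f 0\<close> is dropped.\<close>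

definition afc :: "(real \<Rightarrow> real) \<Rightarrow> 'a::cstar_algebra \<Rightarrow> 'a" where
  "afc f x = algebra_part (rfc f (embed x))"

lemma embed_afc:
  assumes "selfadj x" "continuous_on (rspec (embed x)) f" "f 0 = 0"
  shows "embed (afc f x) = rfc f (embed x)"
  unfolding afc_def
  using scalar_part_cfc[OF _ rfc_continuous[OF assms(2)]] assms
  by (intro embed_algebra_part) (simp add: rfc_def)

lemma spectrum_eq_spec: "spectrum x = spec (embed x)"
proof -
  have "embed x - z *\<^sub>C 1 = Unitization (- z) x" for z
    by (simp add: unitization_eq_iff)
  then show ?thesis by (simp add: spectrum_def spec_def inverse_of_def)
qed

lemma embed_cfc:
  assumes "selfadj x" "f \<in> spectrum_fun x"
  shows "embed (algebra_part (cfc f (embed x))) = cfc f (embed x)"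
  using assms by (intro embed_algebra_part) (simp add: scalar_part_cfc spectrum_fun_def spectrum_eq_spec)

text \<open>The existence half. Since \<open>functional_calculus\<close> is a definite description,
  it can be evaluated only once uniqueness is available as well.\<close>

lemma functional_calculus_hom_cfc:
  assumes sa: "selfadj x"
  shows "functional_calculus_hom x (\<lambda>f. algebra_part (cfc f (embed x)))"
proof -
  have sa': "selfadj (embed x)" using sa by simp
  note cont = spectrum_fun_def spectrum_eq_spec
  have eqI: "algebra_part y = z" if "y = embed z" for y z using that by simp
  show ?thesis
    unfolding functional_calculus_hom_def
  proof (intro conjI ballI allI impI)
    fix f g assume f: "f \<in> spectrum_fun x" and g: "g \<in> spectrum_fun x"
    then have c: "continuous_on (spec (embed x)) f" "continuous_on (spec (embed x)) g" by (auto simp: cont)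
    show "algebra_part (cfc f (embed x)) = algebra_part (cfc g (embed x))"
      if "\<forall>z\<in>spectrum x. f z = g z"
      using cfc_cong[OF sa' c(1), of g] that by (simp add: cont)
    show "algebra_part (cfc (\<lambda>z. f z + g z) (embed x))
        = algebra_part (cfc f (embed x)) + algebra_part (cfc g (embed x))"
      by (simp add: cfc_add[OF sa' c])
    show "algebra_part (cfc (\<lambda>z. f z * g z) (embed x))
        = algebra_part (cfc f (embed x)) * algebra_part (cfc g (embed x))"
      by (rule eqI) (simp add: cfc_mult[OF sa' c] embed_mult embed_cfc[OF sa] f g)
  next
    fix f k assume f: "f \<in> spectrum_fun x"
    then have c: "continuous_on (spec (embed x)) f" by (auto simp: cont)
    show "algebra_part (cfc (\<lambda>z. k * f z) (embed x)) = k *\<^sub>C algebra_part (cfc f (embed x))"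
      by (simp add: cfc_cmult[OF sa' c])
    show "algebra_part (cfc (\<lambda>z. cnj (f z)) (embed x)) = star (algebra_part (cfc f (embed x)))"
      by (simp add: cfc_star[OF sa' c])
  qed (simp add: cfc_id[OF sa'])
qed

section \<open>Uniqueness of the functional calculus\<close>

lemma spectrum_fun_closed:
  assumes "f \<in> spectrum_fun x" "g \<in> spectrum_fun x"
  shows "(\<lambda>z. f z + g z) \<in> spectrum_fun x" "(\<lambda>z. f z * g z) \<in> spectrum_fun x"
    "(\<lambda>z. k * f z) \<in> spectrum_fun x" "(\<lambda>z. cnj (f z)) \<in> spectrum_fun x"
  using assms by (auto simp: spectrum_fun_def intro!: continuous_intros)

lemma functional_calculus_homD:
  assumes "functional_calculus_hom c \<Phi>" "f \<in> spectrum_fun c"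
  shows "g \<in> spectrum_fun c \<Longrightarrow> (\<And>z. z \<in> spectrum c \<Longrightarrow> f z = g z) \<Longrightarrow> \<Phi> f = \<Phi> g"
    and "g \<in> spectrum_fun c \<Longrightarrow> \<Phi> (\<lambda>z. f z + g z) = \<Phi> f + \<Phi> g"
    and "g \<in> spectrum_fun c \<Longrightarrow> \<Phi> (\<lambda>z. f z * g z) = \<Phi> f * \<Phi> g"
    and "\<Phi> (\<lambda>z. k * f z) = k *\<^sub>C \<Phi> f"
    and "\<Phi> (\<lambda>z. cnj (f z)) = star (\<Phi> f)"
    and "\<Phi> (\<lambda>z. z) = c"
proof -
  note d = assms(1)[unfolded functional_calculus_hom_def]
  note d1 = d[THEN conjunct1] and d2 = d[THEN conjunct2, THEN conjunct1]
    and d3 = d[THEN conjunct2, THEN conjunct2, THEN conjunct1]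
  show "\<Phi> f = \<Phi> g" if g: "g \<in> spectrum_fun c" and eq: "\<And>z. z \<in> spectrum c \<Longrightarrow> f z = g z"
    by (rule mp[OF bspec[OF bspec[OF d1 assms(2)] g]]) (intro ballI eq)
  show "\<Phi> (\<lambda>z. f z + g z) = \<Phi> f + \<Phi> g" "\<Phi> (\<lambda>z. f z * g z) = \<Phi> f * \<Phi> g"
    if g: "g \<in> spectrum_fun c"
    by (rule conjunct1[OF bspec[OF bspec[OF d2 assms(2)] g]], rule conjunct2[OF bspec[OF bspec[OF d2 assms(2)] g]])
  show "\<Phi> (\<lambda>z. k * f z) = k *\<^sub>C \<Phi> f"
    by (rule spec[OF conjunct1[OF bspec[OF d3 assms(2)]]])
  show "\<Phi> (\<lambda>z. cnj (f z)) = star (\<Phi> f)"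
    by (rule conjunct2[OF bspec[OF d3 assms(2)]])
  show "\<Phi> (\<lambda>z. z) = c"
    by (rule d[THEN conjunct2, THEN conjunct2, THEN conjunct2])
qed

text \<open>No continuity is part of \<open>functional_calculus_hom\<close>, so contractivity is
  derived from spectra: if \<open>|w| > B\<^sup>2\<close>, then \<open>h - w\<close> with
  \<open>h = |g|\<^sup>2\<close> has no zero on the spectrum of \<open>x\<close>, and
  \<open>w\<close> cannot be in the spectrum of \<open>\<Phi> h\<close>.\<close>

lemma functional_calculus_hom_norm_le:
  assumes hom: "functional_calculus_hom x \<Phi>" and g: "g \<in> spectrum_fun x"
    and le: "\<And>z. z \<in> spectrum x \<Longrightarrow> cmod (g z) \<le> B" and "B \<ge> 0"
  shows "norm (\<Phi> g) \<le> B"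
proof -
  define h where "h z = g z * cnj (g z)" for z
  have gc: "(\<lambda>z. cnj (g z)) \<in> spectrum_fun x" by (rule spectrum_fun_closed[OF g g])
  have h: "h \<in> spectrum_fun x" unfolding h_def by (rule spectrum_fun_closed[OF g gc])
  have "\<Phi> h = \<Phi> g * \<Phi> (\<lambda>z. cnj (g z))"
    unfolding h_def by (rule functional_calculus_homD(3)[OF hom g gc])
  moreover have "\<Phi> (\<lambda>z. cnj (g z)) = star (\<Phi> g)"
    by (rule functional_calculus_homD(5)[OF hom g])
  ultimately have hg: "\<Phi> h = \<Phi> g * star (\<Phi> g)" by simp
  have "norm (embed (\<Phi> h)) \<le> B\<^sup>2"
  proof (rule norm_le_if_spec_le)
    show "selfadj (embed (\<Phi> h))" by (simp add: hg star_mult)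
    show "B\<^sup>2 \<ge> 0" by simp
    fix w assume w: "w \<in> spec (embed (\<Phi> h))"
    show "cmod w \<le> B\<^sup>2"
    proof (rule ccontr)
      assume "\<not> cmod w \<le> B\<^sup>2"
      moreover have "cmod (h z) \<le> B\<^sup>2" if "z \<in> spectrum x" for z
        using mult_mono[OF le[OF that] le[OF that]] \<open>B \<ge> 0\<close>
        by (simp add: h_def norm_mult power2_eq_square)
      ultimately have ne: "h z - w \<noteq> 0" if "z \<in> spectrum x" for z
        using that by auto
      have w0: "w \<noteq> 0" using \<open>\<not> cmod w \<le> B\<^sup>2\<close> by auto
      \<comment> \<open>The resolvent of \<open>h\<close> does not vanish at 0, but its product with
        \<open>h\<close> does, so \<open>\<Phi>\<close> can be applied. As
        \<open>(h - w) (k - 1) = w\<close>, the inverse is recovered as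
        \<open>(\<Phi> k - 1) / w\<close>.\<close>
      define k where "k z = h z * (1 / (h z - w))" for z
      have hc: "continuous_on (spectrum x) h" "h 0 = 0" using h by (auto simp: spectrum_fun_def)
      have k: "k \<in> spectrum_fun x"
        using hc ne unfolding spectrum_fun_def k_def by (auto intro!: continuous_intros)
      have wk: "(\<lambda>z. w * k z) \<in> spectrum_fun x" by (rule spectrum_fun_closed[OF k k])
      have eq: "h z * k z = h z + w * k z" if "z \<in> spectrum x" for z
        using ne[OF that] by (simp add: k_def field_simps)
      have "\<Phi> (\<lambda>z. h z * k z) = \<Phi> (\<lambda>z. h z + w * k z)"
        using eq by (rule functional_calculus_homD(1)[OF hom spectrum_fun_closed(2)[OF h k]
          spectrum_fun_closed(1)[OF h wk]])
      moreover have "\<Phi> (\<lambda>z. h z * k z) = \<Phi> h * \<Phi> k" "\<Phi> (\<lambda>z. k z * h z) = \<Phi> k * \<Phi> h"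
        "\<Phi> (\<lambda>z. h z + w * k z) = \<Phi> h + \<Phi> (\<lambda>z. w * k z)" "\<Phi> (\<lambda>z. w * k z) = w *\<^sub>C \<Phi> k"
        by (rule functional_calculus_homD(3)[OF hom h k], rule functional_calculus_homD(3)[OF hom k h],
          rule functional_calculus_homD(2)[OF hom h wk], rule functional_calculus_homD(4)[OF hom k])
      ultimately have "\<Phi> h * \<Phi> k = \<Phi> h + w *\<^sub>C \<Phi> k" "\<Phi> k * \<Phi> h = \<Phi> h + w *\<^sub>C \<Phi> k"
        by (simp_all add: mult.commute)
      then have hk: "embed (\<Phi> h) * embed (\<Phi> k) = embed (\<Phi> h) + w *\<^sub>C embed (\<Phi> k)"
        "embed (\<Phi> k) * embed (\<Phi> h) = embed (\<Phi> h) + w *\<^sub>C embed (\<Phi> k)"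
        by (simp_all flip: embed_hom)
      have "inverse_of (embed (\<Phi> h) - w *\<^sub>C 1) ((1 / w) *\<^sub>C (embed (\<Phi> k) - 1))"
        using w0 by (simp add: inverse_of_def algebra_simps scaleC_diff_right scaleC_add_right hk)
      with w show False by (auto simp: spec_def)
    qed
  qed
  then have "(norm (\<Phi> g))\<^sup>2 \<le> B\<^sup>2" by (simp add: hg cstar_identity')
  then show ?thesis using \<open>B \<ge> 0\<close> by (rule power2_le_imp_le)
qed

lemma functional_calculus_hom_unique:
  assumes sa: "selfadj x" and 1: "functional_calculus_hom x \<Phi>" and 2: "functional_calculus_hom x \<Psi>"
    and f: "f \<in> spectrum_fun x"
  shows "\<Phi> f = \<Psi> f"
proof -
  have zf: "(\<lambda>z. z) \<in> spectrum_fun x" by (auto simp: spectrum_fun_def intro: continuous_on_id)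
  have zp: "(\<lambda>z. z * poly r z) \<in> spectrum_fun x" for r
    by (auto simp: spectrum_fun_def intro!: continuous_intros)
  have rec: "\<Phi> (\<lambda>z. z * poly (pCons a r) z) = a *\<^sub>C x + x * \<Phi> (\<lambda>z. z * poly r z)"
    if hom: "functional_calculus_hom x \<Phi>" for \<Phi> a r
  proof -
    have az: "(\<lambda>z. a * z) \<in> spectrum_fun x" by (rule spectrum_fun_closed[OF zf zf])
    have zz: "(\<lambda>z. z * (z * poly r z)) \<in> spectrum_fun x" by (rule spectrum_fun_closed[OF zf zp])
    have "(\<lambda>z. z * poly (pCons a r) z) = (\<lambda>z. a * z + z * (z * poly r z))"
      by (simp add: fun_eq_iff algebra_simps)
    moreover have "\<Phi> (\<lambda>z. a * z + z * (z * poly r z)) = \<Phi> (\<lambda>z. a * z) + \<Phi> (\<lambda>z. z * (z * poly r z))"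
      by (rule functional_calculus_homD(2)[OF hom az zz])
    moreover have "\<Phi> (\<lambda>z. a * z) = a *\<^sub>C \<Phi> (\<lambda>z. z)" "\<Phi> (\<lambda>z. z * (z * poly r z)) = \<Phi> (\<lambda>z. z) * \<Phi> (\<lambda>z. z * poly r z)"
      "\<Phi> (\<lambda>z. z) = x"
      by (rule functional_calculus_homD(4)[OF hom zf], rule functional_calculus_homD(3)[OF hom zf zp[of r]],
        rule functional_calculus_homD(6)[OF hom zf])
    ultimately show ?thesis by simp
  qed
  have zero: "\<Phi> (\<lambda>z. z * poly 0 z) = 0" if hom: "functional_calculus_hom x \<Phi>" for \<Phi>
  proof -
    have "\<Phi> (\<lambda>z. 0 * z) = 0 *\<^sub>C \<Phi> (\<lambda>z. z)"
      by (rule functional_calculus_homD(4)[OF hom zf])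
    then show ?thesis by simp
  qed
  have poly: "\<Phi> (\<lambda>z. z * poly r z) = \<Psi> (\<lambda>z. z * poly r z)" for r
    by (induction r) (simp_all only: zero rec 1 2)
  have "norm (\<Phi> f - \<Psi> f) \<le> 0 + e" if "e > 0" for e
  proof -
    have fc: "continuous_on (spectrum x) f" "f 0 = 0" using f by (auto simp: spectrum_fun_def)
    have "\<exists>p. \<forall>z\<in>spectrum x. cmod (poly p z - f z) < e / 4"
      unfolding spectrum_eq_spec
    proof (rule complex_polynomial_approximation[OF compact_spec])
      show "Im z = 0" if "z \<in> spec (embed x)" for z
        using selfadj_spec_real[OF _ that] sa by simp
      show "continuous_on (spec (embed x)) f" using fc(1) by (simp add: spectrum_eq_spec)
    qed (use \<open>e > 0\<close> in simp)
    then obtain p where p: "\<And>z. z \<in> spectrum x \<Longrightarrow> cmod (poly p z - f z) < e / 4" by blast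
    \<comment> \<open>The approximating polynomial may have a constant term, to which
      \<open>\<Phi>\<close> does not apply. It is small because \<open>f 0 = 0\<close> and 0 is in
      the spectrum, so it counts as part of the error.\<close>
    obtain a r where ar: "p = pCons a r" by (cases p)
    have a: "cmod a < e / 4"
      using p[of 0] zero_in_spec_embed[of x] fc(2) by (simp add: spectrum_eq_spec ar)
    define g where "g z = f z + (- 1) * (z * poly r z)" for z
    have mr: "(\<lambda>z. (- 1) * (z * poly r z)) \<in> spectrum_fun x" by (rule spectrum_fun_closed[OF zp zp])
    have g: "g \<in> spectrum_fun x" unfolding g_def by (rule spectrum_fun_closed[OF f mr])
    have gle: "cmod (g z) \<le> e / 2" if "z \<in> spectrum x" for z
    proof -
      have "g z = a - (poly p z - f z)" by (simp add: g_def ar)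
      then have "cmod (g z) \<le> cmod a + cmod (poly p z - f z)" by (simp add: norm_triangle_ineq4)
      then show ?thesis using a p[OF that] by simp
    qed
    have split: "\<Phi> g = \<Phi> f - \<Phi> (\<lambda>z. z * poly r z)" if hom: "functional_calculus_hom x \<Phi>" for \<Phi>
    proof -
      have "\<Phi> g = \<Phi> f + \<Phi> (\<lambda>z. (- 1) * (z * poly r z))"
        unfolding g_def by (rule functional_calculus_homD(2)[OF hom f mr])
      moreover have "\<Phi> (\<lambda>z. (- 1) * (z * poly r z)) = (- 1) *\<^sub>C \<Phi> (\<lambda>z. z * poly r z)"
        by (rule functional_calculus_homD(4)[OF hom zp[of r]])
      ultimately show ?thesis by simp
    qed
    have "\<Phi> f - \<Psi> f = \<Phi> g - \<Psi> g" by (simp add: split 1 2 poly)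
    then have "norm (\<Phi> f - \<Psi> f) \<le> norm (\<Phi> g) + norm (\<Psi> g)" by (simp add: norm_triangle_ineq4)
    also have "\<dots> \<le> e / 2 + e / 2"
      by (intro add_mono functional_calculus_hom_norm_le[OF 1 g] functional_calculus_hom_norm_le[OF 2 g] gle)
        (use \<open>e > 0\<close> in auto)
    finally show ?thesis by simp
  qed
  then have "norm (\<Phi> f - \<Psi> f) \<le> 0" by (rule field_le_epsilon)
  then show ?thesis by simp
qed

lemma embed_functional_calculus:
  assumes "selfadj x" "f \<in> spectrum_fun x"
  shows "embed (functional_calculus f x) = cfc f (embed x)"
proof -
  have "functional_calculus f x = algebra_part (cfc f (embed x))"
    unfolding functional_calculus_def
    using functional_calculus_hom_cfc[OF assms(1)] functional_calculus_hom_unique[OF assms(1) _ _ assms(2)]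
    by (intro the_equality) blast+
  then show ?thesis using embed_cfc[OF assms] by simp
qed

lemma embed_cut_down:
  assumes "selfadj c" "\<epsilon> \<ge> 0"
  shows "embed (cut_down c \<epsilon>) = rfc (\<lambda>t. max (t - \<epsilon>) 0) (embed c)"
  unfolding cut_down_def rfc_def
  by (rule embed_functional_calculus[OF assms(1)])
    (use assms(2) in \<open>auto simp: spectrum_fun_def intro!: continuous_intros\<close>)

section \<open>Cuntz comparison and finiteness\<close>

text \<open>The nontrivial direction works because the square root function vanishes at 0: the
  factor found in the unitization comes from the algebra.\<close>

lemma positive_embed [simp]: "positive (embed a) \<longleftrightarrow> positive (a :: 'a::cstar_algebra)"
proof
  assume pos: "positive (embed a)"
  then have sa: "selfadj a" using positive_selfadj[OF pos] by simp
  have e: "embed (afc sqrt a) = rfc sqrt (embed a)"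
    by (rule embed_afc[OF sa]) (auto intro: continuous_intros)
  have "embed (star (afc sqrt a) * afc sqrt a) = embed a"
    using rfc_sqrt[OF pos] by (simp only: embed_hom e)
  then show "positive a" unfolding positive_def by (metis embed_eq_iff)
next
  assume "positive a"
  then obtain y where "a = star y * y" by (auto simp: positive_def)
  then have "embed a = star (embed y) * embed y" by (simp add: embed_hom)
  then show "positive (embed a)" unfolding positive_def by blast
qed

lemma cuntz_belowI:
  assumes "\<And>\<eta>. \<eta> > 0 \<Longrightarrow> \<exists>v. norm (a - v * b * star v) \<le> \<eta>"
  shows "a \<precsim> b"
proof -
  have "\<forall>n. \<exists>v. norm (a - v * b * star v) \<le> inverse (real (Suc n))"
    using assms by simp
  then obtain v where v: "\<And>n. norm (a - v n * b * star (v n)) \<le> inverse (real (Suc n))"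
    by metis
  have "(\<lambda>n. norm (a - v n * b * star (v n))) \<longlonglongrightarrow> 0"
    by (rule tendsto_sandwich[OF _ _ tendsto_const LIMSEQ_inverse_real_of_nat])
      (simp_all del: of_nat_Suc add: v)
  then show ?thesis unfolding cuntz_below_def by blast
qed

lemma cuntz_belowD:
  assumes "a \<precsim> b" "\<eta> > 0"
  shows "\<exists>v. norm (a - v * b * star v) < \<eta>"
proof -
  obtain v where "(\<lambda>n. norm (a - v n * b * star (v n))) \<longlonglongrightarrow> 0"
    using assms(1) unfolding cuntz_below_def by blast
  then have "\<forall>\<^sub>F n in sequentially. norm (a - v n * b * star (v n)) < \<eta>"
    using assms(2) by (rule order_tendstoD)
  then show ?thesis by (auto simp: eventually_at_top_linorder)
qed

text \<open>The witness of \<open>norm_diff_conj_le_if_le\<close> has the square root of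
  \<open>G\<close> as a factor, so it lies in the ideal although its other factor does not.\<close>

lemma majorant_conj:
  fixes G Y :: "'a::cstar_algebra"
  assumes G: "positive G" and Y: "positive Y" and le: "embed G \<preceq> embed Y + \<mu> *\<^sub>R 1"
    and "\<mu> \<ge> 0" "\<kappa> > 0"
  shows "\<exists>v. norm (G - v * Y * star v) \<le> \<mu> + \<kappa>"
proof -
  have sG: "selfadj G" using positive_selfadj[OF G] .
  define V where "V = rfc sqrt (embed G) * rfc (\<lambda>t. 1 / sqrt (t + \<kappa>)) (embed Y)"
  have "rfc sqrt (embed G) = embed (afc sqrt G)"
    by (rule embed_afc[OF sG, symmetric]) (auto intro: continuous_intros)
  then have V: "embed (algebra_part V) = V"
    by (intro embed_algebra_part) (simp add: V_def)
  have "norm (embed G - V * embed Y * star V) \<le> \<mu> + \<kappa>"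
    unfolding V_def by (rule norm_diff_conj_le_if_le) (use assms in auto)
  then have "norm (embed (G - algebra_part V * Y * star (algebra_part V))) \<le> \<mu> + \<kappa>"
    by (simp only: embed_hom V)
  then show ?thesis unfolding norm_embed by blast
qed

section \<open>Isometries in finite algebras\<close>

lemma is_unit_element_unique: "is_unit_element e \<Longrightarrow> is_unit_element e' \<Longrightarrow> e = (e'::'a::star_algebra)"
  unfolding is_unit_element_def by metis

text \<open>An isometry \<open>w\<close> of the corner of \<open>p\<close> has a range projection
  below and equivalent to \<open>p\<close>, hence equal to \<open>p\<close>. What kills
  \<open>w\<close> kills its range.\<close>

lemma finite_projection_annihilator:
  fixes p w d :: "'a::star_algebra"
  assumes p: "finite_projection p" and w: "star w * w = p" "p * w = w" "w * p = w"
    and d: "d * p = d" "d * w = 0"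
  shows "d = 0"
proof -
  let ?q = "w * star w"
  have "?q * ?q = w * (star w * w) * star w" by (simp add: mult.assoc)
  then have "projection ?q" using w by (simp add: projection_def star_mult)
  moreover have "p * ?q = ?q" using w by (simp flip: mult.assoc)
  moreover have "mvn_equivalent p ?q" using w unfolding mvn_equivalent_def by blast
  ultimately have "?q = p" using p unfolding finite_projection_def by blast
  then have "d = d * (w * star w)" using d by simp
  also have "\<dots> = (d * w) * star w" by (simp only: mult.assoc)
  finally show ?thesis by (simp add: d)
qed

text \<open>Isometries are produced in the unitization, while for an algebra with unit
  \<open>e\<close> finiteness speaks about \<open>e\<close>; in that case \<open>W\<close> is first
  mapped back into the algebra.\<close>

lemma finite_isometry_annihilator:
  fixes d :: "'a::cstar_algebra"
  assumes fin: "finite_cstar TYPE('a)" and W: "star W * W = 1" and d: "embed d * W = 0"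
  shows "d = 0"
proof (cases "\<exists>e::'a. is_unit_element e")
  case True
  then obtain e :: 'a where e: "is_unit_element e" by blast
  then have "(THE e::'a. is_unit_element e) = e" using is_unit_element_unique by blast
  then have fp: "finite_projection e" using fin True by (simp add: finite_cstar_def)
  have e1: "e * x = x" "x * e = x" for x using e by (auto simp: is_unit_element_def)
  have se: "star e = e" using fp by (simp add: finite_projection_def projection_def)
  \<comment> \<open>The image of \<open>W\<close> under the *-homomorphism sending
    \<open>c 1 + x\<close> to \<open>c e + x\<close>.\<close>
  define w where "w = scalar_part W *\<^sub>C e + algebra_part W"
  have "star w * w = scalar_part (star W * W) *\<^sub>C e + algebra_part (star W * W)"
    by (simp add: w_def star_add se e1 algebra_simps scaleC_add_right)
  also have "\<dots> = e" unfolding W by simp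
  finally have "star w * w = e" .
  moreover have "d * w = algebra_part (embed d * W)"
    by (simp add: w_def e1 algebra_simps)
  ultimately show ?thesis
    using finite_projection_annihilator[OF fp, of w d] d by (simp add: e1)
next
  case False
  then have "finite_projection (1 :: 'a unitization)" using fin by (simp add: finite_cstar_def)
  then have "embed d = 0" by (rule finite_projection_annihilator) (use W d in auto)
  then show ?thesis by simp
qed

lemma eigenvalue_in_rspec:
  fixes x :: "'a::unital_cstar_algebra"
  assumes "selfadj x" "x * s = l *\<^sub>R s" "s \<noteq> 0"
  shows "l \<in> rspec x"
  unfolding mem_rspec[OF assms(1)]
proof (rule ccontr)
  assume "complex_of_real l \<notin> spec x"
  then obtain y where y: "y * (x - complex_of_real l *\<^sub>C 1) = 1"
    by (auto simp: spec_def inverse_of_def)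
  have "(x - complex_of_real l *\<^sub>C 1) * s = 0"
    using assms(2) by (simp add: left_diff_distrib scaleR_scaleC)
  then have "y * ((x - complex_of_real l *\<^sub>C 1) * s) = 0" by simp
  then have "(y * (x - complex_of_real l *\<^sub>C 1)) * s = 0" by (simp only: mult.assoc)
  then show False using assms(3) y by simp
qed

text \<open>Used at \<open>l = 1\<close>, for functions vanishing on vectors fixed by
  \<open>x\<close>, and at \<open>l = 0\<close>, for staying inside a corner.\<close>

lemma rfc_mult_eigenvector:
  assumes "selfadj x" "continuous_on (rspec x) f" "x * s = l *\<^sub>R s"
  shows "rfc f x * s = f l *\<^sub>R s"
  using rfc_eigen[OF assms] eigenvalue_in_rspec[OF assms(1,3)] by (cases "s = 0") auto

text \<open>\<open>V = s v\<^sup>* + (1 - c\<^sup>2)\<^sup>1\<^sup>/\<^sup>2\<close> satisfies \<open>V\<^sup>*V = 1 - (c\<^sup>2 - v s\<^sup>2 v\<^sup>*)\<close> and \<open>d V = 0\<close>, so its polar part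
  is an isometry in the unitization whose range is orthogonal to \<open>d\<close>.\<close>

lemma finite_not_subequivalent:
  fixes c s d v :: "'a::cstar_algebra"
  assumes fin: "finite_cstar TYPE('a)"
    and sa: "selfadj c" "selfadj s" "selfadj d" and "norm c \<le> 1"
    and cs: "c * s = s" "c * d = d" and sd: "s * d = 0"
    and near: "norm (c * c - v * (s * s) * star v) < 1"
  shows "d = 0"
proof -
  define C where "C = embed c"
  define T where "T = embed s * star (embed v)"
  define f :: "real \<Rightarrow> real" where "f t = sqrt (1 - t * t)" for t
  define m where "m = rfc f C"
  have sC: "selfadj C" by (simp add: C_def sa)
  have c: "continuous_on (rspec C) f" unfolding f_def by (intro continuous_intros)
  have sm: "selfadj m" unfolding m_def by (rule rfc_selfadj[OF sC c])
  have mm: "m * m = 1 - C * C"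
  proof -
    have "m * m = rfc (\<lambda>t. f t * f t) C" unfolding m_def by (rule rfc_mult[OF sC c c, symmetric])
    also have "\<dots> = rfc (\<lambda>t. 1 - t * t) C"
    proof (rule rfc_cong[OF sC])
      fix t assume "t \<in> rspec C"
      then have "\<bar>t\<bar> \<le> 1" using rspec_norm[OF sC] \<open>norm c \<le> 1\<close> unfolding C_def norm_embed by force
      then have "t * t \<le> 1" using abs_le_square_iff[of t 1] by (simp add: power2_eq_square)
      then show "f t * f t = 1 - t * t" by (simp add: f_def)
    qed (intro continuous_intros c)
    also have "\<dots> = 1 - C * C"
      by (simp only: rfc_diff[OF sC continuous_on_const continuous_on_mult[OF continuous_on_id continuous_on_id]]
          rfc_mult[OF sC continuous_on_id continuous_on_id] rfc_id[OF sC] rfc_const[OF sC] scaleR_one)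
    finally show ?thesis .
  qed
  \<comment> \<open>The function defining \<open>m\<close> vanishes at 1. With
    \<open>c s = s\<close> this removes the cross terms of \<open>star V * V\<close>, and with
    \<open>c d = d\<close> it gives \<open>d m = 0\<close>.\<close>
  have m0: "m * embed y = 0" if "c * y = y" for y
  proof -
    have "C * embed y = 1 *\<^sub>R embed y" using that by (simp add: C_def flip: embed_mult)
    from rfc_mult_eigenvector[OF sC c this] show ?thesis by (simp add: m_def f_def)
  qed
  have ss': "star (embed s) = embed s" using sa by simp
  have sd': "star (embed d) = embed d" using sa by simp
  have dm: "embed d * m = 0"
    using arg_cong[OF m0[OF cs(2)], of star] sd' sm by (simp add: star_mult)
  have ds: "embed d * embed s = 0"
    using arg_cong[OF sd, of star] sa by (simp add: star_mult flip: embed_mult)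
  have mT: "m * T = 0" unfolding T_def by (simp add: m0[OF cs(1)] flip: mult.assoc)
  have Tm: "star T * m = 0" using arg_cong[OF mT, of star] sm by (simp add: star_mult)
  define Z where "Z = C * C - star T * T"
  have Z: "Z = embed (c * c - v * (s * s) * star v)"
    by (simp add: Z_def T_def C_def embed_hom star_mult ss' mult.assoc)
  have sZ: "selfadj Z" using sC by (simp add: Z_def star_diff star_mult)
  have nZ: "t < 1" if "t \<in> rspec Z" for t
    using rspec_norm[OF sZ that] near unfolding Z norm_embed by linarith
  define V where "V = T + m"
  have VV: "star V * V = 1 - Z"
    using sm by (simp add: V_def Z_def star_add distrib_left distrib_right mT Tm mm)
  \<comment> \<open>\<open>R\<close> is the inverse square root of \<open>star V * V\<close>,
    available because the spectrum of \<open>Z\<close> stays below 1.\<close>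
  define g :: "real \<Rightarrow> real" where "g t = 1 / sqrt (1 - t)" for t
  have g: "continuous_on (rspec Z) g"
    unfolding g_def using nZ by (intro continuous_intros) force+
  define R where "R = rfc g Z"
  have sR: "selfadj R" unfolding R_def by (rule rfc_selfadj[OF sZ g])
  have "R * (1 - Z) * R = 1"
  proof -
    have h: "continuous_on (rspec Z) (\<lambda>t. 1 - t)" by (intro continuous_intros)
    have "1 - Z = rfc (\<lambda>t. 1 - t) Z"
      by (simp add: rfc_diff[OF sZ continuous_on_const continuous_on_id] rfc_id[OF sZ] rfc_const[OF sZ])
    then have "R * (1 - Z) * R = rfc (\<lambda>t. g t * (1 - t) * g t) Z"
      by (simp only: R_def rfc_mult[OF sZ g h] rfc_mult[OF sZ continuous_on_mult[OF g h] g])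
    also have "\<dots> = rfc (\<lambda>_. 1) Z"
    proof (rule rfc_cong[OF sZ])
      fix t assume "t \<in> rspec Z"
      then show "g t * (1 - t) * g t = 1" using nZ[of t] by (simp add: g_def field_simps)
    qed (intro continuous_intros g)
    finally show ?thesis by (simp add: rfc_const[OF sZ])
  qed
  then have "star (V * R) * (V * R) = 1"
    using sR by (simp add: star_mult VV flip: mult.assoc) (simp add: mult.assoc flip: VV)
  moreover have "embed d * (V * R) = (embed d * embed s * star (embed v) + embed d * m) * R"
    by (simp add: V_def T_def algebra_simps)
  then have "embed d * (V * R) = 0" by (simp add: ds dm)
  ultimately show ?thesis by (rule finite_isometry_annihilator[OF fin])
qed

section \<open>Order zero maps and minimal projections\<close>

lemma mat_positive_1:
  assumes "mat_positive 1 (M :: 'a::star_algebra mat)"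
  shows "positive (M $$ (0, 0))"
proof -
  obtain C where C: "C \<in> carrier_mat 1 1" "M = mat_star C * C"
    using assms by (auto simp: mat_positive_def)
  then have "M $$ (0, 0) = star (C $$ (0, 0)) * C $$ (0, 0)"
    by (simp add: mat_star_def scalar_prod_def)
  then show ?thesis unfolding positive_def by blast
qed

lemma mat_positive_carrier: "mat_positive n B \<Longrightarrow> B \<in> carrier_mat n n"
  by (auto simp: mat_positive_def mat_star_def)

lemma completely_positive_imp_positive:
  assumes "completely_positive n \<phi>" "mat_positive n B"
  shows "positive (\<phi> B)"
proof -
  have "mat_positive 1 (amplification n \<phi> 1 B)"
    using assms by (simp add: completely_positive_def)
  from mat_positive_1[OF this] have "positive (\<phi> (mat_block n B 0 0))"
    by (simp add: amplification_def)
  moreover have "mat_block n B 0 0 = B"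
    using mat_positive_carrier[OF assms(2)] by (auto simp: mat_block_def)
  ultimately show ?thesis by simp
qed

lemma mat_positive_one: "mat_positive n (1\<^sub>m n :: complex mat)"
proof -
  have "mat_star (1\<^sub>m n :: complex mat) = 1\<^sub>m n"
    by (auto simp: mat_star_def star_complex_def)
  then show ?thesis unfolding mat_positive_def by (intro bexI[of _ "1\<^sub>m n"]) auto
qed

lemma operator_norm_leI:
  assumes "z \<in> carrier_mat m n"
    and "\<And>v. v \<in> carrier_vec n \<Longrightarrow> euclidean_norm v \<le> 1 \<Longrightarrow> euclidean_norm (z *\<^sub>v v) \<le> B"
  shows "operator_norm z \<le> B"
  unfolding operator_norm_def
proof (rule cSUP_least)
  have "0\<^sub>v n \<in> {v \<in> carrier_vec (dim_col z). euclidean_norm v \<le> 1}"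
    using assms(1) by (auto simp: euclidean_norm_def L2_set_def)
  then show "{v \<in> carrier_vec (dim_col z). euclidean_norm v \<le> 1} \<noteq> {}" by blast
qed (use assms in auto)

lemma operator_norm_one: "operator_norm (1\<^sub>m n) \<le> 1"
  by (rule operator_norm_leI[of _ n n]) auto

lemma operator_norm_le_entries:
  assumes z: "z \<in> carrier_mat n n" and le: "\<And>i j. i < n \<Longrightarrow> j < n \<Longrightarrow> cmod (z $$ (i, j)) \<le> r"
  shows "operator_norm z \<le> real n * real n * r"
proof (rule operator_norm_leI[OF z])
  fix v :: "complex Matrix.vec" assume v: "v \<in> carrier_vec n" "euclidean_norm v \<le> 1"
  have dv: "dim_vec v = n" using v by simp
  have vj: "cmod (vec_index v j) \<le> 1" if "j < n" for j
    using member_le_L2_set[of "{..<n}" j "\<lambda>i. cmod (vec_index v i)"] that v(2)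
    unfolding euclidean_norm_def dv by simp
  have comp: "cmod (vec_index (z *\<^sub>v v) i) \<le> real n * r" if i: "i < n" for i
  proof -
    have "vec_index (z *\<^sub>v v) i = (\<Sum>j = 0..<n. z $$ (i, j) * vec_index v j)"
      using z v i by (simp add: scalar_prod_def)
    also have "cmod \<dots> \<le> (\<Sum>j = 0..<n. r)"
    proof (rule sum_norm_le)
      fix j assume "j \<in> {0..<n}"
      then have "cmod (z $$ (i, j)) * cmod (vec_index v j) \<le> r * 1"
        using le[OF i, of j] vj[of j] order_trans[OF norm_ge_zero le[OF i, of j]]
        by (intro mult_mono) auto
      then show "cmod (z $$ (i, j) * vec_index v j) \<le> r" by (simp add: norm_mult)
    qed
    finally show ?thesis by simp
  qed
  have "euclidean_norm (z *\<^sub>v v) \<le> (\<Sum>i<n. \<bar>cmod (vec_index (z *\<^sub>v v) i)\<bar>)"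
    using z v L2_set_le_sum_abs[of "\<lambda>i. cmod (vec_index (z *\<^sub>v v) i)" "{..<n}"]
    by (simp add: euclidean_norm_def)
  also have "\<dots> \<le> (\<Sum>i<n. real n * r)"
    by (rule sum_mono) (use comp in auto)
  finally show "euclidean_norm (z *\<^sub>v v) \<le> real n * real n * r" by simp
qed

text \<open>The square \<open>v v^T\<close> of the real vector \<open>v = (s, t)\<close>; the vector
  \<open>(- t, s)\<close> supplies an orthogonal partner.\<close>

definition rank_one :: "real \<Rightarrow> real \<Rightarrow> complex mat" where
  "rank_one s t = Matrix.mat 2 2 (\<lambda>(i, j). complex_of_real ((if i = 0 then s else t) * (if j = 0 then s else t)))"

lemma rank_one_carrier [simp]: "rank_one s t \<in> carrier_mat 2 2"
  by (simp add: rank_one_def)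

lemma rank_one_positive: "mat_positive 2 (rank_one s t)"
proof -
  define C :: "complex mat" where
    "C = Matrix.mat 2 2 (\<lambda>(i, j). if i = 0 then complex_of_real (if j = 0 then s else t) else 0)"
  have "rank_one s t = mat_star C * C"
    by (rule eq_matI)
      (auto simp: rank_one_def C_def mat_star_def scalar_prod_def star_complex_def numeral_2_eq_2)
  then show ?thesis unfolding mat_positive_def
    by (intro bexI[of _ C]) (auto simp: C_def)
qed

lemma rank_one_orthogonal: "rank_one s t * rank_one (- t) s = 0\<^sub>m 2 2"
  by (rule eq_matI) (auto simp: rank_one_def scalar_prod_def numeral_2_eq_2 algebra_simps)

text \<open>Consequently a linear functional restricted to these matrices is a quadratic form in
  \<open>(s, t)\<close>, known from three values.\<close>

lemma rank_one_decomposition: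
  "rank_one s t = complex_of_real (s\<^sup>2 - s * t) \<cdot>\<^sub>m rank_one 1 0
    + (complex_of_real (t\<^sup>2 - s * t) \<cdot>\<^sub>m rank_one 0 1 + complex_of_real (s * t) \<cdot>\<^sub>m rank_one 1 1)"
  by (rule eq_matI) (auto simp: rank_one_def power2_eq_square algebra_simps)

lemma one_eq_rank_one: "1\<^sub>m 2 = rank_one 1 0 + rank_one 0 1"
  by (rule eq_matI) (auto simp: rank_one_def)

lemma quadratic_form_discriminant:
  fixes \<alpha> \<beta> \<kappa> :: real
  assumes "\<alpha> \<ge> 0" and q: "\<And>s t. s\<^sup>2 * \<alpha> + t\<^sup>2 * \<beta> + s * t * \<kappa> \<ge> 0"
  shows "\<kappa>\<^sup>2 \<le> 4 * \<alpha> * \<beta>"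
proof (cases "\<alpha> = 0")
  case True
  have "\<kappa> = 0"
  proof (rule ccontr)
    assume "\<kappa> \<noteq> 0"
    with q[of "- (\<beta> + 1) / \<kappa>" 1] True show False by simp
  qed
  then show ?thesis using True by simp
next
  case False
  have "0 \<le> \<alpha> * (4 * \<alpha> * \<beta> - \<kappa>\<^sup>2)"
    using q[of "- \<kappa>" "2 * \<alpha>"] by (simp add: power2_eq_square algebra_simps)
  then show ?thesis using False assms(1) by (simp add: zero_le_mult_iff)
qed

text \<open>Taking adjoints shows that \<open>z\<close> is real, and \<open>p\<close> is an
  eigenvector of the positive element \<open>z p\<close> for the value \<open>z\<close>.\<close>

lemma scalar_corner_positive:
  fixes p a :: "'a::cstar_algebra"
  assumes p: "projection p" "p \<noteq> 0" and "p * a * p = z *\<^sub>C p" "positive a"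
  shows "\<exists>r\<ge>0. p * a * p = r *\<^sub>R p"
proof -
  have sp: "star p = p" "p * p = p" using p by (auto simp: projection_def)
  have pos: "positive (z *\<^sub>C p)" using positive_conj[OF assms(4), of p] sp assms(3) by simp
  then have "cnj z *\<^sub>C p = z *\<^sub>C p" using positive_selfadj[OF pos] sp by simp
  then have "(cnj z - z) *\<^sub>C p = 0" by (simp add: scaleC_diff_left)
  then have "norm ((cnj z - z) *\<^sub>C p) = 0" by simp
  then have z: "z = complex_of_real (Re z)" using p(2)
    unfolding norm_scaleC by (simp add: complex_eq_iff)
  then have eq: "z *\<^sub>C p = Re z *\<^sub>R p" by (metis scaleR_scaleC)
  have "embed (z *\<^sub>C p) * embed p = Re z *\<^sub>R embed p"
    unfolding eq by (simp add: sp flip: embed_hom)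
  then have "Re z \<in> rspec (embed (z *\<^sub>C p))"
    using positive_selfadj[OF pos] p(2) by (intro eigenvalue_in_rspec[of _ "embed p"]) auto
  then have "Re z \<ge> 0" using positive_rspec pos by (metis positive_embed)
  then show ?thesis using assms(3) eq by auto
qed

text \<open>A completely positive order zero map on \<open>M\<^sub>2\<close> that almost commutes with \<open>p\<close> compresses to an
  almost multiplicative-on-orthogonals functional: its values on the two orthogonal pairs
  \<open>e\<^sub>1\<^sub>1, e\<^sub>2\<^sub>2\<close> and \<open>(e\<^sub>1\<^sub>1 + e\<^sub>2\<^sub>2 \<plusminus> (e\<^sub>1\<^sub>2 + e\<^sub>2\<^sub>1)) / 2\<close> have small products, which forces it to be small.\<close>

lemma order_zero_minimal_corner:
  fixes p :: "'a::cstar_algebra"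
  assumes p: "projection p" "p \<noteq> 0" "norm p = 1" and min: "\<And>y. \<exists>z. p * y * p = z *\<^sub>C p"
    and \<phi>: "cpc_order_zero 2 \<phi>"
    and comm: "\<And>z. z \<in> carrier_mat 2 2 \<Longrightarrow> operator_norm z \<le> 1 \<Longrightarrow> norm (commutator (\<phi> z) p) \<le> \<epsilon>"
  shows "\<exists>r\<ge>0. p * \<phi> (1\<^sub>m 2) * p = r *\<^sub>R p \<and> r\<^sup>2 \<le> 80 * \<epsilon>"
proof -
  have sp: "star p = p" "p * p = p" using p by (auto simp: projection_def)
  have add: "\<phi> (y + z) = \<phi> y + \<phi> z" if "y \<in> carrier_mat 2 2" "z \<in> carrier_mat 2 2" for y z
    using \<phi> that by (simp add: cpc_order_zero_def linear_on_mat_def)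
  have scale: "\<phi> (c \<cdot>\<^sub>m z) = c *\<^sub>C \<phi> z" if "z \<in> carrier_mat 2 2" for c z
    using \<phi> that by (simp add: cpc_order_zero_def linear_on_mat_def)
  have pos: "positive (\<phi> (rank_one s t))" for s t
    using \<phi> by (auto simp: cpc_order_zero_def intro: completely_positive_imp_positive rank_one_positive)
  have "\<forall>s t. \<exists>r\<ge>0. p * \<phi> (rank_one s t) * p = r *\<^sub>R p"
    using scalar_corner_positive[OF p(1,2) _ pos] min by metis
  then obtain r where r: "\<And>s t. r s t \<ge> 0" "\<And>s t. p * \<phi> (rank_one s t) * p = r s t *\<^sub>R p"
    by metis
  have inj: "a = b" if "a *\<^sub>R p = b *\<^sub>R p" for a b using that p(2) by simp
  have lin: "r s t = (s\<^sup>2 - s * t) * r 1 0 + ((t\<^sup>2 - s * t) * r 0 1 + s * t * r 1 1)" for s t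
  proof (rule inj)
    have "\<phi> (rank_one s t) = (s\<^sup>2 - s * t) *\<^sub>R \<phi> (rank_one 1 0)
        + ((t\<^sup>2 - s * t) *\<^sub>R \<phi> (rank_one 0 1) + (s * t) *\<^sub>R \<phi> (rank_one 1 1))"
      by (subst rank_one_decomposition) (simp add: add scale scaleR_scaleC)
    then have "p * \<phi> (rank_one s t) * p = (s\<^sup>2 - s * t) *\<^sub>R (p * \<phi> (rank_one 1 0) * p)
        + ((t\<^sup>2 - s * t) *\<^sub>R (p * \<phi> (rank_one 0 1) * p) + (s * t) *\<^sub>R (p * \<phi> (rank_one 1 1) * p))"
      by (simp add: distrib_left distrib_right)
    then show "r s t *\<^sub>R p = ((s\<^sup>2 - s * t) * r 1 0 + ((t\<^sup>2 - s * t) * r 0 1 + s * t * r 1 1)) *\<^sub>R p"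
      by (simp add: r scaleR_add_left)
  qed
  have prod: "r s t * r (- t) s \<le> 16 * \<epsilon>" if st: "\<bar>s\<bar> \<le> 1" "\<bar>t\<bar> \<le> 1" for s t
  proof -
    define a b where "a = \<phi> (rank_one s t)" and "b = \<phi> (rank_one (- t) s)"
    \<comment> \<open>The entrywise estimate only bounds these matrices by 4, whereas the commutator
      hypothesis wants norm at most 1. Undoing the scaling for both factors gives the 16.\<close>
    have quarter: "operator_norm (complex_of_real (1 / 4) \<cdot>\<^sub>m rank_one x y) \<le> 1"
      if "\<bar>x\<bar> \<le> 1" "\<bar>y\<bar> \<le> 1" for x y
    proof -
      have "\<bar>u * w\<bar> \<le> 1" if "u \<in> {x, y}" "w \<in> {x, y}" for u w
        using mult_mono[of "\<bar>u\<bar>" 1 "\<bar>w\<bar>" 1] that \<open>\<bar>x\<bar> \<le> 1\<close> \<open>\<bar>y\<bar> \<le> 1\<close> by (auto simp: abs_mult)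
      then have "operator_norm (complex_of_real (1 / 4) \<cdot>\<^sub>m rank_one x y) \<le> real 2 * real 2 * (1 / 4)"
        by (intro operator_norm_le_entries)
          (auto simp: rank_one_def norm_mult norm_divide simp flip: of_real_mult)
      then show ?thesis by simp
    qed
    have "mat_positive 2 (rank_one s t)" "mat_positive 2 (rank_one (- t) s)"
      by (rule rank_one_positive)+
    then have ab: "a * b = 0"
      using \<phi> rank_one_orthogonal[of s t] by (simp add: cpc_order_zero_def order_zero_def a_def b_def)
    have "norm (\<phi> (complex_of_real (1 / 4) \<cdot>\<^sub>m rank_one s t)) \<le> 1"
      using \<phi> quarter[OF st] unfolding cpc_order_zero_def contractive_def
      by (meson order_trans rank_one_carrier smult_carrier_mat)
    then have na: "norm a \<le> 4" by (simp add: scale norm_scaleC a_def norm_divide)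
    have "norm (commutator (\<phi> (complex_of_real (1 / 4) \<cdot>\<^sub>m rank_one (- t) s)) p) \<le> \<epsilon>"
      using st by (intro comm quarter) auto
    moreover have "commutator (\<phi> (complex_of_real (1 / 4) \<cdot>\<^sub>m rank_one (- t) s)) p
        = complex_of_real (1 / 4) *\<^sub>C commutator b p"
      by (simp add: commutator_def scale b_def scaleC_diff_right)
    ultimately have nc: "norm (commutator b p) \<le> 4 * \<epsilon>" by (simp add: norm_scaleC norm_divide)
    \<comment> \<open>Moving \<open>p\<close> across \<open>b\<close> leaves
      \<open>p (a b) p\<close>, which vanishes by order zero, and a commutator term.\<close>
    have "(p * a * p) * (p * b * p) = p * a * (p * b * p)" by (simp add: sp mult.assoc flip: mult.assoc[of p p])
    also have "\<dots> = p * (a * b) * p - p * a * commutator b p * p"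
      by (simp add: commutator_def algebra_simps sp)
    finally have "(p * a * p) * (p * b * p) = - (p * a * commutator b p * p)" by (simp add: ab)
    moreover have "(p * a * p) * (p * b * p) = (r s t * r (- t) s) *\<^sub>R p"
      unfolding a_def b_def r by (simp add: sp mult.commute)
    ultimately have "(r s t * r (- t) s) *\<^sub>R p = - (p * a * commutator b p * p)" by (simp only:)
    then have "norm ((r s t * r (- t) s) *\<^sub>R p) = norm (p * a * commutator b p * p)"
      by (simp only: norm_minus_cancel)
    then have "r s t * r (- t) s = norm (p * a * commutator b p * p)"
      using r(1)[of s t] r(1)[of "- t" s] by (simp add: p(3))
    also have "\<dots> \<le> norm p * norm a * norm (commutator b p) * norm p"
      by (meson mult_right_mono norm_ge_zero norm_mult_ineq order_trans)
    also have "\<dots> \<le> 4 * (4 * \<epsilon>)"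
      using mult_mono[OF na nc] p(3) by simp
    finally show ?thesis by simp
  qed
  define \<alpha> \<beta> \<kappa> where "\<alpha> = r 1 0" and "\<beta> = r 0 1" and "\<kappa> = r 1 1 - r 1 0 - r 0 1"
  have q: "r s t = s\<^sup>2 * \<alpha> + t\<^sup>2 * \<beta> + s * t * \<kappa>" for s t
    by (subst lin) (simp add: \<alpha>_def \<beta>_def \<kappa>_def algebra_simps)
  have "\<alpha> * \<beta> \<le> 16 * \<epsilon>" using prod[of 1 0] by (simp add: \<alpha>_def \<beta>_def)
  moreover have "\<kappa>\<^sup>2 \<le> 4 * \<alpha> * \<beta>"
  proof (rule quadratic_form_discriminant)
    show "\<alpha> \<ge> 0" unfolding \<alpha>_def by (rule r)
    show "s\<^sup>2 * \<alpha> + t\<^sup>2 * \<beta> + s * t * \<kappa> \<ge> 0" for s t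
      using r(1)[of s t] unfolding q .
  qed
  moreover have "(\<alpha> + \<beta>)\<^sup>2 - \<kappa>\<^sup>2 \<le> 16 * \<epsilon>"
  proof -
    have "r 1 1 = \<alpha> + \<beta> + \<kappa>" "r (- 1) 1 = \<alpha> + \<beta> - \<kappa>"
      by (subst q, simp)+
    then have "(\<alpha> + \<beta>)\<^sup>2 - \<kappa>\<^sup>2 = r 1 1 * r (- 1) 1"
      by (simp only:) (simp add: power2_eq_square algebra_simps)
    also have "\<dots> \<le> 16 * \<epsilon>" by (rule prod) simp_all
    finally show ?thesis .
  qed
  \<comment> \<open>The 80 is 64 + 16:
    \<open>\<kappa>\<^sup>2 <= 4 \<alpha> \<beta> <= 64 \<epsilon>\<close>, and the other orthogonal
    pair contributes 16.\<close>
  ultimately have "(\<alpha> + \<beta>)\<^sup>2 \<le> 80 * \<epsilon>" by linarith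
  moreover have "p * \<phi> (1\<^sub>m 2) * p = (\<alpha> + \<beta>) *\<^sub>R p"
    by (simp add: one_eq_rank_one add r distrib_left distrib_right \<alpha>_def \<beta>_def scaleR_add_left)
  moreover have "\<alpha> + \<beta> \<ge> 0" using r(1)[of 1 0] r(1)[of 0 1] by (simp add: \<alpha>_def \<beta>_def)
  ultimately show ?thesis by blast
qed

section \<open>Defects, cut-downs and minimal projections\<close>

lemma positive_defect:
  fixes x e :: "'a::cstar_algebra"
  assumes "selfadj x" "positive e" "norm e \<le> 1"
  shows "positive (x * x - x * e * x)"
proof -
  have "embed e \<preceq> 1 *\<^sub>R 1"
    using positive_selfadj[OF assms(2)] assms(3) by (intro cstar_le_norm) auto
  then have "positive (embed x * (1 - embed e) * star (embed x))"
    unfolding cstar_le_def by (intro positive_conj) simp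
  moreover have "embed x * (1 - embed e) * star (embed x) = embed (x * x - x * e * x)"
    using assms(1) by (simp add: embed_hom algebra_simps flip: embed_star)
  ultimately show ?thesis by simp
qed

lemma cut_down_le:
  fixes c :: "'a::cstar_algebra"
  assumes "positive c" "\<epsilon> \<ge> 0"
  shows "positive (cut_down c \<epsilon>)" "embed c \<preceq> embed (cut_down c \<epsilon>) + \<epsilon> *\<^sub>R 1"
    "norm (c - cut_down c \<epsilon>) \<le> \<epsilon>"
proof -
  have sc: "selfadj (embed c)" using positive_selfadj[OF assms(1)] by simp
  have e: "embed (cut_down c \<epsilon>) = rfc (\<lambda>t. max (t - \<epsilon>) 0) (embed c)"
    using positive_selfadj[OF assms(1)] assms(2) by (rule embed_cut_down)
  have cont: "continuous_on S (\<lambda>t. max (t - \<epsilon>) 0)" for S :: "real set"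
    by (intro continuous_intros)
  have nn: "t \<ge> 0" if "t \<in> rspec (embed c)" for t
    using positive_rspec[OF _ that] assms(1) by simp
  have "positive (embed (cut_down c \<epsilon>))"
    unfolding e by (rule positive_rfc[OF sc cont]) simp
  then show "positive (cut_down c \<epsilon>)" by simp
  have "embed (cut_down c \<epsilon>) + \<epsilon> *\<^sub>R 1 = rfc (\<lambda>t. max (t - \<epsilon>) 0 + \<epsilon>) (embed c)"
    unfolding e by (simp only: rfc_add[OF sc cont continuous_on_const] rfc_const[OF sc])
  moreover have "rfc (\<lambda>t. t) (embed c) \<preceq> rfc (\<lambda>t. max (t - \<epsilon>) 0 + \<epsilon>) (embed c)"
    by (rule rfc_mono[OF sc]) (auto intro!: continuous_intros)
  ultimately show "embed c \<preceq> embed (cut_down c \<epsilon>) + \<epsilon> *\<^sub>R 1" by (simp add: rfc_id[OF sc])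
  have "embed (c - cut_down c \<epsilon>) = rfc (\<lambda>t. t - max (t - \<epsilon>) 0) (embed c)"
    by (simp only: embed_diff e rfc_diff[OF sc continuous_on_id cont] rfc_id[OF sc])
  also have "norm \<dots> \<le> \<epsilon>"
  proof (rule norm_rfc_le[OF sc])
    show "continuous_on (rspec (embed c)) (\<lambda>t. t - max (t - \<epsilon>) 0)" by (intro continuous_intros)
    show "\<bar>t - max (t - \<epsilon>) 0\<bar> \<le> \<epsilon>" if "t \<in> rspec (embed c)" for t
      using nn[OF that] assms(2) by (simp add: max_def)
  qed
  finally show "norm (c - cut_down c \<epsilon>) \<le> \<epsilon>" by simp
qed

lemma cpc_one:
  fixes \<phi> :: "complex mat \<Rightarrow> 'a::cstar_algebra"
  assumes "cpc_order_zero n \<phi>"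
  shows "positive (\<phi> (1\<^sub>m n))" "norm (\<phi> (1\<^sub>m n)) \<le> 1"
proof -
  show "positive (\<phi> (1\<^sub>m n))"
    using assms mat_positive_one by (auto simp: cpc_order_zero_def intro: completely_positive_imp_positive)
  have "norm (\<phi> (1\<^sub>m n)) \<le> operator_norm (1\<^sub>m n)"
    using assms by (simp add: cpc_order_zero_def contractive_def)
  then show "norm (\<phi> (1\<^sub>m n)) \<le> 1" using operator_norm_one order_trans by blast
qed

lemma tracially_Z_absorbingD:
  fixes x a :: "'a::cstar_algebra"
  assumes "tracially_Z_absorbing TYPE('a)" "positive x" "positive a" "a \<noteq> 0" "finite F" "\<epsilon> > 0" "n \<ge> 1"
  shows "\<exists>\<phi>. cpc_order_zero n \<phi> \<and> cut_down (x * x - x * \<phi> (1\<^sub>m n) * x) \<epsilon> \<precsim> a \<and>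
    (\<forall>z \<in> carrier_mat n n. operator_norm z \<le> 1 \<longrightarrow> (\<forall>b\<in>F. norm (commutator (\<phi> z) b) < \<epsilon>))"
  using assms(1)[unfolded tracially_Z_absorbing_def, THEN conjunct2, rule_format, of x a F \<epsilon> n]
    assms(2-) by simp

lemma norm_projection:
  assumes "projection p" "p \<noteq> 0"
  shows "norm (p::'a::cstar_algebra) = 1"
  using cstar_identity[of p] assms by (simp add: projection_def power2_eq_square)

lemma norm_diff_triangle_ineq': "norm (a - c) \<le> norm (a - b) + norm (b - c :: 'a::real_normed_vector)"
  by (rule norm_diff_triangle_le[OF order_refl order_refl])

lemma norm_mult3: "norm (a * b * c) \<le> norm a * norm b * norm (c::'a::real_normed_algebra)"
  by (rule order_trans[OF norm_mult_ineq]) (intro mult_right_mono norm_mult_ineq norm_ge_zero)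

lemma positive_sqrt:
  assumes "positive (e::'a::cstar_algebra)"
  obtains g where "selfadj g" "g * g = e"
proof -
  have sa: "selfadj e" using assms by (rule positive_selfadj)
  have e: "embed (afc sqrt e) = rfc sqrt (embed e)"
    by (rule embed_afc[OF sa]) (auto intro: continuous_intros)
  have "selfadj (embed (afc sqrt e))" "embed (afc sqrt e * afc sqrt e) = embed e"
    using rfc_sqrt[of "embed e"] assms by (simp_all add: e embed_mult)
  then show thesis using that[of "afc sqrt e"] by simp
qed

text \<open>If \<open>p\<close> is minimal and \<open>b\<close> connects it to an orthogonal equivalent projection \<open>q = b\<^sup>*b\<close>, the
  almost commuting map from \<open>M\<^sub>2\<close> must be small on \<open>p + q\<close>, so that \<open>p + q\<close> is nearly subequivalent to \<open>p\<close>.\<close>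

lemma minimal_projection_contradiction:
  fixes p b :: "'a::cstar_algebra"
  assumes tz: "tracially_Z_absorbing TYPE('a)" and p: "projection p" "p \<noteq> 0"
    and min: "\<And>y. \<exists>z. p * y * p = z *\<^sub>C p"
    and b: "b * star b = p" "p * b = b" "b * p = 0"
  shows False
proof -
  have sp: "star p = p" "p * p = p" using p by (auto simp: projection_def)
  have np: "norm p = 1" using norm_projection p by blast
  have "(norm b)\<^sup>2 = 1" using cstar_identity'[of b] b np by simp
  then have nb: "norm b = 1" by (simp add: power2_eq_1_iff) (metis norm_ge_zero not_one_le_zero neg_0_le_iff_le)
  have pbs: "star b * p = star b" "p * star b = 0"
    using arg_cong[OF b(2), of star] arg_cong[OF b(3), of star] by (simp_all add: star_mult sp)
  define q where "q = star b * b"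
  have bq: "b * q = b"
    using b by (simp add: q_def flip: mult.assoc)
  have q: "q * q = q" "star q = q" "p * q = 0" "q * p = 0"
    using bq pbs by (simp_all add: q_def star_mult mult.assoc b flip: mult.assoc[of p])
  define x where "x = p + q"
  have x: "star x = x" "x * x = x" by (simp_all add: x_def star_add sp q algebra_simps)
  \<comment> \<open>Turns the bound \<open>r\<^sup>2 <= 80 \<epsilon>\<close> of
    \<open>order_zero_minimal_corner\<close> into \<open>r <= 1 / 64\<close>.\<close>
  define \<epsilon> :: real where "\<epsilon> = (1 / 64)\<^sup>2 / 80"
  have \<epsilon>: "\<epsilon> > 0" "\<epsilon> \<le> 1 / 64" by (simp_all add: \<epsilon>_def power2_eq_square)
  have "positive x" "positive p" using positive_square[OF x(1)] positive_square[OF sp(1)] x sp by simp_all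
  then obtain \<phi> where \<phi>: "cpc_order_zero 2 \<phi>" and sub: "cut_down (x * x - x * \<phi> (1\<^sub>m 2) * x) \<epsilon> \<precsim> p"
    and comm': "\<forall>z \<in> carrier_mat 2 2. operator_norm z \<le> 1 \<longrightarrow> (\<forall>c\<in>{p, b}. norm (commutator (\<phi> z) c) < \<epsilon>)"
    using tracially_Z_absorbingD[OF tz _ _ p(2) _ \<epsilon>(1), of x "{p, b}" 2] by auto
  have comm: "norm (commutator (\<phi> z) c) < \<epsilon>"
    if "z \<in> carrier_mat 2 2" "operator_norm z \<le> 1" "c \<in> {p, b}" for z c
    using comm'[rule_format, OF that] .
  define e where "e = \<phi> (1\<^sub>m 2)"
  have e: "positive e" "norm e \<le> 1" using cpc_one[OF \<phi>] by (simp_all add: e_def)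
  have "norm (commutator e b) < \<epsilon>" unfolding e_def by (rule comm) (auto simp: operator_norm_one)
  then have ce: "norm (commutator e b) \<le> \<epsilon>" by simp
  have "norm (commutator (\<phi> z) p) \<le> \<epsilon>" if "z \<in> carrier_mat 2 2" "operator_norm z \<le> 1" for z
    by (rule less_imp_le[OF comm[OF that]]) simp
  from order_zero_minimal_corner[OF p np min \<phi> this]
  obtain r where r: "r \<ge> 0" "p * e * p = r *\<^sub>R p" "r\<^sup>2 \<le> 80 * \<epsilon>"
    unfolding e_def by blast
  have "r\<^sup>2 \<le> (1 / 64)\<^sup>2" using r(3) by (simp add: \<epsilon>_def)
  then have r64: "r \<le> 1 / 64" by (rule power2_le_imp_le) simp
  obtain g where g: "selfadj g" "g * g = e" using positive_sqrt[OF e(1)] .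
  have gn: "(norm (g * y))\<^sup>2 = norm (star y * e * y)" for y
    unfolding cstar_identity[symmetric] g(2)[symmetric] using g(1) by (simp add: star_mult mult.assoc)
  have gp: "norm (g * p) \<le> 1 / 4"
  proof (rule power2_le_imp_le)
    have "(norm (g * p))\<^sup>2 = r" using gn[of p] r np by (simp add: sp)
    then show "(norm (g * p))\<^sup>2 \<le> (1 / 4)\<^sup>2" using r64 by (simp add: power2_eq_square)
  qed simp
  have gq: "norm (g * q) \<le> 1 / 4"
  proof (rule power2_le_imp_le)
    have beb: "b * e * star b = p * e * p - p * commutator e b * star b * p"
    proof -
      have "p * commutator e b * star b * p = p * e * (b * star b) * p - (p * b) * e * (star b * p)"
        by (simp add: commutator_def algebra_simps)
      moreover have "p * e * p * p = p * e * p" by (simp add: mult.assoc sp)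
      ultimately have "p * commutator e b * star b * p = p * e * p - b * e * star b"
        by (simp only: b(1,2) pbs(1))
      then show ?thesis by simp
    qed
    have "norm (p * commutator e b * star b * p) \<le> norm p * norm (commutator e b) * norm (star b) * norm p"
      by (rule order_trans[OF norm_mult_ineq]) (intro mult_right_mono norm_mult3 norm_ge_zero)
    then have "norm (b * e * star b) \<le> r + \<epsilon>"
      unfolding beb using ce r np nb norm_triangle_ineq4[of "p * e * p" "p * commutator e b * star b * p"] by simp
    moreover have "star q * e * q = star b * (b * e * star b) * b"
      by (simp add: q_def star_mult mult.assoc)
    ultimately have "norm (star q * e * q) \<le> r + \<epsilon>"
      using norm_mult3[of "star b" "b * e * star b" b] nb by simp
    then show "(norm (g * q))\<^sup>2 \<le> (1 / 4)\<^sup>2"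
      unfolding gn using r64 \<epsilon> by (simp add: power2_eq_square)
  qed simp
  have "norm (g * x) \<le> 1 / 2"
    using norm_triangle_ineq[of "g * p" "g * q"] gp gq by (simp add: x_def distrib_left)
  then have "norm (x * e * x) \<le> (1 / 2)\<^sup>2"
    using gn[of x] power_mono[of "norm (g * x)" "1 / 2" 2] by (simp add: x)
  then have xex: "norm (x * e * x) \<le> 1 / 4" by (simp add: power2_eq_square)
  define X where "X = x * x - x * e * x"
  define D where "D = cut_down X \<epsilon>"
  have "x - X = x * e * x" by (simp add: X_def x)
  with xex have 1: "norm (x - X) \<le> 1 / 4" by simp
  have 2: "norm (X - D) \<le> 1 / 64"
    using cut_down_le(3)[of X \<epsilon>] positive_defect[OF x(1) e] \<epsilon> by (simp add: X_def D_def)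
  obtain v where v: "norm (D - v * p * star v) < 1 / 8"
    using cuntz_belowD[OF sub, of "1 / 8"] unfolding D_def X_def e_def by auto
  have "norm (x - v * p * star v) \<le> norm (x - X) + norm (X - v * p * star v)"
    by (rule norm_diff_triangle_ineq')
  moreover have "norm (X - v * p * star v) \<le> norm (X - D) + norm (D - v * p * star v)"
    by (rule norm_diff_triangle_ineq')
  ultimately have near: "norm (x - v * p * star v) < 1 / 2" using 1 2 v by linarith
  \<comment> \<open>By minimality the entries of \<open>v p v*\<close> at \<open>p\<close> and
    \<open>q\<close> are products of two scalars, as in a rank one matrix. Being close to the unit
    \<open>p + q\<close> demands \<open>|\<alpha>|\<^sup>2\<close> and
    \<open>|\<beta>|\<^sup>2\<close> above 1/2 but \<open>|\<alpha> \<beta>|\<close> below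
    1/2.\<close>
  obtain \<alpha> where \<alpha>: "p * v * p = \<alpha> *\<^sub>C p" using min by blast
  obtain \<beta> where "p * (b * v) * p = \<beta> *\<^sub>C p" using min by blast
  then have \<beta>: "b * v * p = \<beta> *\<^sub>C p" by (simp add: b flip: mult.assoc)
  have \<alpha>': "p * star v * p = cnj \<alpha> *\<^sub>C p" and \<beta>': "p * star v * star b = cnj \<beta> *\<^sub>C p"
    using arg_cong[OF \<alpha>, of star] arg_cong[OF \<beta>, of star] by (simp_all add: star_mult sp mult.assoc)
  have split: "y * (x - v * p * star v) * z = y * x * z - (y * v * p) * (p * star v * z)" for y z
  proof -
    have "(y * v * p) * (p * star v * z) = y * v * (p * p) * star v * z" by (simp only: mult.assoc)
    then show ?thesis by (simp add: sp algebra_simps)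
  qed
  have bound: "norm (y * (x - v * p * star v) * z) < 1 / 2" if "norm y = 1" "norm z = 1" for y z
    using norm_mult3[of y "x - v * p * star v" z] near that by simp
  have bx: "b * x = b" by (simp add: x_def distrib_left b bq)
  have px: "p * x = p" by (simp add: x_def distrib_left sp q)
  have "norm ((1 - \<alpha> * cnj \<alpha>) *\<^sub>C p) < 1 / 2"
    using bound[OF np np] unfolding split px \<alpha> \<alpha>' by (simp add: sp scaleC_diff_left mult.commute)
  then have 1: "cmod (1 - \<alpha> * cnj \<alpha>) < 1 / 2" by (simp add: norm_scaleC np)
  have "norm ((1 - \<beta> * cnj \<beta>) *\<^sub>C p) < 1 / 2"
    using bound[of b "star b"] nb unfolding split bx \<beta> \<beta>' by (simp add: sp b scaleC_diff_left mult.commute)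
  then have 2: "cmod (1 - \<beta> * cnj \<beta>) < 1 / 2" by (simp add: norm_scaleC np)
  have "norm (- ((\<alpha> * cnj \<beta>) *\<^sub>C p)) < 1 / 2"
    using bound[of p "star b"] nb np unfolding split px \<alpha> \<beta>' by (simp add: sp pbs mult.commute)
  then have 3: "cmod \<alpha> * cmod \<beta> < 1 / 2" by (simp add: norm_scaleC np norm_mult)
  have half: "(cmod z)\<^sup>2 > 1 / 2" if "cmod (1 - z * cnj z) < 1 / 2" for z
  proof -
    have "1 \<le> cmod (1 - z * cnj z) + cmod (z * cnj z)"
      using norm_triangle_ineq[of "1 - z * cnj z" "z * cnj z"] by simp
    then show ?thesis using that by (simp add: norm_mult power2_eq_square)
  qed
  have "1 / 2 * (1 / 2) < (cmod \<alpha>)\<^sup>2 * (cmod \<beta>)\<^sup>2"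
    using half[OF 1] half[OF 2] by (intro mult_strict_mono) auto
  also have "\<dots> = (cmod \<alpha> * cmod \<beta>)\<^sup>2" by (simp add: power_mult_distrib)
  also have "\<dots> < (1 / 2)\<^sup>2"
    using 3 by (intro power_strict_mono) auto
  finally show False by (simp add: power2_eq_square)
qed

section \<open>Orthogonal elements near the norm of a positive element\<close>

lemma afc_props:
  fixes x :: "'a::cstar_algebra"
  assumes sx: "selfadj x" and f: "continuous_on UNIV f" "f 0 = 0"
  shows "embed (afc f x) = rfc f (embed x)" "selfadj (afc f x)"
proof -
  have c: "continuous_on S f" for S using f(1) continuous_on_subset by blast
  show e: "embed (afc f x) = rfc f (embed x)" by (rule embed_afc[OF sx c f(2)])
  have "selfadj (embed (afc f x))" unfolding e by (rule rfc_selfadj[OF _ c]) (simp add: sx)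
  then show "selfadj (afc f x)" by simp
qed

lemma afc_mult:
  fixes x :: "'a::cstar_algebra"
  assumes sx: "selfadj x" and f: "continuous_on UNIV f" "f 0 = 0" and g: "continuous_on UNIV g" "g 0 = 0"
  shows "embed (afc f x * afc g x) = rfc (\<lambda>t. f t * g t) (embed x)"
proof -
  have "continuous_on S f" "continuous_on S g" for S using f(1) g(1) continuous_on_subset by blast+
  then show ?thesis
    using sx by (simp add: embed_mult afc_props[OF sx f] afc_props[OF sx g] rfc_mult)
qed

lemma afc_nonzero:
  fixes x :: "'a::cstar_algebra"
  assumes sx: "selfadj x" and f: "continuous_on UNIV f" "f 0 = 0" and t: "t \<in> rspec (embed x)" "f t \<noteq> 0"
  shows "afc f x \<noteq> 0"
proof
  assume "afc f x = 0"
  then have "rfc f (embed x) = 0" using afc_props(1)[OF sx f] by simp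
  moreover have "\<bar>f t\<bar> \<le> norm (rfc f (embed x))"
    using sx f(1) continuous_on_subset by (intro norm_rfc_ge t) auto
  ultimately show False using t(2) by simp
qed

text \<open>Elements of the corner with two nonzero spectral values produce orthogonal elements, and adding a
  large multiple of \<open>p\<close> makes an element invertible in the corner.\<close>

lemma corner_scalar_selfadj:
  fixes p :: "'a::cstar_algebra"
  assumes p: "projection p"
    and no: "\<And>s d. \<lbrakk>selfadj s; selfadj d; p * s = s; p * d = d; s * d = 0\<rbrakk> \<Longrightarrow> s = 0 \<or> d = 0"
    and y: "selfadj y"
  shows "\<exists>r. p * y * p = r *\<^sub>R p"
proof -
  have sp: "star p = p" "p * p = p" using p by (auto simp: projection_def)
  define h where "h = p * y * p"
  have h: "selfadj h" "p * h = h" "h * p = h"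
    using sp y by (simp_all add: h_def star_mult mult.assoc flip: mult.assoc[of p p])
  define t where "t = norm h + 1"
  define k where "k = h + t *\<^sub>R p"
  have k: "selfadj k" "p * k = k" "k * p = k"
    using sp h by (simp_all add: k_def star_add algebra_simps)
  have sk: "selfadj (embed k)" using k by simp
  \<comment> \<open>\<open>k\<close> annihilates \<open>1 - p\<close>, hence so does every function
    of \<open>k\<close> vanishing at 0.\<close>
  have absorb: "p * afc f k = afc f k" if f: "continuous_on UNIV f" "f 0 = 0" for f
  proof -
    have "embed k * (1 - embed p) = 0 *\<^sub>R (1 - embed p)"
      using k(3) by (simp add: algebra_simps flip: embed_mult)
    then have "rfc f (embed k) * (1 - embed p) = f 0 *\<^sub>R (1 - embed p)"
      using f(1) continuous_on_subset by (intro rfc_mult_eigenvector[OF sk]) auto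
    then have "embed (afc f k - afc f k * p) = 0"
      using f by (simp add: embed_hom afc_props[OF k(1) f] algebra_simps)
    then have "afc f k * p = afc f k" by simp
    from arg_cong[OF this, of star] show ?thesis
      using afc_props(2)[OF k(1) f] sp by (simp add: star_mult)
  qed
  have two: "u = w" if u: "u \<in> rspec (embed k)" "u \<noteq> 0" and w: "w \<in> rspec (embed k)" "w \<noteq> 0" for u w
  proof (rule ccontr)
    assume "u \<noteq> w"
    \<comment> \<open>Radius of the bumps at \<open>u\<close> and \<open>w\<close>: they must vanish
      at 0 and have disjoint supports.\<close>
    define \<delta> where "\<delta> = min (min \<bar>u\<bar> \<bar>w\<bar>) (\<bar>u - w\<bar> / 2)"
    define f where "f v x = max 0 (\<delta> - \<bar>x - v\<bar>)" for v x :: real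
    have d: "\<delta> > 0" using u w \<open>u \<noteq> w\<close> by (simp add: \<delta>_def)
    have f: "continuous_on UNIV (f v)" for v unfolding f_def by (intro continuous_intros)
    have f0: "f u 0 = 0" "f w 0 = 0" by (auto simp: f_def \<delta>_def)
    have "f u x * f w x = 0" for x
    proof -
      have "\<bar>u - w\<bar> \<le> \<bar>x - u\<bar> + \<bar>x - w\<bar>" by linarith
      moreover have "\<delta> \<le> \<bar>u - w\<bar> / 2" unfolding \<delta>_def by (rule min.cobounded2)
      ultimately have "\<delta> - \<bar>x - u\<bar> \<le> 0 \<or> \<delta> - \<bar>x - w\<bar> \<le> 0" by argo
      then show ?thesis by (auto simp: f_def max_def)
    qed
    then have "embed (afc (f u) k * afc (f w) k) = rfc (\<lambda>_. 0) (embed k)"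
      by (simp only: afc_mult[OF k(1) f f0(1) f f0(2)])
    then have "embed (afc (f u) k * afc (f w) k) = 0" by (simp add: rfc_const[OF sk])
    then have "afc (f u) k * afc (f w) k = 0" by simp
    then have "afc (f u) k = 0 \<or> afc (f w) k = 0"
      by (intro no absorb afc_props(2)[OF k(1)] f f0)
    moreover have "afc (f u) k \<noteq> 0" "afc (f w) k \<noteq> 0"
      using d by (auto intro!: afc_nonzero[OF k(1) f f0(1) u(1)] afc_nonzero[OF k(1) f f0(2) w(1)] simp: f_def)
    ultimately show False by blast
  qed
  have "\<exists>u. \<forall>w\<in>rspec (embed k). w = 0 \<or> w = u"
  proof (cases "\<exists>u\<in>rspec (embed k). u \<noteq> 0")
    case True
    then show ?thesis using two by blast
  qed blast
  then obtain u where u: "\<And>w. w \<in> rspec (embed k) \<Longrightarrow> w = 0 \<or> w = u" by blast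
  have "embed k * embed k = u *\<^sub>R embed k"
  proof -
    have "embed k * embed k = rfc (\<lambda>t. t * t) (embed k)"
      by (simp add: rfc_mult[OF sk continuous_on_id continuous_on_id] rfc_id[OF sk])
    also have "\<dots> = rfc (\<lambda>t. u * t) (embed k)"
      by (rule rfc_cong[OF sk]) (use u in \<open>auto intro!: continuous_intros\<close>)
    also have "\<dots> = u *\<^sub>R embed k" by (simp add: rfc_cmult[OF sk continuous_on_id] rfc_id[OF sk])
    finally show ?thesis .
  qed
  then have "embed (k * k) = embed (u *\<^sub>R k)" by (simp only: embed_hom)
  then have kk: "k * k = u *\<^sub>R k" by simp
  \<comment> \<open>\<open>k * k = u k\<close> makes \<open>r\<close> annihilate
    \<open>k = h + t p\<close>. Then \<open>t r = - r h\<close>, and \<open>norm h < t\<close>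
    leaves only \<open>r = 0\<close>.\<close>
  define r where "r = k - u *\<^sub>R p"
  have "r * k = 0" using kk k by (simp add: r_def left_diff_distrib)
  moreover have rp: "r * p = r" using k sp by (simp add: r_def left_diff_distrib)
  ultimately have tr: "t *\<^sub>R r = - (r * h)" by (simp add: k_def distrib_left eq_neg_iff_add_eq_0 add.commute)
  have "t * norm r \<le> norm r * norm h"
    using norm_mult_ineq[of r h] arg_cong[OF tr, of norm] by (simp add: t_def)
  then have "norm r \<le> 0" by (simp add: t_def algebra_simps)
  then have "k = u *\<^sub>R p" by (simp add: r_def)
  then have "h = (u - t) *\<^sub>R p" by (simp add: k_def scaleR_diff_left algebra_simps)
  then show ?thesis by (auto simp: h_def)
qed

lemma corner_scalar:
  fixes p :: "'a::cstar_algebra"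
  assumes p: "projection p"
    and no: "\<And>s d. \<lbrakk>selfadj s; selfadj d; p * s = s; p * d = d; s * d = 0\<rbrakk> \<Longrightarrow> s = 0 \<or> d = 0"
  shows "\<exists>z. p * y * p = z *\<^sub>C p"
proof -
  obtain u v where suv: "selfadj u" "selfadj v" and y: "y = u + \<i> *\<^sub>C v"
    by (rule selfadj_decomposition)
  obtain r where r: "p * u * p = r *\<^sub>R p" using corner_scalar_selfadj[OF p no suv(1)] by blast
  obtain r' where r': "p * v * p = r' *\<^sub>R p" using corner_scalar_selfadj[OF p no suv(2)] by blast
  have "p * y * p = p * u * p + \<i> *\<^sub>C (p * v * p)" unfolding y by (simp add: algebra_simps)
  also have "\<dots> = (complex_of_real r + \<i> * complex_of_real r') *\<^sub>C p"
    unfolding r r' scaleR_scaleC by (simp add: scaleC_add_left)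
  finally show ?thesis by blast
qed

lemma scalars_isomorphic_complex:
  fixes p :: "'a::cstar_algebra"
  assumes p: "projection p" "p \<noteq> 0" and all: "\<And>x. \<exists>z. x = z *\<^sub>C p"
  shows "\<exists>f :: 'a \<Rightarrow> complex. star_isomorphism f"
proof -
  have sp: "star p = p" "p * p = p" using p by (auto simp: projection_def)
  have inj: "z = w" if "z *\<^sub>C p = w *\<^sub>C p" for z w
  proof -
    have "norm ((z - w) *\<^sub>C p) = 0" using that by (simp add: scaleC_diff_left)
    then show ?thesis using p(2) by (simp add: norm_scaleC)
  qed
  define f where "f x = (THE z. x = z *\<^sub>C p)" for x
  have f: "f (z *\<^sub>C p) = z" for z
    unfolding f_def using inj by (intro the_equality) auto
  have "star_isomorphism f"
    unfolding star_isomorphism_def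
  proof (intro conjI allI)
    show "bij f"
      unfolding bij_def inj_def surj_def using all f by metis
    fix x y :: 'a and c
    obtain z w where zw: "x = z *\<^sub>C p" "y = w *\<^sub>C p" using all by metis
    have "x + y = (z + w) *\<^sub>C p" by (simp add: zw scaleC_add_left)
    then show "f (x + y) = f x + f y" by (simp add: zw f)
    show "f (c *\<^sub>C x) = c *\<^sub>C f x" by (simp add: zw f scaleC_complex_def)
    show "f (x * y) = f x * f y" by (simp add: zw f sp mult.commute)
    show "f (star x) = star (f x)" by (simp add: zw f sp star_complex_def)
  qed
  then show ?thesis by blast
qed

text \<open>By \<open>red\<close> and its adjoint \<open>p\<close> is central, so the scalar corner
  is a closed nonzero ideal and simplicity makes it everything.\<close>

lemma scalar_corner_simple:
  fixes p :: "'a::cstar_algebra"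
  assumes simple: "simple_cstar TYPE('a)" and p: "projection p" "p \<noteq> 0"
    and min: "\<And>y. \<exists>z. p * y * p = z *\<^sub>C p" and red: "\<And>y. p * y = p * y * p"
  shows "\<exists>z. x = z *\<^sub>C p"
proof -
  have sp: "star p = p" "p * p = p" using p by (auto simp: projection_def)
  have red': "y * p = p * y * p" for y
    using arg_cong[OF red[of "star y"], of star] by (simp add: star_mult sp mult.assoc)
  define I where "I = {x. p * x * p = x}"
  have absorb: "x * y \<in> I" "y * x \<in> I" if xI: "x \<in> I" for x y
  proof -
    obtain z where z: "x = z *\<^sub>C p" using min[of x] xI by (auto simp: I_def)
    have "p * (p * y) * p = p * y"
      by (rule trans[OF _ red[symmetric]]) (simp add: sp flip: mult.assoc)
    moreover have "p * (y * p) * p = y * p"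
      by (rule trans[OF _ red'[symmetric]]) (simp add: sp mult.assoc)
    ultimately show "x * y \<in> I" "y * x \<in> I" by (simp_all add: I_def z)
  qed
  have "closed_ideal I"
    unfolding closed_ideal_def
  proof (intro conjI ballI allI)
    show "x * y \<in> I" "y * x \<in> I" if "x \<in> I" for x y by (rule absorb[OF that])+
    show "closed I" unfolding I_def by (intro closed_Collect_eq continuous_intros)
  qed (auto simp: I_def distrib_left distrib_right)
  then have "I = {0} \<or> I = UNIV" using simple by (simp add: simple_cstar_def)
  moreover have "p \<in> I" by (simp add: I_def sp)
  ultimately have "I = UNIV" using p(2) by auto
  then have "p * x * p = x" by (auto simp: I_def)
  then show ?thesis using min[of x] by simp
qed

text \<open>Without such a pair the corner is scalar. If \<open>p\<close> is central, the algebra is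
  isomorphic to the complex numbers, which the definition excludes. Otherwise some
  \<open>p y (1 - p)\<close> is nonzero, and rescaling it gives the partial isometry that
  \<open>minimal_projection_contradiction\<close> refutes.\<close>

lemma corner_orthogonal:
  fixes p :: "'a::cstar_algebra"
  assumes simple: "simple_cstar TYPE('a)" and tz: "tracially_Z_absorbing TYPE('a)"
    and p: "projection p" "p \<noteq> 0"
  shows "\<exists>s d. selfadj s \<and> selfadj d \<and> p * s = s \<and> p * d = d \<and> s * d = 0 \<and> s \<noteq> 0 \<and> d \<noteq> 0"
proof (rule ccontr)
  assume "\<not> ?thesis"
  then have no: "s = 0 \<or> d = 0"
    if "selfadj s" "selfadj d" "p * s = s" "p * d = d" "s * d = 0" for s d
    using that by blast
  have min: "\<exists>z. p * y * p = z *\<^sub>C p" for y by (rule corner_scalar[OF p(1) no])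
  have sp: "star p = p" "p * p = p" using p by (auto simp: projection_def)
  show False
  proof (cases "\<forall>y. p * y = p * y * p")
    case True
    then have "\<exists>z. x = z *\<^sub>C p" for x using scalar_corner_simple[OF simple p min] by blast
    from scalars_isomorphic_complex[OF p this] tz show False
      by (simp add: tracially_Z_absorbing_def)
  next
    case False
    then obtain y where "p * y \<noteq> p * y * p" by blast
    define b where "b = p * y - p * y * p"
    have b: "b \<noteq> 0" "p * b = b" "b * p = 0"
      using \<open>p * y \<noteq> p * y * p\<close> sp by (simp_all add: b_def algebra_simps flip: mult.assoc[of p p])
    have "star b * p = star b" using arg_cong[OF b(2), of star] sp by (simp add: star_mult)
    moreover have "p * (b * star b) * p = (p * b) * (star b * p)" by (simp only: mult.assoc)
    ultimately have bb: "p * (b * star b) * p = b * star b" by (simp add: b)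
    have "positive (star (star b) * star b)" unfolding positive_def by blast
    then have pos: "positive (b * star b)" by simp
    obtain z where "p * (b * star b) * p = z *\<^sub>C p" using min by blast
    from scalar_corner_positive[OF p this pos] obtain r where r: "r \<ge> 0" "b * star b = r *\<^sub>R p"
      unfolding bb by blast
    have "r \<noteq> 0"
    proof
      assume "r = 0"
      then have "norm (b * star b) = 0" using r by simp
      then show False using b(1) by (simp add: cstar_identity')
    qed
    define c where "c = (1 / sqrt r) *\<^sub>R b"
    have "c * star c = (1 / sqrt r * (1 / sqrt r) * r) *\<^sub>R p"
      by (simp add: c_def r(2))
    moreover have "1 / sqrt r * (1 / sqrt r) * r = 1" using r(1) \<open>r \<noteq> 0\<close> by (simp add: field_simps)
    ultimately have "c * star c = p" by simp
    moreover have "p * c = c" "c * p = 0" by (simp_all add: c_def b)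
    ultimately show False using minimal_projection_contradiction[OF tz p min] by blast
  qed
qed

lemma one_in_rspec:
  fixes a :: "'a::cstar_algebra"
  assumes "positive a" "norm a = 1"
  shows "1 \<in> rspec (embed a)"
proof (rule ccontr)
  assume "1 \<notin> rspec (embed a)"
  have sa: "selfadj (embed a)" using positive_selfadj[OF assms(1)] by simp
  obtain m where m: "m \<in> rspec (embed a)" "\<And>t. t \<in> rspec (embed a) \<Longrightarrow> t \<le> m"
    using compact_attains_sup[OF compact_rspec rspec_nonempty[OF sa]] by blast
  have "\<bar>t\<bar> \<le> m" if "t \<in> rspec (embed a)" for t
    using m(2)[OF that] positive_rspec[of "embed a" t] that assms(1) by simp
  then have "norm (embed a) \<le> m" by (rule norm_le_if_rspec_le[OF sa])
  moreover have "m \<le> 1" using rspec_norm[OF sa m(1)] assms(2) by simp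
  ultimately have "m = 1" using assms(2) by simp
  with m(1) \<open>1 \<notin> rspec (embed a)\<close> show False by simp
qed

text \<open>If \<open>1\<close> is not isolated in the spectrum of \<open>a\<close>, bump functions of \<open>a\<close> do; otherwise the corner of
  the spectral projection of \<open>a\<close> at \<open>1\<close> is used.\<close>

lemma orthogonal_pair_near_one:
  fixes a :: "'a::cstar_algebra"
  assumes simple: "simple_cstar TYPE('a)" and tz: "tracially_Z_absorbing TYPE('a)"
    and a: "positive a" "norm a = 1" and \<delta>: "0 < \<delta>" "\<delta> < 1"
  shows "\<exists>c s d l. selfadj c \<and> norm c \<le> 1 \<and> selfadj s \<and> selfadj d \<and> c * s = s \<and> c * d = d \<and>
    s * d = 0 \<and> s \<noteq> 0 \<and> d \<noteq> 0 \<and> selfadj l \<and> c = l * a * l \<and>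
    (1 - \<delta>) *\<^sub>R embed (c * c) \<preceq> embed (c * a * c)"
proof -
  have sa: "selfadj a" using positive_selfadj[OF a(1)] .
  have sA: "selfadj (embed a)" using sa by simp
  have one: "1 \<in> rspec (embed a)" by (rule one_in_rspec[OF a])
  have le1: "t \<le> 1" "t \<ge> 0" if "t \<in> rspec (embed a)" for t
    using rspec_norm[OF sA that] positive_rspec[OF _ that] a by auto
  have cutoff: "selfadj (afc f a)" "norm (afc f a) \<le> 1"
    "\<exists>l. selfadj l \<and> afc f a = l * a * l"
    "(1 - \<delta>) *\<^sub>R embed (afc f a * afc f a) \<preceq> embed (afc f a * a * afc f a)"
    if f: "continuous_on UNIV f" "\<And>t. 0 \<le> f t" "\<And>t. f t \<le> 1" "\<And>t. t \<le> 1 - \<delta> \<Longrightarrow> f t = 0" for f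
  proof -
    have f0: "f 0 = 0" using f(4) \<delta> by simp
    have cf: "continuous_on S f" for S using f(1) continuous_on_subset by blast
    note ef = afc_props(1)[OF sa f(1) f0]
    show "selfadj (afc f a)" by (rule afc_props(2)[OF sa f(1) f0])
    have "norm (rfc f (embed a)) \<le> 1"
      by (rule norm_rfc_le[OF sA cf]) (use f in auto)
    then show "norm (afc f a) \<le> 1" using norm_embed[of "afc f a"] by (simp add: ef)
    \<comment> \<open>A square root of \<open>f t / t\<close>, with the denominator altered only
      where \<open>f\<close> vanishes. It yields the factorization
      \<open>f(a) = g(a) a g(a)\<close>.\<close>
    define g where "g t = sqrt (f t / max t (1 - \<delta>))" for t
    have g: "continuous_on UNIV g" "g 0 = 0"
      unfolding g_def using f0 \<delta> by (auto intro!: continuous_intros f(1))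
    have cg: "continuous_on S g" for S using g(1) continuous_on_subset by blast
    have gf: "g t * t * g t = f t" for t
    proof (cases "t \<le> 1 - \<delta>")
      case True
      then show ?thesis using f(4) by (simp add: g_def)
    next
      case False
      then have "max t (1 - \<delta>) = t" "t > 0" using \<delta> by auto
      then have "g t * g t = f t / t" using f(2)[of t] by (simp add: g_def)
      then show ?thesis using \<open>t > 0\<close> by (simp add: field_simps)
    qed
    have cgt: "continuous_on S (\<lambda>t. g t * t)" for S
      by (rule continuous_on_mult[OF cg continuous_on_id])
    have "embed (afc g a * a * afc g a) = rfc (\<lambda>t. g t * t * g t) (embed a)"
      by (simp only: embed_mult afc_props(1)[OF sa g] rfc_mult[OF sA cg continuous_on_id]
          rfc_mult[OF sA cgt cg] rfc_id[OF sA])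
    also have "\<dots> = embed (afc f a)" by (simp only: gf ef)
    finally have "afc f a = afc g a * a * afc g a" by simp
    then show "\<exists>l. selfadj l \<and> afc f a = l * a * l" using afc_props(2)[OF sa g] by blast
    have cff: "continuous_on S (\<lambda>t. f t * f t)" for S by (intro continuous_on_mult cf)
    have cft: "continuous_on S (\<lambda>t. f t * t)" for S by (intro continuous_on_mult cf continuous_on_id)
    have "(1 - \<delta>) *\<^sub>R embed (afc f a * afc f a) = rfc (\<lambda>t. (1 - \<delta>) * (f t * f t)) (embed a)"
      by (simp only: rfc_cmult[OF sA cff] afc_mult[OF sa f(1) f0 f(1) f0])
    moreover have "embed (afc f a * a * afc f a) = rfc (\<lambda>t. f t * t * f t) (embed a)"
      by (simp only: embed_mult ef rfc_mult[OF sA cf continuous_on_id] rfc_mult[OF sA cft cf] rfc_id[OF sA])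
    moreover have "rfc (\<lambda>t. (1 - \<delta>) * (f t * f t)) (embed a) \<preceq> rfc (\<lambda>t. f t * t * f t) (embed a)"
    proof (rule rfc_mono[OF sA])
      show "(1 - \<delta>) * (f t * f t) \<le> f t * t * f t" for t
      proof (cases "t \<le> 1 - \<delta>")
        case False
        then have "(1 - \<delta>) * (f t * f t) \<le> t * (f t * f t)"
          using f(2)[of t] by (intro mult_right_mono) auto
        then show ?thesis by (simp add: mult_ac)
      qed (simp add: f(4))
    qed (intro continuous_on_mult cff cft cf continuous_on_const)+
    ultimately show "(1 - \<delta>) *\<^sub>R embed (afc f a * afc f a) \<preceq> embed (afc f a * a * afc f a)"
      by (simp only:)
  qed
  have ramp: "continuous_on UNIV (\<lambda>t. min 1 (max 0 ((t - (1 - \<delta>)) / \<kappa>)))"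
    "min 1 (max 0 ((t - (1 - \<delta>)) / \<kappa>)) = 0" if "\<kappa> > 0" "t \<le> 1 - \<delta>" for \<kappa> t :: real
  proof -
    show "continuous_on UNIV (\<lambda>t. min 1 (max 0 ((t - (1 - \<delta>)) / \<kappa>)))"
      using \<open>\<kappa> > 0\<close> by (intro continuous_intros) auto
    have "(t - (1 - \<delta>)) / \<kappa> \<le> 0" using that by (intro divide_nonpos_pos) auto
    then show "min 1 (max 0 ((t - (1 - \<delta>)) / \<kappa>)) = 0" by simp
  qed
  show ?thesis
  proof (cases "\<exists>t\<in>rspec (embed a). 1 - \<delta> < t \<and> t < 1")
    case True
    then obtain t0 where t0: "t0 \<in> rspec (embed a)" "1 - \<delta> < t0" "t0 < 1" by blast
    \<comment> \<open>So narrow that \<open>f\<close> has reached 1 from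
      \<open>t0 - \<kappa>\<close> on and is a unit for both bumps: \<open>f2\<close> lives within
      \<open>\<kappa>\<close> of \<open>t0\<close>, while \<open>f1\<close> starts at
      \<open>t0 + \<kappa> < 1\<close> and is nonzero at 1.\<close>
    define \<kappa> where "\<kappa> = min ((1 - t0) / 2) ((t0 - (1 - \<delta>)) / 2)"
    have "\<kappa> \<le> (1 - t0) / 2" "\<kappa> \<le> (t0 - (1 - \<delta>)) / 2"
      unfolding \<kappa>_def by (rule min.cobounded1, rule min.cobounded2)
    moreover have "\<kappa> > 0" using t0 by (simp add: \<kappa>_def)
    ultimately have \<kappa>: "\<kappa> > 0" "2 * \<kappa> \<le> 1 - t0" "2 * \<kappa> \<le> t0 - (1 - \<delta>)" by auto
    define f where "f t = min 1 (max 0 ((t - (1 - \<delta>)) / \<kappa>))" for t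
    define f1 where "f1 t = max 0 (t - (t0 + \<kappa>))" for t
    define f2 where "f2 t = max 0 (\<kappa> - \<bar>t - t0\<bar>)" for t
    have f: "continuous_on UNIV f" "\<And>t. 0 \<le> f t" "\<And>t. f t \<le> 1" "\<And>t. t \<le> 1 - \<delta> \<Longrightarrow> f t = 0"
      using ramp[OF \<kappa>(1)] by (auto simp: f_def)
    have f0: "f 0 = 0" using f(4) \<delta> by simp
    have f1: "continuous_on UNIV f1" "f1 0 = 0" and f2: "continuous_on UNIV f2" "f2 0 = 0"
      unfolding f1_def f2_def using t0 \<kappa> \<delta> by (auto intro!: continuous_intros)
    have fone: "f t = 1" if "t \<ge> t0 - \<kappa>" for t
    proof -
      have "(t - (1 - \<delta>)) / \<kappa> \<ge> 1" using that \<kappa> by (simp add: field_simps)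
      then show ?thesis by (simp add: f_def)
    qed
    have "f t * f1 t = f1 t" "f t * f2 t = f2 t" for t
      using fone[of t] \<kappa> by (auto simp: f1_def f2_def max_def)
    then have "embed (afc f a * afc f1 a) = embed (afc f1 a)" "embed (afc f a * afc f2 a) = embed (afc f2 a)"
      by (simp_all only: afc_mult[OF sa f(1) f0 f1] afc_mult[OF sa f(1) f0 f2] afc_props(1)[OF sa f1] afc_props(1)[OF sa f2])
    then have 1: "afc f a * afc f1 a = afc f1 a" "afc f a * afc f2 a = afc f2 a" by simp_all
    have "f1 t * f2 t = 0" for t by (auto simp: f1_def f2_def max_def)
    then have "embed (afc f1 a * afc f2 a) = rfc (\<lambda>_. 0) (embed a)"
      by (simp only: afc_mult[OF sa f1 f2])
    then have "embed (afc f1 a * afc f2 a) = 0" by (simp add: rfc_const[OF sA])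
    then have 2: "afc f1 a * afc f2 a = 0" by simp
    have 3: "afc f1 a \<noteq> 0" "afc f2 a \<noteq> 0"
      by (rule afc_nonzero[OF sa f1 one], use t0 \<kappa> in \<open>simp add: f1_def\<close>)
        (rule afc_nonzero[OF sa f2 t0(1)], use \<kappa> in \<open>simp add: f2_def\<close>)
    obtain l where "selfadj l" "afc f a = l * a * l" using cutoff(3)[OF f] by blast
    then show ?thesis
      by (intro exI[of _ "afc f a"] exI[of _ "afc f1 a"] exI[of _ "afc f2 a"] exI[of _ l] conjI
          cutoff[OF f] afc_props(2)[OF sa f1] afc_props(2)[OF sa f2] 1 2 3)
  next
    case False
    \<comment> \<open>This ramp reaches 1 exactly at 1. The spectrum has no point between
      \<open>1 - \<delta>\<close> and 1, so \<open>f\<close> takes only the values 0 and 1 on it and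
      \<open>f(a)\<close> is a projection.\<close>
    define f where "f t = min 1 (max 0 ((t - (1 - \<delta>)) / \<delta>))" for t
    have f: "continuous_on UNIV f" "\<And>t. 0 \<le> f t" "\<And>t. f t \<le> 1" "\<And>t. t \<le> 1 - \<delta> \<Longrightarrow> f t = 0"
      using ramp[OF \<delta>(1)] by (auto simp: f_def)
    have f0: "f 0 = 0" using f(4) \<delta> by simp
    have f1: "f 1 = 1" using \<delta> by (simp add: f_def)
    have dich: "t \<le> 1 - \<delta> \<or> t = 1" if "t \<in> rspec (embed a)" for t
      using False that le1[OF that] by force
    have "embed (afc f a * afc f a) = rfc (\<lambda>t. f t * f t) (embed a)"
      by (rule afc_mult[OF sa f(1) f0 f(1) f0])
    also have "\<dots> = rfc f (embed a)"
    proof (rule rfc_cong[OF sA])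
      show "continuous_on (rspec (embed a)) (\<lambda>t. f t * f t)"
        using f(1) continuous_on_subset by (intro continuous_on_mult) auto
      show "f t * f t = f t" if "t \<in> rspec (embed a)" for t
        using dich[OF that] f(4)[of t] f1 by auto
    qed
    also have "\<dots> = embed (afc f a)" by (rule afc_props(1)[OF sa f(1) f0, symmetric])
    finally have p: "projection (afc f a)"
      using cutoff(1)[OF f] by (simp add: projection_def)
    have "afc f a \<noteq> 0" by (rule afc_nonzero[OF sa f(1) f0 one]) (simp add: f1)
    from corner_orthogonal[OF simple tz p this] obtain s d where sd: "selfadj s" "selfadj d"
      "afc f a * s = s" "afc f a * d = d" "s * d = 0" "s \<noteq> 0" "d \<noteq> 0" by blast
    obtain l where "selfadj l" "afc f a = l * a * l" using cutoff(3)[OF f] by blast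
    then show ?thesis
      by (intro exI[of _ "afc f a"] exI[of _ s] exI[of _ d] exI[of _ l] conjI cutoff[OF f] sd)
  qed
qed

section \<open>Compressions by almost commuting contractions\<close>

lemma cstar_le_coeff:
  "positive S \<Longrightarrow> r \<le> r' \<Longrightarrow> r *\<^sub>R S \<preceq> r' *\<^sub>R (S :: 'a::unital_cstar_algebra)"
  unfolding cstar_le_def scaleR_diff_left[symmetric] by (rule positive_scaleR) auto

lemma positive_one: "positive (1 :: 'a::unital_cstar_algebra)"
  using positive_square[of "1 :: 'a"] by simp

lemma embed_le_perturb:
  fixes a b :: "'a::cstar_algebra"
  assumes "selfadj a" "selfadj b" "norm (a - b) \<le> r"
  shows "embed a \<preceq> embed b + r *\<^sub>R 1"
proof -
  have "embed (a - b) \<preceq> r *\<^sub>R 1"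
    using assms by (intro cstar_le_norm) (auto simp: star_diff)
  then show ?thesis by (simp add: cstar_le_def embed_diff algebra_simps)
qed

lemma norm_mult_le:
  "norm v \<le> r \<Longrightarrow> norm w \<le> q \<Longrightarrow> norm (v * w) \<le> r * (q :: real)" for v w :: "'a::real_normed_algebra"
  by (rule order_trans[OF norm_mult_ineq mult_mono]) (auto intro: order_trans[OF norm_ge_zero])

section \<open>Cuntz comparison with tolerances\<close>

lemma cuntz_trans:
  fixes a b c :: "'a::cstar_algebra"
  assumes "a \<precsim> b" "b \<precsim> c"
  shows "a \<precsim> c"
proof (rule cuntz_belowI)
  fix \<eta> :: real assume \<eta>: "\<eta> > 0"
  obtain v where v: "norm (a - v * b * star v) < \<eta> / 2"
    using cuntz_belowD[OF assms(1), of "\<eta> / 2"] \<eta> by auto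
  define M where "M = (norm v)\<^sup>2 + 1"
  have M: "M > 0" "(norm v)\<^sup>2 \<le> M" by (simp_all add: M_def add_nonneg_pos)
  obtain w where w: "norm (b - w * c * star w) < \<eta> / (2 * M)"
    using cuntz_belowD[OF assms(2), of "\<eta> / (2 * M)"] \<eta> M by auto
  have "norm (v * (b - w * c * star w) * star v) \<le> norm v * norm (b - w * c * star w) * norm (star v)"
    by (rule norm_mult3)
  also have "\<dots> = (norm v)\<^sup>2 * norm (b - w * c * star w)" by (simp add: power2_eq_square)
  also have "\<dots> \<le> M * (\<eta> / (2 * M))" using M w by (intro mult_mono) auto
  also have "\<dots> = \<eta> / 2" using M by simp
  finally have 2: "norm (v * (b - w * c * star w) * star v) \<le> \<eta> / 2" .
  have "a - (v * w) * c * star (v * w) = (a - v * b * star v) + v * (b - w * c * star w) * star v"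
    by (simp add: star_mult algebra_simps)
  then have "norm (a - (v * w) * c * star (v * w)) \<le> norm (a - v * b * star v) + norm (v * (b - w * c * star w) * star v)"
    by (simp only: norm_triangle_ineq)
  then have "norm (a - (v * w) * c * star (v * w)) \<le> \<eta>" using v 2 by simp
  then show "\<exists>v. norm (a - v * c * star v) \<le> \<eta>" by blast
qed

lemma cuntz_conj: "y * a * star y \<precsim> a"
  unfolding cuntz_below_def by (intro exI[of _ "\<lambda>_. y"]) simp

text \<open>\<open>K\<close> is chosen so that \<open>K (X - \<mu>) K\<close> is the cut-down of
  \<open>X\<close>; as \<open>X - \<mu>\<close> is below \<open>Y\<close>, the cut-down is below
  \<open>K Y K\<close>. This converts order estimates with an error into Cuntz comparisons.\<close>

lemma cut_down_cuntz_below: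
  fixes X Y :: "'a::cstar_algebra"
  assumes X: "positive X" and Y: "positive Y" and le: "embed X \<preceq> embed Y + \<mu> *\<^sub>R 1"
    and \<mu>: "0 \<le> \<mu>" "\<mu> < \<epsilon>"
  shows "cut_down X \<epsilon> \<precsim> Y"
proof -
  have sX: "selfadj X" using positive_selfadj[OF X] .
  have sE: "selfadj (embed X)" using sX by simp
  \<comment> \<open>The denominator is \<open>t - \<mu>\<close> wherever the numerator is nonzero
    and never drops below \<open>\<epsilon> - \<mu> > 0\<close>. As \<open>k 0 = 0\<close>, the
    element \<open>K\<close> stays in the algebra.\<close>
  define k where "k t = sqrt (max (t - \<epsilon>) 0 / (max t \<epsilon> - \<mu>))" for t
  have ne: "max t \<epsilon> - \<mu> > 0" for t using \<mu>(2) by (simp add: max_def)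
  have k: "continuous_on UNIV k" "k 0 = 0"
  proof -
    have "max t \<epsilon> - \<mu> \<noteq> 0" for t using ne[of t] by simp
    then show "continuous_on UNIV k" unfolding k_def by (intro continuous_intros ballI)
    show "k 0 = 0" using \<mu> by (simp add: k_def)
  qed
  have ck: "continuous_on S k" for S using k(1) continuous_on_subset by blast
  have ct: "continuous_on S (\<lambda>t. t - \<mu>)" for S by (intro continuous_intros)
  define K where "K = afc k X"
  have sK: "selfadj K" unfolding K_def by (rule afc_props(2)[OF sX k])
  have EK: "embed K = rfc k (embed X)" unfolding K_def by (rule afc_props(1)[OF sX k])
  have kk: "k t * (t - \<mu>) * k t = max (t - \<epsilon>) 0" for t
  proof -
    have "k t * k t = max (t - \<epsilon>) 0 / (max t \<epsilon> - \<mu>)"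
      using ne[of t] by (simp add: k_def)
    moreover have "k t * (t - \<mu>) * k t = (k t * k t) * (t - \<mu>)" by (simp only: mult_ac)
    ultimately have "k t * (t - \<mu>) * k t = max (t - \<epsilon>) 0 / (max t \<epsilon> - \<mu>) * (t - \<mu>)"
      by (simp only:)
    also have "\<dots> = max (t - \<epsilon>) 0"
      using \<mu> by (cases "t \<le> \<epsilon>") (auto simp: max_def)
    finally show ?thesis .
  qed
  have "embed K * (embed X - \<mu> *\<^sub>R 1) * embed K = rfc (\<lambda>t. k t * (t - \<mu>) * k t) (embed X)"
  proof -
    have "embed X - \<mu> *\<^sub>R 1 = rfc (\<lambda>t. t - \<mu>) (embed X)"
      by (simp only: rfc_diff[OF sE continuous_on_id continuous_on_const] rfc_id[OF sE] rfc_const[OF sE])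
    then show ?thesis
      by (simp only: EK rfc_mult[OF sE ck ct] rfc_mult[OF sE continuous_on_mult[OF ck ct] ck])
  qed
  also have "\<dots> = embed (cut_down X \<epsilon>)"
    unfolding kk using \<mu> by (intro embed_cut_down[OF sX, symmetric]) simp
  finally have G: "embed (cut_down X \<epsilon>) = embed K * (embed X - \<mu> *\<^sub>R 1) * embed K" by simp
  have "embed X - \<mu> *\<^sub>R 1 \<preceq> embed Y"
    using le by (simp add: cstar_le_def algebra_simps)
  from cstar_le_conj_selfadj[OF this, of "embed K"] sK
  have leK: "embed (cut_down X \<epsilon>) \<preceq> embed (K * Y * K) + 0 *\<^sub>R 1" by (simp add: G embed_mult)
  have posK: "positive (K * Y * K)" using positive_conj[OF Y, of K] sK by simp
  have "cut_down X \<epsilon> \<precsim> K * Y * K"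
  proof (rule cuntz_belowI)
    fix \<eta> :: real assume "\<eta> > 0"
    then show "\<exists>v. norm (cut_down X \<epsilon> - v * (K * Y * K) * star v) \<le> \<eta>"
      using majorant_conj[OF cut_down_le(1)[OF X] posK leK order_refl, of \<eta>] \<mu> by simp
  qed
  moreover have "K * Y * K \<precsim> Y" using cuntz_conj[of K Y] sK by simp
  ultimately show ?thesis by (rule cuntz_trans)
qed

text \<open>With \<open>N = x\<^sup>2 + c\<^sup>2\<close> and
  \<open>h = N (N + \<kappa>)\<^sup>-\<^sup>1\<close>, the norm of \<open>(1 - h) N (1 - h)\<close>
  is at most \<open>\<kappa> = \<eta>\<^sup>2\<close>. Both squares are below \<open>N\<close>, so
  one \<open>h\<close> serves both elements.\<close>

lemma approximate_unit_pair:
  fixes x c :: "'a::cstar_algebra"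
  assumes "selfadj x" "selfadj c" "\<eta> > 0"
  shows "\<exists>h. positive h \<and> norm h \<le> 1 \<and> norm (x - h * x) \<le> \<eta> \<and> norm (c - h * c) \<le> \<eta>"
proof -
  define N where "N = x * x + c * c"
  define \<kappa> where "\<kappa> = \<eta>\<^sup>2"
  have \<kappa>: "\<kappa> > 0" using assms(3) by (simp add: \<kappa>_def)
  have xx: "positive (embed (x * x))" "positive (embed (c * c))"
    using assms positive_square by simp_all
  have pN: "positive (embed N)" using positive_add[OF xx] by (simp add: N_def embed_add)
  have sE: "selfadj (embed N)" by (rule positive_selfadj[OF pN])
  have sN: "selfadj N" using sE by simp
  define g where "g t = max t 0 / (max t 0 + \<kappa>)" for t
  have ne: "max t 0 + \<kappa> > 0" for t using \<kappa> by (simp add: max_def)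
  have g: "continuous_on UNIV g" "g 0 = 0"
  proof -
    have "max t 0 + \<kappa> \<noteq> 0" for t using ne[of t] by simp
    then show "continuous_on UNIV g" unfolding g_def by (intro continuous_intros ballI)
    show "g 0 = 0" by (simp add: g_def)
  qed
  have cg: "continuous_on S g" for S using g(1) continuous_on_subset by blast
  have g01: "0 \<le> g t" "g t \<le> 1" for t
    using ne[of t] \<kappa> by (auto simp: g_def)
  define h where "h = afc g N"
  have Eh: "embed h = rfc g (embed N)" unfolding h_def by (rule afc_props(1)[OF sN g])
  have sh: "selfadj h" unfolding h_def by (rule afc_props(2)[OF sN g])
  have "positive (embed h)" unfolding Eh by (rule positive_rfc[OF sE cg g01(1)])
  then have ph: "positive h" by simp
  have "norm (embed h) \<le> 1"
    unfolding Eh by (rule norm_rfc_le[OF sE cg]) (use g01 in auto)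
  then have nh: "norm h \<le> 1" by simp
  define k where "k t = 1 - g t" for t
  have ck: "continuous_on S k" for S unfolding k_def by (intro continuous_intros cg)
  define K where "K = rfc k (embed N)"
  have K: "K = 1 - embed h"
    unfolding K_def k_def Eh by (simp add: rfc_diff[OF sE continuous_on_const cg] rfc_const[OF sE])
  have sK: "selfadj K" unfolding K_def by (rule rfc_selfadj[OF sE ck])
  have "norm (K * embed N * K) \<le> \<kappa>"
  proof -
    have "K * embed N * K = rfc (\<lambda>t. k t * t * k t) (embed N)"
      by (simp only: K_def rfc_id[OF sE] rfc_mult[OF sE ck continuous_on_id]
          rfc_mult[OF sE continuous_on_mult[OF ck continuous_on_id] ck])
    also have "norm \<dots> \<le> \<kappa>"
    proof (rule norm_rfc_le[OF sE])
      show "continuous_on (rspec (embed N)) (\<lambda>t. k t * t * k t)"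
        by (intro continuous_on_mult ck continuous_on_id)
      fix t assume "t \<in> rspec (embed N)"
      then have t: "t \<ge> 0" using positive_rspec[OF pN] by blast
      then have kt: "k t = \<kappa> / (t + \<kappa>)" using \<kappa> by (simp add: k_def g_def field_simps)
      have k0: "0 \<le> k t" "k t \<le> 1" using t \<kappa> by (simp_all add: kt)
      have kt2: "k t * t \<le> \<kappa>" using t \<kappa> by (simp add: kt divide_le_eq mult_left_mono)
      have "k t * t * k t \<le> \<kappa> * 1"
        using k0 kt2 \<kappa> by (intro mult_mono) auto
      then show "\<bar>k t * t * k t\<bar> \<le> \<kappa>" using k0 t by simp
    qed
    finally show ?thesis .
  qed
  have main: "norm (y - h * y) \<le> \<eta>" if y: "selfadj y" "embed (y * y) \<preceq> embed N" for y
  proof -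
    have "embed (y - h * y) = K * embed y" by (simp add: K embed_hom algebra_simps)
    moreover have sy: "star (embed y) = embed y" using y(1) by simp
    have "(K * embed y) * star (K * embed y) = K * embed (y * y) * K"
      by (simp only: star_mult sy sK embed_mult mult.assoc)
    ultimately have "(norm (y - h * y))\<^sup>2 = norm (K * embed (y * y) * K)"
      using cstar_identity'[of "K * embed y"] norm_embed[of "y - h * y"] by simp
    also have "norm (K * embed (y * y) * K) \<le> norm (K * embed N * K)"
    proof (rule norm_mono)
      show "positive (K * embed (y * y) * K)"
        using positive_conj[of "embed (y * y)" K] positive_square[OF y(1)] sK by simp
      show "K * embed (y * y) * K \<preceq> K * embed N * K" by (rule cstar_le_conj_selfadj[OF y(2) sK])
      show "selfadj (K * embed N * K)" by (simp only: star_mult sK sE mult.assoc)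
    qed
    also have "\<dots> \<le> \<kappa>" by fact
    finally have "(norm (y - h * y))\<^sup>2 \<le> \<eta>\<^sup>2" by (simp add: \<kappa>_def)
    then show ?thesis by (rule power2_le_imp_le) (use assms(3) in simp)
  qed
  have "embed (x * x) \<preceq> embed N" "embed (c * c) \<preceq> embed N"
    using xx by (simp_all add: cstar_le_def N_def embed_add)
  then show ?thesis using ph nh main assms by blast
qed

text \<open>Since \<open>h y\<close> is near \<open>y\<close>, the defect of \<open>e\<close> at
  \<open>y\<close> is nearly the defect at \<open>h\<close> conjugated by \<open>y\<close>. It is
  needed at \<open>y = x\<close> for (1) and at \<open>y = c\<close> for the contradiction behind
  (3).\<close>

lemma compressed_defect_le:
  fixes y h e :: "'a::cstar_algebra"
  assumes y: "selfadj y" "norm (y - h * y) \<le> \<eta>" and h: "positive h" "norm h \<le> 1"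
    and e: "positive e" "norm e \<le> 1" and \<epsilon>: "\<epsilon> \<ge> 0"
  defines "z \<equiv> cut_down (h * h - h * e * h) \<epsilon>"
  shows "embed (y * y - y * e * y) \<preceq> embed (y * z * y) + (\<epsilon> * (norm y)\<^sup>2 + 2 * norm y * \<eta>) *\<^sub>R 1"
proof -
  have sh: "selfadj h" and se: "selfadj e" using h e positive_selfadj by auto
  have sy: "selfadj (embed y)" using y by simp
  define H where "H = h * h - h * e * h"
  have H: "positive H" unfolding H_def by (rule positive_defect[OF sh e])
  have sH: "selfadj H" by (rule positive_selfadj[OF H])
  have "embed H \<preceq> embed z + \<epsilon> *\<^sub>R 1"
    unfolding z_def H_def[symmetric] by (rule cut_down_le(2)[OF H \<epsilon>])
  from cstar_le_conj_selfadj[OF this sy]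
  have 1: "embed (y * H * y) \<preceq> embed (y * z * y) + \<epsilon> *\<^sub>R embed (y * y)"
    by (simp add: embed_mult algebra_simps)
  have "embed (y * y) \<preceq> (norm y)\<^sup>2 *\<^sub>R 1"
    using y norm_mult_ineq[of y y] by (intro cstar_le_norm) (auto simp: star_mult power2_eq_square)
  from cstar_le_add[OF cstar_le_refl cstar_le_scaleR[OF this \<epsilon>], of "embed (y * z * y)"]
  have 2: "embed (y * z * y) + \<epsilon> *\<^sub>R embed (y * y) \<preceq> embed (y * z * y) + (\<epsilon> * (norm y)\<^sup>2) *\<^sub>R 1"
    by simp
  define m where "m = 1 - embed e"
  have nm: "norm m \<le> 1"
  proof -
    have "nonneg (embed e)" using e by (simp flip: positive_iff_nonneg)
    from nonneg_norm_le[OF this, of 1] e show ?thesis by (simp add: m_def)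
  qed
  define u where "u = embed (y - h * y)"
  have u: "norm u \<le> \<eta>" using y by (simp add: u_def)
  have \<eta>0: "\<eta> \<ge> 0" using u norm_ge_zero order_trans by blast
  have su: "star u = embed (y - y * h)" unfolding u_def using y(1) sh by (simp add: star_diff star_mult flip: embed_star)
  \<comment> \<open>Inserts the intermediate term \<open>y h (1 - e) y\<close>, replacing
    \<open>y\<close> by its compression on one side at a time.\<close>
  have E: "embed (y * y - y * e * y - y * H * y) = star u * m * embed y + embed (y * h) * m * u"
    unfolding su unfolding u_def m_def H_def by (simp add: embed_hom algebra_simps)
  have "norm (y * y - y * e * y - y * H * y) = norm (embed (y * y - y * e * y - y * H * y))"
    by (rule norm_embed[symmetric])
  also have "\<dots> \<le> norm (star u * m * embed y) + norm (embed (y * h) * m * u)"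
    unfolding E by (rule norm_triangle_ineq)
  also have "\<dots> \<le> \<eta> * 1 * norm y + norm y * 1 * \<eta>"
  proof (rule add_mono)
    have "norm (star u * m * embed y) \<le> norm (star u) * norm m * norm (embed y)" by (rule norm_mult3)
    also have "\<dots> \<le> \<eta> * 1 * norm y" using u nm \<eta>0 by (intro mult_mono) auto
    finally show "norm (star u * m * embed y) \<le> \<eta> * 1 * norm y" .
    have yh: "norm (embed (y * h)) \<le> norm y * 1"
      unfolding norm_embed by (rule order_trans[OF norm_mult_ineq]) (intro mult_left_mono h norm_ge_zero)
    have "norm (embed (y * h) * m * u) \<le> norm (embed (y * h)) * norm m * norm u" by (rule norm_mult3)
    also have "\<dots> \<le> norm y * 1 * \<eta>"
      using u nm \<eta>0 yh by (intro mult_mono) auto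
    finally show "norm (embed (y * h) * m * u) \<le> norm y * 1 * \<eta>" .
  qed
  finally have n: "norm (y * y - y * e * y - y * H * y) \<le> 2 * norm y * \<eta>" by (simp add: mult_ac)
  have "embed (y * y - y * e * y) \<preceq> embed (y * H * y) + (2 * norm y * \<eta>) *\<^sub>R 1"
    using y se sH n by (intro embed_le_perturb) (auto simp: star_diff star_mult mult.assoc)
  also have "\<dots> \<preceq> (embed (y * z * y) + (\<epsilon> * (norm y)\<^sup>2) *\<^sub>R 1) + (2 * norm y * \<eta>) *\<^sub>R 1"
    by (rule cstar_le_add[OF cstar_le_trans[OF 1 2] cstar_le_refl])
  also have "\<dots> = embed (y * z * y) + (\<epsilon> * (norm y)\<^sup>2 + 2 * norm y * \<eta>) *\<^sub>R 1"
    by (simp add: scaleR_add_left)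
  finally show ?thesis .
qed

text \<open>Up to commutators, \<open>\<sigma> c e\<^sup>2 c \<preceq> e c a c e \<preceq> (1 - \<epsilon>) c\<^sup>2\<close>, and \<open>2 \<sigma> e \<preceq> \<sigma>\<^sup>2 + e\<^sup>2\<close> turns this bound on
  \<open>e\<^sup>2\<close> into one on \<open>e\<close>.\<close>

lemma small_compression_le:
  fixes a c e :: "'a::cstar_algebra"
  assumes a: "positive a" "norm a = 1" and c: "selfadj c" "norm c \<le> 1" and e: "positive e" "norm e \<le> 1"
    and \<epsilon>: "0 < \<epsilon>" "\<epsilon> \<le> 1 / 2" and \<sigma>: "\<sigma> = 1 - \<epsilon> / 4"
    and ca: "\<sigma> *\<^sub>R embed (c * c) \<preceq> embed (c * a * c)"
    and comm: "norm (commutator e c) \<le> r"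
    and small: "norm (e * a * e) \<le> 1 - \<epsilon>"
  shows "embed (c * e * c) \<preceq> \<sigma> *\<^sub>R embed (c * c) + (4 * r) *\<^sub>R 1"
proof -
  have sa: "selfadj a" and se: "selfadj e" using a e positive_selfadj by auto
  have r0: "r \<ge> 0" using comm norm_ge_zero order_trans by blast
  have \<sigma>b: "0 < \<sigma>" "\<sigma> < 1" "\<sigma> \<ge> 7 / 8" using \<epsilon> by (simp_all add: \<sigma>)
  have comm': "norm (c * e - e * c) \<le> r" "norm (e * c - c * e) \<le> r"
    using comm by (simp_all add: commutator_def norm_minus_commute)
  have swap: "norm (c * e * b * e * c - e * c * b * c * e) \<le> 2 * r" if b: "norm b \<le> 1" for b
  proof -
    have le1: "norm (v * w) \<le> 1" if "norm v \<le> 1" "norm w \<le> 1" for v w :: 'a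
      by (rule order_trans[OF norm_mult_ineq]) (use that in \<open>simp add: mult_le_one\<close>)
    have "c * e * b * e * c - e * c * b * c * e = (c * e - e * c) * (b * (e * c)) + (e * c * b) * (e * c - c * e)"
      by (simp add: algebra_simps)
    then have "norm (c * e * b * e * c - e * c * b * c * e)
        \<le> norm ((c * e - e * c) * (b * (e * c))) + norm ((e * c * b) * (e * c - c * e))"
      by (simp only: norm_triangle_ineq)
    also have "\<dots> \<le> r * 1 + 1 * r"
    proof (rule add_mono)
      have "norm (b * (e * c)) \<le> 1" by (intro le1 b e c)
      then show "norm ((c * e - e * c) * (b * (e * c))) \<le> r * 1"
        by (rule norm_mult_le[OF comm'(1)])
      have "norm (e * c * b) \<le> 1" by (intro le1 b e c)
      then show "norm ((e * c * b) * (e * c - c * e)) \<le> 1 * r"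
        by (rule norm_mult_le[OF _ comm'(2)])
    qed
    finally show ?thesis by simp
  qed
  define Q where "Q = embed (c * e * c)"
  define S where "S = embed (c * c)"
  define R where "R = embed (c * e * e * c)"
  have pS: "positive S" unfolding S_def using positive_square[OF c(1)] by simp
  have "R \<preceq> embed (e * c * c * e) + (2 * r) *\<^sub>R 1"
  proof -
    have "norm (c * e * e * c - e * c * c * e) \<le> 2 * r"
    proof -
      have "c * e * e * c - e * c * c * e = (c * e - e * c) * (e * c) + (e * c) * (e * c - c * e)"
        by (simp add: algebra_simps)
      then have "norm (c * e * e * c - e * c * c * e) \<le> norm ((c * e - e * c) * (e * c)) + norm ((e * c) * (e * c - c * e))"
        by (simp only: norm_triangle_ineq)
      also have "\<dots> \<le> r * 1 + 1 * r"
      proof (rule add_mono)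
        have ec: "norm (e * c) \<le> 1"
          by (rule order_trans[OF norm_mult_ineq]) (use e c in \<open>simp add: mult_le_one\<close>)
        then show "norm ((c * e - e * c) * (e * c)) \<le> r * 1"
          by (rule norm_mult_le[OF comm'(1)])
        from ec show "norm ((e * c) * (e * c - c * e)) \<le> 1 * r"
          by (rule norm_mult_le[OF _ comm'(2)])
      qed
      finally show ?thesis by simp
    qed
    then show ?thesis unfolding R_def
      using c se by (intro embed_le_perturb) (auto simp: star_mult mult.assoc)
  qed
  from cstar_le_scaleR[OF this, of \<sigma>] \<sigma>b
  have 1: "\<sigma> *\<^sub>R R \<preceq> \<sigma> *\<^sub>R embed (e * c * c * e) + (\<sigma> * (2 * r)) *\<^sub>R 1"
    by (simp add: scaleR_add_right)
  have "\<sigma> *\<^sub>R embed (e * c * c * e) \<preceq> embed (e * c * a * c * e)"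
    using cstar_le_conj_selfadj[OF ca, of "embed e"] se by (simp add: embed_mult mult.assoc)
  moreover have "(\<sigma> * (2 * r)) *\<^sub>R 1 \<preceq> (2 * r) *\<^sub>R (1 :: 'a unitization)"
    using \<sigma>b r0 by (intro cstar_le_coeff positive_one) (simp add: mult_left_le_one_le)
  ultimately have 2: "\<sigma> *\<^sub>R embed (e * c * c * e) + (\<sigma> * (2 * r)) *\<^sub>R 1 \<preceq> embed (e * c * a * c * e) + (2 * r) *\<^sub>R 1"
    by (rule cstar_le_add)
  have "norm (e * c * a * c * e - c * e * a * e * c) \<le> 2 * r"
    using swap[of a] a by (simp add: norm_minus_commute)
  then have "embed (e * c * a * c * e) \<preceq> embed (c * e * a * e * c) + (2 * r) *\<^sub>R 1"
    using c se sa by (intro embed_le_perturb) (auto simp: star_mult mult.assoc)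
  from cstar_le_add[OF this cstar_le_refl, of "(2 * r) *\<^sub>R 1"]
  have 3: "embed (e * c * a * c * e) + (2 * r) *\<^sub>R 1 \<preceq> embed (c * e * a * e * c) + (4 * r) *\<^sub>R 1"
    by (simp add: add.assoc flip: scaleR_add_left)
  have "embed (e * a * e) \<preceq> (1 - \<epsilon>) *\<^sub>R 1"
    using se sa small by (intro cstar_le_norm) (auto simp: star_mult mult.assoc)
  from cstar_le_conj_selfadj[OF this, of "embed c"] c
  have "embed (c * e * a * e * c) \<preceq> (1 - \<epsilon>) *\<^sub>R S" by (simp add: S_def embed_mult mult.assoc)
  then have 4: "embed (c * e * a * e * c) + (4 * r) *\<^sub>R 1 \<preceq> (1 - \<epsilon>) *\<^sub>R S + (4 * r) *\<^sub>R 1"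
    by (rule cstar_le_add[OF _ cstar_le_refl])
  have h2: "\<sigma> *\<^sub>R R \<preceq> (1 - \<epsilon>) *\<^sub>R S + (4 * r) *\<^sub>R 1"
    by (rule cstar_le_trans[OF 1 cstar_le_trans[OF 2 cstar_le_trans[OF 3 4]]])
  have h1: "(2 * \<sigma>) *\<^sub>R Q \<preceq> \<sigma>\<^sup>2 *\<^sub>R S + R"
  proof -
    define w where "w = \<sigma> *\<^sub>R c - e * c"
    have "star w * w = \<sigma>\<^sup>2 *\<^sub>R (c * c) + c * e * e * c - (2 * \<sigma>) *\<^sub>R (c * e * c)"
      using c se by (simp add: w_def star_diff star_mult algebra_simps power2_eq_square scaleR_2
          flip: scaleR_add_left)
    then have "embed (star w * w) = \<sigma>\<^sup>2 *\<^sub>R S + R - (2 * \<sigma>) *\<^sub>R Q"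
      by (simp add: S_def R_def Q_def embed_add embed_diff embed_scaleR)
    moreover have "positive (star w * w)" unfolding positive_def by blast
    ultimately show ?thesis unfolding cstar_le_def by (metis positive_embed)
  qed
  have "(2 * \<sigma>\<^sup>2) *\<^sub>R Q = \<sigma> *\<^sub>R ((2 * \<sigma>) *\<^sub>R Q)" by (simp add: power2_eq_square mult_ac)
  also have "\<dots> \<preceq> \<sigma> *\<^sub>R (\<sigma>\<^sup>2 *\<^sub>R S + R)" using h1 \<sigma>b by (intro cstar_le_scaleR) auto
  also have "\<dots> = \<sigma> ^ 3 *\<^sub>R S + \<sigma> *\<^sub>R R" by (simp add: scaleR_add_right power3_eq_cube power2_eq_square)
  also have "\<dots> \<preceq> \<sigma> ^ 3 *\<^sub>R S + ((1 - \<epsilon>) *\<^sub>R S + (4 * r) *\<^sub>R 1)"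
    by (rule cstar_le_add[OF cstar_le_refl h2])
  also have "\<dots> = (\<sigma> ^ 3 + (1 - \<epsilon>)) *\<^sub>R S + (4 * r) *\<^sub>R 1" by (simp add: scaleR_add_left)
  also have "\<dots> \<preceq> (2 * \<sigma> ^ 3) *\<^sub>R S + (4 * r) *\<^sub>R 1"
  proof (rule cstar_le_add[OF cstar_le_coeff[OF pS] cstar_le_refl])
    \<comment> \<open>Origin of the quarter in \<open>\<sigma>\<close>: what is wanted is
      \<open>1 - \<epsilon> <= \<sigma> ^ 3\<close>, and Bernoulli's inequality gives
      \<open>1 - 3 \<epsilon> / 4 <= \<sigma> ^ 3\<close>.\<close>
    have "1 - \<epsilon> \<le> 1 + 3 * (- (\<epsilon> / 4))" using \<epsilon> by simp
    also have "\<dots> \<le> (1 + - (\<epsilon> / 4)) ^ 3"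
      using Bernoulli_inequality[of "- (\<epsilon> / 4)" 3] \<epsilon> by simp
    finally show "\<sigma> ^ 3 + (1 - \<epsilon>) \<le> 2 * \<sigma> ^ 3" by (simp add: \<sigma>)
  qed
  finally have "(2 * \<sigma>\<^sup>2) *\<^sub>R Q \<preceq> (2 * \<sigma> ^ 3) *\<^sub>R S + (4 * r) *\<^sub>R 1" .
  from cstar_le_scaleR[OF this, of "1 / (2 * \<sigma>\<^sup>2)"]
  have "Q \<preceq> \<sigma> *\<^sub>R S + (4 * r / (2 * \<sigma>\<^sup>2)) *\<^sub>R 1"
    using \<sigma>b by (simp add: scaleR_add_right power3_eq_cube power2_eq_square)
  also have "\<dots> \<preceq> \<sigma> *\<^sub>R S + (4 * r) *\<^sub>R 1"
  proof (rule cstar_le_add[OF cstar_le_refl cstar_le_coeff[OF positive_one]])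
    have "1 \<le> 2 * \<sigma>\<^sup>2" using mult_mono[OF \<sigma>b(3) \<sigma>b(3)] \<sigma>b by (simp add: power2_eq_square)
    then show "4 * r / (2 * \<sigma>\<^sup>2) \<le> 4 * r"
      using r0 mult_left_mono[of 1 "2 * \<sigma>\<^sup>2" "4 * r"] by (simp add: divide_le_eq)
  qed
  finally show ?thesis unfolding Q_def S_def .
qed

text \<open>Dividing by \<open>\<delta>\<close> reduces this to
  \<open>finite_not_subequivalent\<close>; the scaled form is needed because the order estimates
  only compare \<open>\<delta> c\<^sup>2\<close> with the defect.\<close>

lemma scaled_not_subequivalent:
  fixes c s d :: "'a::cstar_algebra"
  assumes fin: "finite_cstar TYPE('a)" and "selfadj c" "selfadj s" "selfadj d" "norm c \<le> 1"
    and "c * s = s" "c * d = d" "s * d = 0" "d \<noteq> 0" and "\<delta> > 0"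
  shows "norm (\<delta> *\<^sub>R (c * c) - w * (s * s) * star w) \<ge> \<delta>"
proof (rule ccontr)
  assume "\<not> ?thesis"
  then have lt: "norm (\<delta> *\<^sub>R (c * c) - w * (s * s) * star w) < \<delta>" by simp
  define u where "u = (1 / sqrt \<delta>) *\<^sub>R w"
  have "u * (s * s) * star u = (1 / sqrt \<delta> * (1 / sqrt \<delta>)) *\<^sub>R (w * (s * s) * star w)"
    by (simp add: u_def)
  also have "1 / sqrt \<delta> * (1 / sqrt \<delta>) = 1 / \<delta>" using assms(10) by simp
  finally have "c * c - u * (s * s) * star u = (1 / \<delta>) *\<^sub>R (\<delta> *\<^sub>R (c * c) - w * (s * s) * star w)"
    using assms(10) by (simp add: scaleR_diff_right)
  then have "norm (c * c - u * (s * s) * star u) = norm (\<delta> *\<^sub>R (c * c) - w * (s * s) * star w) / \<delta>"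
    using assms(10) by simp
  also have "\<dots> < 1" using lt assms(10) by simp
  finally show False using finite_not_subequivalent[OF fin assms(2-8)] assms(9) by blast
qed

theorem proposition7p12:
  fixes x a :: "'a::cstar_algebra" and F :: "'a set" and \<epsilon> :: real and n :: nat
  assumes "finite_cstar TYPE('a)"
    and "simple_cstar TYPE('a)"
    and "tracially_Z_absorbing TYPE('a)"
    and "positive x"
    and "positive a"
    and "norm a = 1"
    and "finite F"
    and "\<epsilon> > 0"
    and "n \<ge> 1"
  shows "\<exists>\<phi> :: complex mat \<Rightarrow> 'a. cpc_order_zero n \<phi> \<and>
    cut_down (x * x - x * \<phi> (1\<^sub>m n) * x) \<epsilon> \<precsim> a \<and>
    (\<forall>z \<in> carrier_mat n n. operator_norm z \<le> 1 \<longrightarrow>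
      (\<forall>b\<in>F. norm (commutator (\<phi> z) b) < \<epsilon>)) \<and>
    norm (\<phi> (1\<^sub>m n) * a * \<phi> (1\<^sub>m n)) > 1 - \<epsilon>"
proof -
  \<comment> \<open>\<open>small_compression_le\<close> requires a tolerance of at most 1/2, and the
    smaller tolerance proves more.\<close>
  define \<epsilon>' where "\<epsilon>' = min \<epsilon> (1 / 2)"
  have \<epsilon>': "0 < \<epsilon>'" "\<epsilon>' \<le> \<epsilon>" "\<epsilon>' \<le> 1 / 2" using assms(8) by (auto simp: \<epsilon>'_def)
  define \<delta> where "\<delta> = \<epsilon>' / 4"
  have \<delta>: "0 < \<delta>" "\<delta> < 1" using \<epsilon>' by (simp_all add: \<delta>_def)
  obtain c s d l where c: "selfadj c" "norm c \<le> 1" and s: "selfadj s" "s \<noteq> 0" and d: "selfadj d" "d \<noteq> 0"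
    and csd: "c * s = s" "c * d = d" "s * d = 0" and l: "selfadj l" "c = l * a * l"
    and ca: "(1 - \<delta>) *\<^sub>R embed (c * c) \<preceq> embed (c * a * c)"
    using orthogonal_pair_near_one[OF assms(2,3,5,6) \<delta>] by blast
  have sx: "selfadj x" using assms(4) by (rule positive_selfadj)
  define B where "B = norm x + 1"
  have B: "B \<ge> 1" "norm x \<le> B" by (simp_all add: B_def)
  \<comment> \<open>The 64 leaves room for both uses: the error at \<open>x\<close> is at most
    \<open>3 \<eta> B\<^sup>2\<close>, below \<open>\<epsilon>\<close>, and the final comparison
    loses less than \<open>9 \<eta>\<close>, below
    \<open>\<delta> = \<epsilon>' / 4\<close>.\<close>
  define \<eta> where "\<eta> = \<epsilon>' / (64 * B\<^sup>2)"
  have B2: "B\<^sup>2 \<ge> 1" "B \<le> B\<^sup>2" using B(1) by (simp_all add: self_le_power)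
  have \<eta>: "0 < \<eta>" "\<eta> * B\<^sup>2 = \<epsilon>' / 64" using \<epsilon>' B by (simp_all add: \<eta>_def)
  have \<eta>64: "\<eta> \<le> \<epsilon>' / 64" using mult_left_mono[OF B2(1), of \<eta>] \<eta> by simp
  obtain h where h: "positive h" "norm h \<le> 1" "norm (x - h * x) \<le> \<eta>" "norm (c - h * c) \<le> \<eta>"
    using approximate_unit_pair[OF sx c(1) \<eta>(1)] by blast
  have ss: "positive (s * s)" "s * s \<noteq> 0"
    using positive_square[OF s(1)] s cstar_identity[of s] by auto
  obtain \<phi> where \<phi>: "cpc_order_zero n \<phi>"
    and sub: "cut_down (h * h - h * \<phi> (1\<^sub>m n) * h) \<eta> \<precsim> s * s"
    and comm: "\<forall>z \<in> carrier_mat n n. operator_norm z \<le> 1 \<longrightarrow> (\<forall>b\<in>insert c F. norm (commutator (\<phi> z) b) < \<eta>)"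
    using tracially_Z_absorbingD[OF assms(3) h(1) ss _ \<eta>(1) assms(9), of "insert c F"] assms(7) by auto
  define e where "e = \<phi> (1\<^sub>m n)"
  have e: "positive e" "norm e \<le> 1" unfolding e_def by (rule cpc_one[OF \<phi>])+
  define z where "z = cut_down (h * h - h * e * h) \<eta>"
  have pz: "positive z"
    unfolding z_def using positive_defect[OF positive_selfadj[OF h(1)] e] \<eta>(1) by (intro cut_down_le(1)) auto
  have zss: "z \<precsim> s * s" using sub by (simp add: z_def e_def)
  have commF: "norm (commutator (\<phi> y) b) < \<epsilon>"
    if "y \<in> carrier_mat n n" "operator_norm y \<le> 1" "b \<in> F" for y b
  proof -
    have "norm (commutator (\<phi> y) b) < \<eta>" using comm that by blast
    then show ?thesis using \<eta>64 \<epsilon>' by linarith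
  qed
  have "cut_down (x * x - x * e * x) \<epsilon> \<precsim> a"
  proof -
    have "embed (x * x - x * e * x) \<preceq> embed (x * z * x) + (\<eta> * (norm x)\<^sup>2 + 2 * norm x * \<eta>) *\<^sub>R 1"
      unfolding z_def using \<eta>(1) by (intro compressed_defect_le[OF sx h(3,1,2) e]) simp
    moreover have "\<eta> * (norm x)\<^sup>2 + 2 * norm x * \<eta> < \<epsilon>"
    proof -
      have "(norm x)\<^sup>2 \<le> B\<^sup>2" using B by (intro power_mono) auto
      then have "\<eta> * (norm x)\<^sup>2 \<le> \<eta> * B\<^sup>2" using \<eta>(1) by (intro mult_left_mono) auto
      moreover have "\<eta> * norm x \<le> \<eta> * B\<^sup>2" using \<eta>(1) B B2 by (intro mult_left_mono) auto
      ultimately show ?thesis using \<eta>(2) \<epsilon>' by (simp add: mult_ac)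
    qed
    moreover have "0 \<le> \<eta> * (norm x)\<^sup>2 + 2 * norm x * \<eta>" using \<eta>(1) by simp
    moreover have "positive (x * z * x)" using positive_conj[OF pz, of x] sx by simp
    ultimately have 1: "cut_down (x * x - x * e * x) \<epsilon> \<precsim> x * z * x"
      using cut_down_cuntz_below[OF positive_defect[OF sx e]] by blast
    have 2: "x * z * x \<precsim> z" using cuntz_conj[of x z] sx by simp
    \<comment> \<open>Here the factor \<open>l\<close> is used: \<open>c = l a l\<close> is a unit
      for \<open>s\<close>, so \<open>s\<^sup>2\<close> is a conjugate of \<open>a\<close>.\<close>
    have "s * s = s * (c * s)" by (simp add: csd)
    also have "\<dots> = (s * l) * a * star (s * l)" using l s by (simp add: star_mult mult.assoc)
    finally have 3: "s * s \<precsim> a" using cuntz_conj[of "s * l" a] by simp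
    show ?thesis by (rule cuntz_trans[OF 1 cuntz_trans[OF 2 cuntz_trans[OF zss 3]]])
  qed
  moreover have "norm (e * a * e) > 1 - \<epsilon>'"
  proof (rule ccontr)
    assume "\<not> ?thesis"
    then have small: "norm (e * a * e) \<le> 1 - \<epsilon>'" by simp
    have "norm (commutator e c) < \<eta>"
      using comm operator_norm_one[of n] unfolding e_def by simp
    then have "norm (commutator e c) \<le> \<eta>" by simp
    from small_compression_le[OF assms(5,6) c e \<epsilon>'(1,3) _ ca this small]
    have "embed (c * e * c) \<preceq> (1 - \<delta>) *\<^sub>R embed (c * c) + (4 * \<eta>) *\<^sub>R 1"
      by (simp add: \<delta>_def)
    \<comment> \<open>The upper bound on \<open>c e c\<close> read the other way round: on the
      support of \<open>c\<close> the defect of \<open>e\<close> is at least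
      \<open>\<delta>\<close>, up to commutators.\<close>
    then have 1: "\<delta> *\<^sub>R embed (c * c) \<preceq> embed (c * c - c * e * c) + (4 * \<eta>) *\<^sub>R 1"
      by (simp add: cstar_le_def embed_diff algebra_simps)
    have 2: "embed (c * c - c * e * c) \<preceq> embed (c * z * c) + (\<eta> * (norm c)\<^sup>2 + 2 * norm c * \<eta>) *\<^sub>R 1"
      unfolding z_def using \<eta>(1) by (intro compressed_defect_le[OF c(1) h(4,1,2) e]) simp
    have 3: "(\<eta> * (norm c)\<^sup>2 + 2 * norm c * \<eta>) *\<^sub>R 1 \<preceq> (3 * \<eta>) *\<^sub>R (1 :: 'a unitization)"
    proof (rule cstar_le_coeff[OF positive_one])
      have "(norm c)\<^sup>2 \<le> 1" using c(2) by (simp add: power_le_one)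
      then have "\<eta> * (norm c)\<^sup>2 \<le> \<eta> * 1" using \<eta>(1) by (intro mult_left_mono) auto
      moreover have "norm c * \<eta> \<le> 1 * \<eta>" using \<eta>(1) c(2) by (intro mult_right_mono) auto
      ultimately show "\<eta> * (norm c)\<^sup>2 + 2 * norm c * \<eta> \<le> 3 * \<eta>" by simp
    qed
    have "embed (\<delta> *\<^sub>R (c * c)) \<preceq> (embed (c * z * c) + (3 * \<eta>) *\<^sub>R 1) + (4 * \<eta>) *\<^sub>R 1"
      unfolding embed_scaleR
      by (rule cstar_le_trans[OF 1 cstar_le_add[OF cstar_le_trans[OF 2 cstar_le_add[OF cstar_le_refl 3]] cstar_le_refl]])
    then have le: "embed (\<delta> *\<^sub>R (c * c)) \<preceq> embed (c * z * c) + (7 * \<eta>) *\<^sub>R 1"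
      by (simp add: add.assoc flip: scaleR_add_left)
    have pcc: "positive (\<delta> *\<^sub>R (c * c))"
    proof -
      have "positive (embed (\<delta> *\<^sub>R (c * c)))"
        unfolding embed_scaleR using positive_square[OF c(1)] \<delta> by (intro positive_scaleR) auto
      then show ?thesis by simp
    qed
    have pczc: "positive (c * z * c)" using positive_conj[OF pz, of c] c by simp
    obtain v where v: "norm (\<delta> *\<^sub>R (c * c) - v * (c * z * c) * star v) \<le> 7 * \<eta> + \<eta>"
      using majorant_conj[OF pcc pczc le, of \<eta>] \<eta>(1) by auto
    have "c * z * c \<precsim> z" using cuntz_conj[of c z] c by simp
    from cuntz_trans[OF cuntz_conj cuntz_trans[OF this zss]]
    have "v * (c * z * c) * star v \<precsim> s * s" .
    from cuntz_belowD[OF this \<eta>(1)]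
    obtain w where w: "norm (v * (c * z * c) * star v - w * (s * s) * star w) < \<eta>" by blast
    have "norm (\<delta> *\<^sub>R (c * c) - w * (s * s) * star w)
        \<le> norm (\<delta> *\<^sub>R (c * c) - v * (c * z * c) * star v) + norm (v * (c * z * c) * star v - w * (s * s) * star w)"
      by (rule norm_diff_triangle_ineq')
    also have "\<dots> < \<delta>" using v w \<eta>64 \<epsilon>' by (simp add: \<delta>_def)
    finally show False
      using scaled_not_subequivalent[OF assms(1) c(1) s(1) d(1) c(2) csd d(2) \<delta>(1), of w] by simp
  qed
  then have "norm (e * a * e) > 1 - \<epsilon>" using \<epsilon>' by simp
  ultimately show ?thesis using \<phi> commF unfolding e_def by blast
qed

end
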